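(* Let $n\ge1$ be an integer, let $\mu_1,\dots,\mu_{n+1}\in\mathbb R$, and let $B^{\mu_1},\dots,B^{\mu_{n+1}}$ be independent Brownian motions, $B^{\mu_j}$ having drift $\mu_j$ and starting at $0$. For $t>0$ define recursively ${}^{\mu_{n+1}}T_{0,t}=\sup\{s<t:B^{\mu_{n+1}}(s)=0\}$ and $${}^{\mu_j,\dots,\mu_{n+1}}T_{0,t}=\sup\{s<{}^{\mu_{j+1},\dots,\mu_{n+1}}T_{0,t}:B^{\mu_j}(s)=0\},\qquad j=n,n-1,\dots,1 .$$ Then ${}^{\mu_1,\dots,\mu_{n+1}}T_{0,t}$ has on $(0,t)$ the density $$\frac{P({}^{\mu_1,\dots,\mu_{n+1}}T_{0,t}\in da)}{da}=\int_a^t\int_{w_1}^t\cdots\int_{w_{n-1}}^tf_{\mu_1}(a;w_1)\,f_{\mu_2}(w_1;w_2)\cdots f_{\mu_n}(w_{n-1};w_n)\,f_{\mu_{n+1}}(w_n;t)\,dw_n\cdots dw_2\,dw_1 ,$$ where, for $0<x<w$, $f_\mu(x;w)$ denotes the density at $x$ of $\sup\{s<w:B^\mu(s)=0\}$. In particular, for $\mu_1=\dots=\mu_{n+1}=0$ the density equals $$\int_a^t\int_{w_1}^t\cdots\int_{w_{n-1}}^t\frac{1}{\pi\sqrt{a(w_1-a)}}\,\frac{1}{\pi\sqrt{w_1(w_2-w_1)}}\cdots\frac{1}{\pi\sqrt{w_n(t-w_n)}}\,dw_n\cdots dw_1 .$$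
   Context: A Brownian motion with drift $\mu$ started at $0$ is $B^\mu(s)=B(s)+\mu s$, $s\ge 0$, with $B$ a standard one-dimensional Brownian motion, $B(0)=0$. Suprema are over $s\ge 0$. The integration region is $0<a<w_1<w_2<\dots<w_n<t$ (for $n=1$ there is a single integral $\int_a^t\cdots dw_1$). Explicitly, $$f_\mu(x;w)=\frac{e^{-\frac{\mu^2w}{2}}}{\pi\sqrt{x(w-x)}}+\frac{\mu^2}{2\pi}\int_x^w\frac{e^{-\frac{\mu^2y}{2}}}{\sqrt{x(y-x)}}\,dy .$$ *)

theory Defs
  imports "HOL-Probability.Probability"
begin

text \<open>
  Processes have type \<open>real \<Rightarrow> 'a \<Rightarrow> real\<close> with the time first; only times \<open>s \<ge> 0\<close> matter.
  Paths are continuous and start at 0 for every point of the sample space, so that functionals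
  of the path such as the last zero are random variables without completing \<open>M\<close>.
\<close>

definition standard_brownian_motion :: "'a measure \<Rightarrow> (real \<Rightarrow> 'a \<Rightarrow> real) \<Rightarrow> bool" where
  "standard_brownian_motion M B \<longleftrightarrow>
     prob_space M \<and>
     (\<forall>s\<ge>0. B s \<in> borel_measurable M) \<and>
     (\<forall>\<omega>\<in>space M. B 0 \<omega> = 0) \<and>
     (\<forall>\<omega>\<in>space M. continuous_on {0..} (\<lambda>s. B s \<omega>)) \<and>
     (\<forall>r s. 0 \<le> r \<and> r < s \<longrightarrow>
        distributed M lborel (\<lambda>\<omega>. B s \<omega> - B r \<omega>) (\<lambda>x. ennreal (normal_density 0 (sqrt (s - r)) x))) \<and>
     (\<forall>(\<tau>::nat \<Rightarrow> real) k. 0 \<le> \<tau> 0 \<and> (\<forall>i<k. \<tau> i < \<tau> (Suc i)) \<longrightarrow>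
        prob_space.indep_vars M (\<lambda>_. borel) (\<lambda>i \<omega>. B (\<tau> (Suc i)) \<omega> - B (\<tau> i) \<omega>) {..<k})"

definition brownian_motion_drift :: "'a measure \<Rightarrow> real \<Rightarrow> (real \<Rightarrow> 'a \<Rightarrow> real) \<Rightarrow> bool" where
  "brownian_motion_drift M \<mu> X \<longleftrightarrow>
     (\<exists>B. standard_brownian_motion M B \<and> (\<forall>s\<ge>0. \<forall>\<omega>\<in>space M. X s \<omega> = B s \<omega> + \<mu> * s))"

definition indep_processes :: "'a measure \<Rightarrow> ('i \<Rightarrow> real \<Rightarrow> 'a \<Rightarrow> real) \<Rightarrow> 'i set \<Rightarrow> bool" where
  "indep_processes M X J \<longleftrightarrow>
     prob_space.indep_vars M (\<lambda>_. Pi\<^sub>M {0..} (\<lambda>_. borel)) (\<lambda>j \<omega>. \<lambda>s\<in>{0..}. X j s \<omega>) J"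

text \<open>
  For a path started at 0 and \<open>w > 0\<close> the set below contains 0. For \<open>w \<le> 0\<close> it is empty and the
  value is the unspecified constant \<open>Sup {}\<close>; in the nested construction this can occur only when
  an inner last zero equals 0, an event of probability 0.
\<close>

definition last_zero :: "(real \<Rightarrow> real) \<Rightarrow> real \<Rightarrow> real" where
  "last_zero x w = Sup {s. 0 \<le> s \<and> s < w \<and> x s = 0}"

primrec nested_last_zero :: "(real \<Rightarrow> real) list \<Rightarrow> real \<Rightarrow> real" where
  "nested_last_zero [] t = t"
| "nested_last_zero (x # xs) t = last_zero x (nested_last_zero xs t)"

definition last_zero_density :: "real \<Rightarrow> real \<Rightarrow> real \<Rightarrow> real" where
  "last_zero_density \<mu> x w =
     exp (- (\<mu>\<^sup>2 * w / 2)) / (pi * sqrt (x * (w - x))) +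
     \<mu>\<^sup>2 / (2 * pi) * (LBINT y:{x..w}. exp (- (\<mu>\<^sup>2 * y / 2)) / sqrt (x * (y - x)))"

text \<open>
  The iterated integral \<open>\<integral>\<^sub>a\<^sup>t \<integral>\<^bsub>w1\<^esub>\<^sup>t \<dots> \<integral>\<^bsub>w(n-1)\<^esub>\<^sup>t G [w1, \<dots>, wn] dwn \<dots> dw1\<close> of a nonnegative function.
\<close>

primrec iterated_integral :: "nat \<Rightarrow> real \<Rightarrow> real \<Rightarrow> (real list \<Rightarrow> ennreal) \<Rightarrow> ennreal" where
  "iterated_integral 0 a t G = G []"
| "iterated_integral (Suc n) a t G =
     (\<integral>\<^sup>+w\<in>{a<..<t}. iterated_integral n w t (\<lambda>ws. G (w # ws)) \<partial>lborel)"

text \<open>With \<open>w 0 = a\<close> and \<open>w (n + 1) = t\<close>, the integrand is \<open>g 1 (w 0) (w 1) * \<dots> * g (n + 1) (w n) (w (n + 1))\<close>.\<close>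

definition chain_integral :: "nat \<Rightarrow> (nat \<Rightarrow> real \<Rightarrow> real \<Rightarrow> real) \<Rightarrow> real \<Rightarrow> real \<Rightarrow> ennreal" where
  "chain_integral n g a t =
     iterated_integral n a t
       (\<lambda>ws. ennreal (\<Prod>j=1..n+1. g j ((a # ws @ [t]) ! (j - 1)) ((a # ws @ [t]) ! j)))"

end

theory Submission
  imports Defs "HOL-Real_Asymp.Real_Asymp"
begin

text \<open>
  Put \<open>g y = 1\<close> for \<open>y > 0\<close> and \<open>g y = - exp (- 2 * \<mu> * y)\<close> for \<open>y \<le> 0\<close>. The function
  \<open>h r y = E (g (y + B\<^sup>\<mu> r))\<close> vanishes at \<open>y = 0\<close>, so the martingale \<open>h (v - s) (B\<^sup>\<mu> s)\<close> contributes
  nothing once the path has hit 0; hence \<open>P (B\<^sup>\<mu> > 0 on [x, v)) = E (g (B\<^sup>\<mu> v); B\<^sup>\<mu> x > 0)\<close>. This reflection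
  principle with drift needs no strong Markov property: it is obtained by stopping at a small positive level on
  dyadic grids, whose mesh tends to 0 before the level does. Differentiating \<open>h\<close> in time gives the
  first-passage density; integrated against the law of \<open>B\<^sup>\<mu> x\<close> it yields the density
  \<open>exp (- \<mu>\<^sup>2 u / 2) \<surd>x / (\<pi> u \<surd>(u - x))\<close> of the first zero after \<open>x\<close>, whose integral over \<open>(x, v)\<close> is
  the complement of the distribution function of the last zero before \<open>v\<close>. For the nested last zeros, the inner
  one is a random time independent of the outer path, and the density is that of a mixture.
\<close>

section \<open>Gaussian computations\<close>

text \<open>Three obstacles shape the proof. \<open>survival\<close> is small near 0 only while the
  remaining time stays away from 0; so positivity is studied on [x, w] with evaluation at a later
  time v, and w moves up to v only at the end. A path seen on a grid may leap over the band between
  0 and the level \<eta>; for fixed \<eta> uniform continuity excludes this on fine grids, which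
  dictates the order of the two limits. For \<mu> > 0 the function g is unbounded, so the limits
  under the expectation rest on domination by an integrable function. The density is verified rather
  than derived: for \<mu> nonzero it is the driftless arcsine density with horizon min v \<xi>,
  where \<xi> is exponential with rate \<mu>^2/2, and exchanging two integrals makes its
  distribution function explicit. For the mixture the last zero must be jointly measurable in path
  and time, although the product sigma-algebra sees only countably many times; hence a description
  by rational times.\<close>

lemma nn_integral_FTC_open:
  fixes f F :: "real \<Rightarrow> real"
  assumes "a < b"
    and F: "\<And>x. a < x \<Longrightarrow> x < b \<Longrightarrow> (F has_real_derivative f x) (at x)"
    and f: "\<And>x. a < x \<Longrightarrow> x < b \<Longrightarrow> isCont f x"
    and nonneg: "\<And>x. a < x \<Longrightarrow> x < b \<Longrightarrow> 0 \<le> f x"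
    and A: "(F \<longlongrightarrow> A) (at_right a)" and B: "(F \<longlongrightarrow> B) (at_left b)"
  shows "(\<integral>\<^sup>+x. ennreal (f x) * indicator {a<..<b} x \<partial>lborel) = ennreal (B - A)"
proof -
  have A': "((F \<circ> real_of_ereal) \<longlongrightarrow> A) (at_right (ereal a))"
    using A by (simp add: ereal_tendsto_simps)
  have B': "((F \<circ> real_of_ereal) \<longlongrightarrow> B) (at_left (ereal b))"
    using B by (simp add: ereal_tendsto_simps)
  have int: "set_integrable lborel (einterval (ereal a) (ereal b)) f"
    and val: "(LBINT x=ereal a..ereal b. f x) = B - A"
    using interval_integral_FTC_nonneg[of "ereal a" "ereal b" F f A B] assms A' B' by auto
  have "einterval (ereal a) (ereal b) = {a<..<b}"
    by (auto simp: einterval_def)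
  with int val \<open>a < b\<close> have int: "integrable lborel (\<lambda>x. f x * indicator {a<..<b} x)"
    and val: "(\<integral>x. f x * indicator {a<..<b} x \<partial>lborel) = B - A"
    by (auto simp: set_integrable_def set_lebesgue_integral_def interval_lebesgue_integral_def
        mult.commute)
  have "(\<integral>\<^sup>+x. ennreal (f x) * indicator {a<..<b} x \<partial>lborel) =
      (\<integral>\<^sup>+x. ennreal (f x * indicator {a<..<b} x) \<partial>lborel)"
    by (intro nn_integral_cong) (auto split: split_indicator)
  also have "\<dots> = ennreal (B - A)"
    using int val nonneg by (subst nn_integral_eq_integral) (auto split: split_indicator)
  finally show ?thesis .
qed

section \<open>The standard normal distribution function\<close>

definition std_normal_cdf :: "real \<Rightarrow> real" where
  "std_normal_cdf x = cdf std_normal_distribution x"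

lemma has_bochner_integral_std_normal_cdf:
  "has_bochner_integral lborel (\<lambda>v. std_normal_density v * indicator {..x} v) (std_normal_cdf x)"
proof -
  interpret real_distribution std_normal_distribution by (rule real_dist_normal_dist)
  have int: "integrable lborel (\<lambda>v. std_normal_density v * indicator {..x} v)"
    by (intro integrable_real_mult_indicator) auto
  have "emeasure std_normal_distribution {..x} =
      (\<integral>\<^sup>+v. ennreal (std_normal_density v * indicator {..x} v) \<partial>lborel)"
    by (subst emeasure_density) (auto intro!: nn_integral_cong split: split_indicator)
  also have "\<dots> = ennreal (\<integral>v. std_normal_density v * indicator {..x} v \<partial>lborel)"
    using int by (subst nn_integral_eq_integral) auto
  finally have "std_normal_cdf x = (\<integral>v. std_normal_density v * indicator {..x} v \<partial>lborel)"
    unfolding std_normal_cdf_def cdf_def measure_def by (simp add: integral_nonneg)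
  with int show ?thesis
    by (simp add: has_bochner_integral_iff)
qed

lemma std_normal_density_minus: "std_normal_density (- v) = std_normal_density v"
  by (simp add: std_normal_density_def)

lemma std_normal_density_le_1: "std_normal_density v \<le> 1"
proof -
  have "1 / sqrt (2 * pi) \<le> 1"
    using pi_gt3 by (auto simp: divide_simps real_le_rsqrt)
  then have "1 / sqrt (2 * pi) * exp (- v\<^sup>2 / 2) \<le> 1 * 1"
    by (intro mult_mono) auto
  then show ?thesis by (simp add: std_normal_density_def)
qed

lemma isCont_std_normal_density: "isCont std_normal_density v"
proof -
  have "isCont (\<lambda>v. (1 / sqrt (2 * pi)) * exp (- v\<^sup>2 / 2)) v"
    by (intro continuous_intros) auto
  also have "(\<lambda>v. (1 / sqrt (2 * pi)) * exp (- v\<^sup>2 / 2)) = std_normal_density"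
    by (simp add: fun_eq_iff std_normal_density_def)
  finally show ?thesis .
qed

lemma DERIV_std_normal_cdf [derivative_intros]:
  assumes "(g has_real_derivative g') (at x)"
  shows "((\<lambda>x. std_normal_cdf (g x)) has_real_derivative std_normal_density (g x) * g') (at x)"
proof -
  have "(std_normal_cdf has_real_derivative std_normal_density y) (at y)" for y
  proof -
    \<comment> \<open>The base point minus infinity is replaced by y - 1, so that the fundamental
      theorem on a compact interval gives the derivative at y.\<close>
    have cont: "continuous_on {y - 1..y + 1} std_normal_density"
      using isCont_std_normal_density by (simp add: continuous_at_imp_continuous_on)
    have eq: "std_normal_cdf z = std_normal_cdf (y - 1) + integral {y - 1..z} std_normal_density"
      if "z \<in> {y - 1<..<y + 1}" for z
    proof -
      have "has_bochner_integral lborel (\<lambda>v. std_normal_density v * indicator {..z} v -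
          std_normal_density v * indicator {..y-1} v) (std_normal_cdf z - std_normal_cdf (y - 1))"
        by (intro has_bochner_integral_diff has_bochner_integral_std_normal_cdf)
      moreover have "(\<lambda>v. std_normal_density v * indicator {..z} v -
          std_normal_density v * indicator {..y-1} v) =
          (\<lambda>v. std_normal_density v * indicator {y-1<..z} v)"
        using that by (auto simp: fun_eq_iff split: split_indicator)
      ultimately have "has_bochner_integral lborel (\<lambda>v. std_normal_density v * indicator {y-1<..z} v)
          (std_normal_cdf z - std_normal_cdf (y - 1))" by simp
      then have "has_bochner_integral lborel (\<lambda>v. std_normal_density v * indicator {y-1..z} v)
          (std_normal_cdf z - std_normal_cdf (y - 1))"
      proof (rule has_bochner_integralI_AE)
        show "AE v in lborel. std_normal_density v * indicator {y-1<..z} v =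
            std_normal_density v * indicator {y-1..z} v"
          using AE_lborel_singleton[of "y - 1"] by eventually_elim (auto split: split_indicator)
      qed auto
      then have "(LBINT v:{y-1..z}. std_normal_density v) = std_normal_cdf z - std_normal_cdf (y - 1)"
        and "set_integrable lborel {y-1..z} std_normal_density"
        by (auto simp: has_bochner_integral_iff set_lebesgue_integral_def set_integrable_def mult.commute)
      then show ?thesis
        by (simp add: set_borel_integral_eq_integral)
    qed
    have "((\<lambda>z. std_normal_cdf (y - 1) + integral {y - 1..z} std_normal_density)
        has_real_derivative std_normal_density y) (at y within {y - 1..y + 1})"
      using integral_has_real_derivative[OF cont, of y] by (auto intro!: derivative_eq_intros)
    then have "((\<lambda>z. std_normal_cdf (y - 1) + integral {y - 1..z} std_normal_density)
        has_real_derivative std_normal_density y) (at y)"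
      by (simp add: at_within_Icc_at)
    then show ?thesis
      by (rule has_field_derivative_transform_within_open[where S="{y - 1<..<y + 1}"])
         (auto simp: eq)
  qed
  from DERIV_chain2[OF this assms] show ?thesis .
qed

lemma std_normal_cdf_Lipschitz: "\<bar>std_normal_cdf a - std_normal_cdf b\<bar> \<le> \<bar>a - b\<bar>"
proof -
  have "norm (std_normal_cdf a - std_normal_cdf b) \<le> 1 * norm (a - b)"
    by (rule field_differentiable_bound[of UNIV _ std_normal_density])
       (auto intro!: DERIV_std_normal_cdf[of "\<lambda>x. x" 1, simplified] simp: std_normal_density_le_1)
  then show ?thesis by simp
qed

lemma std_normal_cdf_le_1: "std_normal_cdf x \<le> 1"
  and std_normal_cdf_nonneg: "0 \<le> std_normal_cdf x"
  and std_normal_cdf_at_top: "(std_normal_cdf \<longlongrightarrow> 1) at_top"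
  and std_normal_cdf_at_bot: "(std_normal_cdf \<longlongrightarrow> 0) at_bot"
proof -
  interpret real_distribution std_normal_distribution by (rule real_dist_normal_dist)
  have *: "std_normal_cdf = cdf std_normal_distribution"
    by (simp add: fun_eq_iff std_normal_cdf_def)
  show "std_normal_cdf x \<le> 1" "0 \<le> std_normal_cdf x"
    "(std_normal_cdf \<longlongrightarrow> 1) at_top" "(std_normal_cdf \<longlongrightarrow> 0) at_bot"
    unfolding * by (auto intro: cdf_bounded_prob cdf_nonneg cdf_lim_at_top_prob cdf_lim_at_bot)
qed

text \<open>Multiplying the density of N(\<mu> r, r) by exp (- 2 \<mu> y) gives its mirror image,
  the density of N(- \<mu> r, r). The negative half-line thus contributes minus the mass of the
  positive one, and the expectation under N(\<mu> r, r) is 0.\<close>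

definition reflected_sign :: "real \<Rightarrow> real \<Rightarrow> real" where
  "reflected_sign \<mu> y = (if 0 < y then 1 else - exp (- 2 * \<mu> * y))"

lemma borel_measurable_reflected_sign [measurable]: "reflected_sign \<mu> \<in> borel_measurable borel"
  unfolding reflected_sign_def[abs_def] by measurable

text \<open>\<open>survival \<mu> r y\<close> is \<open>E (reflected_sign \<mu> (y + B\<^sup>\<mu> r))\<close>; for \<open>y > 0\<close> it is the probability that the path started at \<open>y\<close> has no zero up to time \<open>r\<close>.\<close>

definition survival :: "real \<Rightarrow> real \<Rightarrow> real \<Rightarrow> real" where
  "survival \<mu> r y = std_normal_cdf ((y + \<mu> * r) / sqrt r) -
     exp (- 2 * \<mu> * y) * std_normal_cdf ((\<mu> * r - y) / sqrt r)"

text \<open>Scaling by sqrt r reduces to a standard normal v, with the change of sign at v = - a. On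
  the upper half symmetry gives the first term of \<open>survival\<close>; on the lower half the
  exponential is absorbed by a shift of the normal density.\<close>

lemma has_bochner_integral_survival:
  assumes r: "0 < r"
  shows "has_bochner_integral lborel
    (\<lambda>z. normal_density 0 (sqrt r) z * reflected_sign \<mu> (y + \<mu> * r + z)) (survival \<mu> r y)"
proof -
  define q where "q = sqrt r"
  have q: "0 < q" "q\<^sup>2 = r" using r by (auto simp: q_def)
  define a where "a = (y + \<mu> * r) / q"
  have i1: "has_bochner_integral lborel (\<lambda>v. std_normal_density v * indicator {-a<..} v)
      (std_normal_cdf a)"
  proof -
    have "has_bochner_integral lborel
        (\<lambda>v. std_normal_density (0 + (-1) * v) * indicator {..a} (0 + (-1) * v))
        (std_normal_cdf a /\<^sub>R \<bar>-1\<bar>)"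
      using has_bochner_integral_std_normal_cdf[of a]
      by (subst (asm) lborel_has_bochner_integral_real_affine_iff[of "-1" _ _ 0]) auto
    then have "has_bochner_integral lborel
        (\<lambda>v. std_normal_density v * indicator {..a} (- v)) (std_normal_cdf a)"
      by (simp add: std_normal_density_minus)
    then show ?thesis
    proof (rule has_bochner_integralI_AE)
      show "AE v in lborel. std_normal_density v * indicator {..a} (- v) =
            std_normal_density v * indicator {-a<..} v"
        using AE_lborel_singleton[of "-a"] by eventually_elim (auto split: split_indicator)
    qed auto
  qed
  have i2: "has_bochner_integral lborel (\<lambda>v. std_normal_density v * indicator {..-a} v *
      exp (- 2 * \<mu> * (y + \<mu> * r + q * v))) (exp (-2 * \<mu> * y) * std_normal_cdf ((\<mu> * r - y) / q))"
  proof -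
    let ?b = "(\<mu> * r - y) / q"
    \<comment> \<open>The shift 2 \<mu> q completes the square v^2/2 + 2 \<mu> q v; the leftover
      constant 2 \<mu>^2 r is supplied by the drift term in the exponential.\<close>
    have "has_bochner_integral lborel
        (\<lambda>v. std_normal_density (2 * \<mu> * q + 1 * v) * indicator {..?b} (2 * \<mu> * q + 1 * v))
        (std_normal_cdf ?b /\<^sub>R \<bar>1\<bar>)"
      using has_bochner_integral_std_normal_cdf[of ?b]
      by (subst (asm) lborel_has_bochner_integral_real_affine_iff[of "1" _ _ "2 * \<mu> * q"]) auto
    then have "has_bochner_integral lborel (\<lambda>v. exp (-2 * \<mu> * y) *
        (std_normal_density (2 * \<mu> * q + v) * indicator {..?b} (2 * \<mu> * q + v)))
        (exp (-2 * \<mu> * y) * std_normal_cdf ?b)"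
      by (intro has_bochner_integral_mult_right) simp
    moreover have "exp (-2 * \<mu> * y) *
        (std_normal_density (2 * \<mu> * q + v) * indicator {..?b} (2 * \<mu> * q + v)) =
        std_normal_density v * indicator {..-a} v * exp (- 2 * \<mu> * (y + \<mu> * r + q * v))" for v
    proof -
      have "?b - 2 * \<mu> * q = - a"
        using q by (simp add: a_def field_simps power2_eq_square)
      then have "2 * \<mu> * q + v \<le> ?b \<longleftrightarrow> v \<le> - a" by linarith
      then have ind: "indicator {..?b} (2 * \<mu> * q + v) = (indicator {..-a} v :: real)"
        by (simp add: indicator_def)
      have "- 2 * \<mu> * y + - (2 * \<mu> * q + v)\<^sup>2 / 2 = - v\<^sup>2 / 2 + - 2 * \<mu> * (y + \<mu> * r + q * v)"
        unfolding q(2)[symmetric] by (simp add: field_simps power2_eq_square)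
      then have "exp (-2 * \<mu> * y) * exp (- (2 * \<mu> * q + v)\<^sup>2 / 2) =
          exp (- v\<^sup>2 / 2) * exp (- 2 * \<mu> * (y + \<mu> * r + q * v))"
        unfolding exp_add[symmetric] by (rule arg_cong)
      then show ?thesis
        unfolding std_normal_density_def ind by (simp add: mult.commute mult.left_commute)
    qed
    ultimately show ?thesis by simp
  qed
  have pos: "0 < y + \<mu> * r + q * v \<longleftrightarrow> - a < v" for v
    using q by (simp add: a_def field_simps) linarith
  have "has_bochner_integral lborel (\<lambda>v. std_normal_density v * reflected_sign \<mu> (y + \<mu> * r + q * v))
      (survival \<mu> r y)"
  proof -
    have "(\<lambda>v. std_normal_density v * reflected_sign \<mu> (y + \<mu> * r + q * v)) =
        (\<lambda>v. std_normal_density v * indicator {-a<..} v - std_normal_density v * indicator {..-a} v *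
      exp (- 2 * \<mu> * (y + \<mu> * r + q * v)))"
      by (auto simp: fun_eq_iff reflected_sign_def pos split: split_indicator)
    then show ?thesis
      unfolding survival_def
      using has_bochner_integral_diff[OF i1 i2] by (simp add: a_def q_def)
  qed
  moreover have "q * normal_density 0 q (q * v) = std_normal_density v" for v
    using q(1) by (simp add: normal_density_def std_normal_density_def power_mult_distrib
        real_sqrt_mult field_simps)
  ultimately have "has_bochner_integral lborel
      (\<lambda>v. q * (normal_density 0 q (q * v) * reflected_sign \<mu> (y + \<mu> * r + q * v))) (survival \<mu> r y)"
    by (simp add: mult.assoc[symmetric])
  from has_bochner_integral_mult_right[OF this, of "1/q"]
  have "has_bochner_integral lborel
      (\<lambda>v. (normal_density 0 q (0 + q * v) * reflected_sign \<mu> (y + \<mu> * r + (0 + q * v))))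
      (survival \<mu> r y /\<^sub>R \<bar>q\<bar>)"
    using q(1) by (simp add: divide_inverse_commute mult.assoc[symmetric])
  then show ?thesis
    using q(1) by (subst lborel_has_bochner_integral_real_affine_iff[of q _ _ 0]) (auto simp: q_def)
qed

text \<open>At y = 0 the two values of \<open>std_normal_cdf\<close> coincide and the prefactor is
  1. The bound \<open>?h\<close> involves r only through its lower bound \<delta>; this uniformity
  is needed because the path may be stopped at any grid time.\<close>

lemma survival_small:
  assumes "0 < \<delta>" "0 < c"
  shows "\<exists>\<epsilon>>0. \<forall>r\<ge>\<delta>. \<forall>y. 0 \<le> y \<and> y \<le> \<epsilon> \<longrightarrow> \<bar>survival \<mu> r y\<bar> \<le> c"
proof -
  let ?h = "\<lambda>y. 2 * y / sqrt \<delta> + \<bar>exp (- 2 * \<mu> * y) - 1\<bar>"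
  have bound: "\<bar>survival \<mu> r y\<bar> \<le> ?h y" if "\<delta> \<le> r" "0 \<le> y" for r y
  proof -
    let ?a = "std_normal_cdf ((y + \<mu> * r) / sqrt r)" and ?b = "std_normal_cdf ((\<mu> * r - y) / sqrt r)"
    have "\<bar>?a - ?b\<bar> \<le> \<bar>(y + \<mu> * r) / sqrt r - (\<mu> * r - y) / sqrt r\<bar>"
      by (rule std_normal_cdf_Lipschitz)
    also have "\<dots> = 2 * y / sqrt r"
      using that assms by (simp add: diff_divide_distrib[symmetric])
    also have "\<dots> \<le> 2 * y / sqrt \<delta>"
      using that assms by (intro divide_left_mono) auto
    finally have 1: "\<bar>?a - ?b\<bar> \<le> 2 * y / sqrt \<delta>" .
    have "\<bar>(exp (- 2 * \<mu> * y) - 1) * ?b\<bar> \<le> \<bar>exp (- 2 * \<mu> * y) - 1\<bar> * 1"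
      unfolding abs_mult
      by (intro mult_left_mono) (auto simp: std_normal_cdf_le_1 std_normal_cdf_nonneg)
    moreover have "survival \<mu> r y = (?a - ?b) - (exp (- 2 * \<mu> * y) - 1) * ?b"
      by (simp add: survival_def algebra_simps)
    ultimately show ?thesis
      using 1 abs_triangle_ineq4[of "?a - ?b" "(exp (- 2 * \<mu> * y) - 1) * ?b"] by simp
  qed
  have "isCont ?h 0" using assms by (intro continuous_intros) auto
  then have "(?h \<longlongrightarrow> 0) (at 0)" by (simp add: isCont_def)
  then have "eventually (\<lambda>y. ?h y < c) (at 0)"
    using assms(2) by (rule order_tendstoD)
  then obtain d where d: "d > 0" "\<And>y. y \<noteq> 0 \<Longrightarrow> \<bar>y\<bar> < d \<Longrightarrow> ?h y < c"
    by (auto simp: eventually_at dist_real_def)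
  show ?thesis
  proof (intro exI[of _ "d/2"] conjI allI impI)
    fix r y assume ry: "\<delta> \<le> r" "0 \<le> y \<and> y \<le> d/2"
    have "?h y \<le> c"
      using d(2)[of y] ry d(1) assms by (cases "y = 0") auto
    then show "\<bar>survival \<mu> r y\<bar> \<le> c"
      using bound[of r y] ry by linarith
  qed (use d in auto)
qed

text \<open>The density at \<open>s\<close> of the first zero of the path started at \<open>y > 0\<close>.\<close>

definition hitting_density :: "real \<Rightarrow> real \<Rightarrow> real \<Rightarrow> real" where
  "hitting_density \<mu> y s = y / sqrt (2 * pi * s ^ 3) * exp (- (y + \<mu> * s)\<^sup>2 / (2 * s))"

text \<open>In the time variable \<open>- survival\<close> is a primitive of the hitting density,
  and survival from y > 0 tends to 1 as the time tends to 0.\<close>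

lemma nn_integral_hitting_density:
  assumes y: "0 < y" and r: "0 < r"
  shows "(\<integral>\<^sup>+s. ennreal (hitting_density \<mu> y s) * indicator {0<..<r} s \<partial>lborel) =
    ennreal (1 - survival \<mu> r y)"
proof -
  let ?F = "\<lambda>s. - survival \<mu> s y"
  have "(\<integral>\<^sup>+s. ennreal (hitting_density \<mu> y s) * indicator {0<..<r} s \<partial>lborel) =
      ennreal (?F r - (- 1))"
  proof (rule nn_integral_FTC_open[OF r])
    fix s :: real assume "0 < s" "s < r"
    then have s: "0 < s" by simp
    show "isCont (hitting_density \<mu> y) s"
      unfolding hitting_density_def[abs_def] using s by (intro continuous_intros) auto
    show "0 \<le> hitting_density \<mu> y s"
      using y s by (simp add: hitting_density_def)
  next
    fix s :: real assume "0 < s"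
    define q where "q = sqrt s"
    have q: "0 < q" "s = q\<^sup>2" using \<open>0 < s\<close> by (auto simp: q_def)
    have d1: "((\<lambda>s. (y + \<mu> * s) / sqrt s) has_real_derivative
        (\<mu> * s - y) / (2 * q ^ 3)) (at s)"
      using \<open>0 < s\<close> q(1)
      by (auto intro!: derivative_eq_intros simp: q_def[symmetric])
         (simp add: q(2) field_simps power2_eq_square power3_eq_cube)
    have d2: "((\<lambda>s. (\<mu> * s - y) / sqrt s) has_real_derivative
        (\<mu> * s + y) / (2 * q ^ 3)) (at s)"
      using \<open>0 < s\<close> q(1)
      by (auto intro!: derivative_eq_intros simp: q_def[symmetric])
         (simp add: q(2) field_simps power2_eq_square power3_eq_cube)
    \<comment> \<open>Both terms of the derivative carry the same Gaussian factor; in their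
      difference \<mu> s cancels and only y / q^3 remains.\<close>
    have dens: "exp (- 2 * \<mu> * y) * std_normal_density ((\<mu> * s - y) / q) =
        std_normal_density ((y + \<mu> * s) / q)"
    proof -
      have "- 2 * \<mu> * y + - ((\<mu> * s - y) / q)\<^sup>2 / 2 = - ((y + \<mu> * s) / q)\<^sup>2 / 2"
        using q(1) by (simp add: q(2) field_simps power2_eq_square)
      then have "exp (- 2 * \<mu> * y) * exp (- ((\<mu> * s - y) / q)\<^sup>2 / 2) = exp (- ((y + \<mu> * s) / q)\<^sup>2 / 2)"
        unfolding exp_add[symmetric] by (rule arg_cong)
      then show ?thesis by (simp add: std_normal_density_def)
    qed
    have hit: "hitting_density \<mu> y s = std_normal_density ((y + \<mu> * s) / q) * (y / q ^ 3)"
    proof -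
      have "sqrt (2 * pi * s ^ 3) = sqrt (2 * pi) * q ^ 3"
        by (simp add: real_sqrt_mult real_sqrt_power q_def)
      moreover have "- (y + \<mu> * s)\<^sup>2 / (2 * s) = - ((y + \<mu> * s) / q)\<^sup>2 / 2"
        using q(1) by (simp add: q(2) power_divide)
      ultimately show ?thesis
        by (simp add: hitting_density_def std_normal_density_def)
    qed
    have "(?F has_real_derivative
        - (std_normal_density ((y + \<mu> * s) / q) * ((\<mu> * s - y) / (2 * q ^ 3)) -
           exp (- 2 * \<mu> * y) * (std_normal_density ((\<mu> * s - y) / q) * ((\<mu> * s + y) / (2 * q ^ 3))))) (at s)"
      unfolding survival_def q_def
      using d1 d2 by (intro derivative_intros DERIV_cmult DERIV_std_normal_cdf) (auto simp: q_def)
    also have "- (std_normal_density ((y + \<mu> * s) / q) * ((\<mu> * s - y) / (2 * q ^ 3)) -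
           exp (- 2 * \<mu> * y) * (std_normal_density ((\<mu> * s - y) / q) * ((\<mu> * s + y) / (2 * q ^ 3)))) =
        hitting_density \<mu> y s"
      unfolding mult.assoc[symmetric] dens hit using q(1) by (simp add: field_simps)
    finally show "(?F has_real_derivative hitting_density \<mu> y s) (at s)" .
  next
    have "filterlim (\<lambda>s. (y + \<mu> * s) / sqrt s) at_top (at_right 0)"
      using y by real_asymp
    then have 1: "((\<lambda>s. std_normal_cdf ((y + \<mu> * s) / sqrt s)) \<longlongrightarrow> 1) (at_right 0)"
      by (rule filterlim_compose[OF std_normal_cdf_at_top])
    have "filterlim (\<lambda>s. (\<mu> * s - y) / sqrt s) at_bot (at_right 0)"
      using y by real_asymp
    then have 2: "((\<lambda>s. std_normal_cdf ((\<mu> * s - y) / sqrt s)) \<longlongrightarrow> 0) (at_right 0)"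
      by (rule filterlim_compose[OF std_normal_cdf_at_bot])
    have "((\<lambda>s. - survival \<mu> s y) \<longlongrightarrow> - (1 - exp (- 2 * \<mu> * y) * 0)) (at_right 0)"
      unfolding survival_def by (intro tendsto_intros 1 2)
    then show "((\<lambda>s. - survival \<mu> s y) \<longlongrightarrow> - 1) (at_right 0)" by simp
  next
    have c: "isCont (\<lambda>s. std_normal_cdf (g s)) r" if "isCont g r" for g
    proof -
      have "isCont std_normal_cdf (g r)"
        using DERIV_std_normal_cdf[of "\<lambda>x. x" 1 "g r"] by (auto intro: DERIV_isCont)
      from isCont_o2[OF that this] show ?thesis .
    qed
    have "isCont (\<lambda>s. - survival \<mu> s y) r"
      unfolding survival_def using r by (intro continuous_intros c) auto
    then show "((\<lambda>s. - survival \<mu> s y) \<longlongrightarrow> - survival \<mu> r y) (at_left r)"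
      by (auto simp: isCont_def intro: tendsto_within_subset filterlim_mono at_le)
  qed
  then show ?thesis by simp
qed

section \<open>The reflection principle with drift\<close>

text \<open>Halving the mesh keeps the old points, so that \<open>grid_above\<close> decreases in N.
  For a < b, indices above 2^N give points beyond b.\<close>

definition dyadic_grid :: "real \<Rightarrow> real \<Rightarrow> nat \<Rightarrow> nat \<Rightarrow> real" where
  "dyadic_grid a b N i = a + (b - a) * real i / 2 ^ N"

lemma dyadic_grid_less: "a < b \<Longrightarrow> i < j \<Longrightarrow> dyadic_grid a b N i < dyadic_grid a b N j"
  by (simp add: dyadic_grid_def divide_strict_right_mono)

lemma dyadic_grid_0 [simp]: "dyadic_grid a b N 0 = a"
  by (simp add: dyadic_grid_def)

lemma dyadic_grid_ge: "a < b \<Longrightarrow> a \<le> dyadic_grid a b N i"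
  by (simp add: dyadic_grid_def)

lemma dyadic_grid_le:
  assumes "a < b" "i \<le> 2 ^ N"
  shows "dyadic_grid a b N i \<le> b"
proof -
  have "real i / 2 ^ N \<le> 1"
    using assms(2) by (simp add: divide_simps)
  then have "(b - a) * (real i / 2 ^ N) \<le> (b - a) * 1"
    using assms(1) by (intro mult_left_mono) auto
  then show ?thesis by (simp add: dyadic_grid_def)
qed

lemma dyadic_grid_refine: "dyadic_grid a b N i = dyadic_grid a b (Suc N) (2 * i)"
  by (simp add: dyadic_grid_def)

lemma dyadic_grid_mesh: "dyadic_grid a b N (Suc i) - dyadic_grid a b N i = (b - a) / 2 ^ N"
  by (simp add: dyadic_grid_def field_simps)

lemma dyadic_mesh_small: "0 < d \<Longrightarrow> eventually (\<lambda>N. (b - a) / 2 ^ N < (d::real)) sequentially"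
proof -
  assume "0 < d"
  have "(\<lambda>N. (b - a) * (1/2) ^ N) \<longlonglongrightarrow> (b - a) * 0"
    by (intro tendsto_intros LIMSEQ_power_zero) auto
  then have "(\<lambda>N. (b - a) / 2 ^ N) \<longlonglongrightarrow> 0"
    by (simp add: power_one_over)
  then show ?thesis using \<open>0 < d\<close> by (rule order_tendstoD)
qed

text \<open>Uniform continuity. Applied to each path separately, it excludes leaps over the band
  below the level once the grid is fine.\<close>

lemma dyadic_grid_oscillation:
  fixes p :: "real \<Rightarrow> real"
  assumes "a < b" and "continuous_on {a..b} p" and "0 < \<eta>"
  shows "eventually (\<lambda>N. \<forall>i<2^N. \<bar>p (dyadic_grid a b N (Suc i)) - p (dyadic_grid a b N i)\<bar> \<le> \<eta>) sequentially"
proof -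
  have "uniformly_continuous_on {a..b} p"
    using assms by (intro compact_uniformly_continuous) auto
  then obtain d where d: "d > 0" "\<And>s s'. s \<in> {a..b} \<Longrightarrow> s' \<in> {a..b} \<Longrightarrow> dist s' s < d \<Longrightarrow> dist (p s') (p s) < \<eta>"
    using \<open>0 < \<eta>\<close> unfolding uniformly_continuous_on_def by metis
  from dyadic_mesh_small[OF d(1), of b a] show ?thesis
  proof eventually_elim
    case (elim N)
    show ?case
    proof (intro allI impI)
      fix i :: nat assume i: "i < 2 ^ N"
      have "dist (p (dyadic_grid a b N (Suc i))) (p (dyadic_grid a b N i)) < \<eta>"
        using elim i assms(1) dyadic_grid_mesh[of a b N i]
        by (intro d(2)) (auto simp: dist_real_def dyadic_grid_ge intro!: dyadic_grid_le)
      then show "\<bar>p (dyadic_grid a b N (Suc i)) - p (dyadic_grid a b N i)\<bar> \<le> \<eta>"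
        by (simp add: dist_real_def)
    qed
  qed
qed

lemma dyadic_grid_witness:
  fixes p :: "real \<Rightarrow> real"
  assumes "a < b" and "continuous_on {a..b} p" and "0 < \<eta>" and s: "s \<in> {a..b}"
  shows "\<exists>N. \<exists>i\<le>2^N. p (dyadic_grid a b N i) < p s + \<eta>"
proof -
  obtain d where d: "d > 0" "\<And>s'. s' \<in> {a..b} \<Longrightarrow> dist s' s < d \<Longrightarrow> dist (p s') (p s) < \<eta>"
    using assms unfolding continuous_on_iff by metis
  obtain N where N: "(b - a) / 2 ^ N < d"
    using dyadic_mesh_small[OF d(1), of b a] by (auto simp: eventually_sequentially)
  \<comment> \<open>The index of the last grid point not after s.\<close>
  define i where "i = nat \<lfloor>(s - a) * 2 ^ N / (b - a)\<rfloor>"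
  let ?u = "(s - a) * 2 ^ N / (b - a)"
  have u: "0 \<le> ?u" "?u \<le> 2 ^ N"
    using s assms(1) by (auto simp: divide_simps mult_right_mono)
  have i: "real i \<le> ?u" "?u < real i + 1"
    using u(1) by (auto simp: i_def)
  have "real i \<le> real (2 ^ N)" using i(1) u(2) unfolding of_nat_power of_nat_numeral by linarith
  then have "i \<le> 2 ^ N" by (simp only: of_nat_le_iff)
  have g: "s - dyadic_grid a b N i = (b - a) / 2 ^ N * (?u - real i)"
    using assms(1) by (simp add: dyadic_grid_def field_simps)
  have "0 \<le> (b - a) / 2 ^ N * (?u - real i)" "(b - a) / 2 ^ N * (?u - real i) \<le> (b - a) / 2 ^ N * 1"
    using i assms(1) by (intro mult_nonneg_nonneg mult_left_mono; auto)+
  then have "dist (dyadic_grid a b N i) s < d"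
    using N g by (simp add: dist_real_def)
  then have "dist (p (dyadic_grid a b N i)) (p s) < \<eta>"
    using assms(1) \<open>i \<le> 2 ^ N\<close> by (intro d(2)) (auto simp: dyadic_grid_ge intro!: dyadic_grid_le)
  then show ?thesis
    using \<open>i \<le> 2 ^ N\<close> by (intro exI[of _ N] exI[of _ i]) (auto simp: dist_real_def abs_less_iff)
qed

text \<open>\<open>indep_var\<close> forces both variables to have the same type; this product form does not.\<close>

lemma (in prob_space) distr_pair_indep_compose:
  assumes ind: "indep_var S X T Y"
    and f: "f \<in> measurable S N1" and g: "g \<in> measurable T N2"
  shows "distr M (N1 \<Otimes>\<^sub>M N2) (\<lambda>\<omega>. (f (X \<omega>), g (Y \<omega>))) =
    distr M N1 (\<lambda>\<omega>. f (X \<omega>)) \<Otimes>\<^sub>M distr M N2 (\<lambda>\<omega>. g (Y \<omega>))"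
proof -
  have X [measurable]: "X \<in> measurable M S" and Y [measurable]: "Y \<in> measurable M T"
    using indep_var_rv1[OF ind] indep_var_rv2[OF ind] by auto
  note [measurable] = f g
  interpret gY: prob_space "distr (distr M T Y) N2 g"
    by (intro prob_space.prob_space_distr prob_space_distr) auto
  have "distr M N1 (\<lambda>\<omega>. f (X \<omega>)) \<Otimes>\<^sub>M distr M N2 (\<lambda>\<omega>. g (Y \<omega>)) =
      distr (distr M S X) N1 f \<Otimes>\<^sub>M distr (distr M T Y) N2 g"
    by (simp add: distr_distr comp_def)
  also have "\<dots> = distr (distr M S X \<Otimes>\<^sub>M distr M T Y) (N1 \<Otimes>\<^sub>M N2) (\<lambda>(x, y). (f x, g y))"
    by (rule pair_measure_distr) (auto intro: gY.sigma_finite_measure_axioms)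
  also have "distr M S X \<Otimes>\<^sub>M distr M T Y = distr M (S \<Otimes>\<^sub>M T) (\<lambda>\<omega>. (X \<omega>, Y \<omega>))"
    using ind unfolding indep_var_distribution_eq by simp
  finally show ?thesis
    by (simp add: distr_distr comp_def)
qed

section \<open>The Markov property at a fixed time\<close>

locale standard_brownian =
  fixes M :: "'a measure" and B :: "real \<Rightarrow> 'a \<Rightarrow> real"
  assumes standard: "standard_brownian_motion M B"
begin

sublocale prob_space M
  using standard by (simp add: standard_brownian_motion_def)

lemma B_measurable: "0 \<le> s \<Longrightarrow> B s \<in> borel_measurable M"
  and B_0: "\<omega> \<in> space M \<Longrightarrow> B 0 \<omega> = 0"
  and B_continuous: "\<omega> \<in> space M \<Longrightarrow> continuous_on {0..} (\<lambda>s. B s \<omega>)"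
  and B_increment: "0 \<le> r \<Longrightarrow> r < s \<Longrightarrow>
        distributed M lborel (\<lambda>\<omega>. B s \<omega> - B r \<omega>) (\<lambda>x. ennreal (normal_density 0 (sqrt (s - r)) x))"
  and B_indep: "0 \<le> \<tau> 0 \<Longrightarrow> (\<And>i. i < k \<Longrightarrow> \<tau> i < \<tau> (Suc i)) \<Longrightarrow>
        indep_vars (\<lambda>_. borel) (\<lambda>i \<omega>. B (\<tau> (Suc i)) \<omega> - B (\<tau> i) \<omega>) {..<k}"
  using standard by (auto simp: standard_brownian_motion_def)

text \<open>The definition gives independent increments, and the past values are partial sums of
  those up to q k. Subtracting B 0 makes the telescoping identity hold at every point, not only in
  \<open>space M\<close>.\<close>

lemma indep_past_increment:
  assumes "0 < q 0" and "\<And>i. i < k \<Longrightarrow> q i < q (Suc i)" and "q k < w"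
  shows "(\<lambda>\<omega>. \<lambda>i\<in>{..k}. B (q i) \<omega> - B 0 \<omega>) \<in> measurable M (PiM {..k} (\<lambda>_. borel))"
    and "distr M (PiM {..k} (\<lambda>_. borel) \<Otimes>\<^sub>M borel)
        (\<lambda>\<omega>. (\<lambda>i\<in>{..k}. B (q i) \<omega> - B 0 \<omega>, B w \<omega> - B (q k) \<omega>)) =
      distr M (PiM {..k} (\<lambda>_. borel)) (\<lambda>\<omega>. \<lambda>i\<in>{..k}. B (q i) \<omega> - B 0 \<omega>) \<Otimes>\<^sub>M
      distr M borel (\<lambda>\<omega>. B w \<omega> - B (q k) \<omega>)"
proof -
  \<comment> \<open>The times 0, q 0, ..., q k, w: increments 0 to k make up the past, increment k +
    1 is the future one.\<close>
  define \<tau> where "\<tau> i = (case i of 0 \<Rightarrow> 0 | Suc i \<Rightarrow> if i \<le> k then q i else w)" for i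
  let ?D = "\<lambda>i \<omega>. B (\<tau> (Suc i)) \<omega> - B (\<tau> i) \<omega>"
  have "indep_vars (\<lambda>_. borel) ?D {..<k+2}"
  proof (rule B_indep)
    show "\<tau> i < \<tau> (Suc i)" if "i < k + 2" for i
    proof (cases i)
      case (Suc j)
      then have "j < k \<or> j = k" using that by auto
      then show ?thesis using assms Suc by (auto simp: \<tau>_def)
    qed (use assms in \<open>auto simp: \<tau>_def\<close>)
  qed (simp add: \<tau>_def)
  then have "indep_var (PiM {..k} (\<lambda>_. borel)) (\<lambda>\<omega>. restrict (\<lambda>i. ?D i \<omega>) {..k})
      (PiM {Suc k} (\<lambda>_. borel)) (\<lambda>\<omega>. restrict (\<lambda>i. ?D i \<omega>) {Suc k})"
    by (rule indep_var_restrict) auto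
  note ind = this
  have f: "(\<lambda>d. \<lambda>i\<in>{..k}. \<Sum>j\<le>i. d j) \<in> measurable (PiM {..k} (\<lambda>_. borel)) (PiM {..k} (\<lambda>_. borel :: real measure))"
    by (auto intro!: measurable_restrict borel_measurable_sum measurable_component_singleton)
  have g: "(\<lambda>d. d (Suc k)) \<in> measurable (PiM {Suc k} (\<lambda>_. borel)) (borel :: real measure)"
    by (auto intro!: measurable_component_singleton)
  have eq: "(\<lambda>i\<in>{..k}. \<Sum>j\<le>i. restrict (\<lambda>i. ?D i \<omega>) {..k} j) =
      (\<lambda>i\<in>{..k}. B (q i) \<omega> - B 0 \<omega>)" for \<omega>
  proof -
    have "(\<Sum>j\<le>i. restrict (\<lambda>i. ?D i \<omega>) {..k} j) = B (q i) \<omega> - B 0 \<omega>" if "i \<le> k" for i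
    proof -
      have "(\<Sum>j\<le>i. restrict (\<lambda>i. ?D i \<omega>) {..k} j) = (\<Sum>j<Suc i. ?D j \<omega>)"
        using that by (intro sum.cong) auto
      also have "\<dots> = B (\<tau> (Suc i)) \<omega> - B (\<tau> 0) \<omega>"
        by (rule sum_lessThan_telescope)
      finally show ?thesis using that by (simp add: \<tau>_def)
    qed
    then show ?thesis
      by (auto simp: restrict_def fun_eq_iff)
  qed
  have eq2: "restrict (\<lambda>i. ?D i \<omega>) {Suc k} (Suc k) = B w \<omega> - B (q k) \<omega>" for \<omega>
    by (simp add: \<tau>_def)
  show "(\<lambda>\<omega>. \<lambda>i\<in>{..k}. B (q i) \<omega> - B 0 \<omega>) \<in> measurable M (PiM {..k} (\<lambda>_. borel))"
    using measurable_compose[OF indep_var_rv1[OF ind] f] unfolding eq .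
  show "distr M (PiM {..k} (\<lambda>_. borel) \<Otimes>\<^sub>M borel)
        (\<lambda>\<omega>. (\<lambda>i\<in>{..k}. B (q i) \<omega> - B 0 \<omega>, B w \<omega> - B (q k) \<omega>)) =
      distr M (PiM {..k} (\<lambda>_. borel)) (\<lambda>\<omega>. \<lambda>i\<in>{..k}. B (q i) \<omega> - B 0 \<omega>) \<Otimes>\<^sub>M
      distr M borel (\<lambda>\<omega>. B w \<omega> - B (q k) \<omega>)"
    using distr_pair_indep_compose[OF ind f g] unfolding eq eq2 .
qed

text \<open>Boundedness does not help: for \<mu> > 0 the function grows exponentially at minus
  infinity. Integrability is inherited from \<open>survival\<close> with start 0.\<close>

lemma integrable_reflected_sign:
  assumes "0 < w"
  shows "integrable M (\<lambda>\<omega>. reflected_sign \<mu> (B w \<omega> + \<mu> * w))"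
proof -
  have "integrable lborel (\<lambda>z. normal_density 0 (sqrt (w - 0)) z * reflected_sign \<mu> (z + \<mu> * w))"
    using has_bochner_integral_survival[OF assms, of \<mu> 0]
    by (simp add: has_bochner_integral_iff add.commute)
  then have "integrable M (\<lambda>\<omega>. reflected_sign \<mu> (B w \<omega> - B 0 \<omega> + \<mu> * w))"
    using distributed_integrable[OF B_increment[of 0 w], of "\<lambda>z. reflected_sign \<mu> (z + \<mu> * w)"] assms
    by simp
  moreover have "integrable M (\<lambda>\<omega>. reflected_sign \<mu> (B w \<omega> - B 0 \<omega> + \<mu> * w)) \<longleftrightarrow>
      integrable M (\<lambda>\<omega>. reflected_sign \<mu> (B w \<omega> + \<mu> * w))"
    by (intro Bochner_Integration.integrable_cong) (auto simp: B_0)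
  ultimately show ?thesis by simp
qed

text \<open>Given the values up to q k, the increment to w is a fresh normal variable; integrating
  it out turns \<open>reflected_sign\<close> into \<open>survival\<close> for the remaining time.
  This is the Markov property at a fixed time, obtained from Fubini on a product law.\<close>

lemma expectation_reflected_sign_past:
  assumes q: "0 < q 0" "\<And>i. i < k \<Longrightarrow> q i < q (Suc i)" "q k < w"
    and E: "E \<in> sets (PiM {..k} (\<lambda>_. borel))"
  shows "(\<integral>\<omega>. indicator E (\<lambda>i\<in>{..k}. B (q i) \<omega>) * reflected_sign \<mu> (B w \<omega> + \<mu> * w) \<partial>M) =
    (\<integral>\<omega>. indicator E (\<lambda>i\<in>{..k}. B (q i) \<omega>) * survival \<mu> (w - q k) (B (q k) \<omega> + \<mu> * q k) \<partial>M)"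
    and "integrable M (\<lambda>\<omega>. indicator E (\<lambda>i\<in>{..k}. B (q i) \<omega>) * survival \<mu> (w - q k) (B (q k) \<omega> + \<mu> * q k))"
proof -
  let ?P = "PiM {..k} (\<lambda>_. borel :: real measure)"
  let ?Y = "\<lambda>\<omega>. \<lambda>i\<in>{..k}. B (q i) \<omega> - B 0 \<omega>" and ?Z = "\<lambda>\<omega>. B w \<omega> - B (q k) \<omega>"
  have "q 0 \<le> q k"
    using q(2) by (induction k) (auto intro: less_imp_le order_trans)
  with q have pos: "0 < q k" "0 < w" by auto
  note ind = indep_past_increment[of q k w, OF q]
  have YZ [measurable]: "?Y \<in> measurable M ?P" "?Z \<in> borel_measurable M"
    using ind(1) q pos by (auto intro!: borel_measurable_diff B_measurable)
  interpret Y: prob_space "distr M ?P ?Y" by (rule prob_space_distr) simp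
  interpret Z: prob_space "distr M borel ?Z" by (rule prob_space_distr) simp
  interpret YZ: pair_prob_space "distr M ?P ?Y" "distr M borel ?Z" ..
  note [measurable] = E
  have eq: "distr M ?P ?Y \<Otimes>\<^sub>M distr M borel ?Z = distr M (?P \<Otimes>\<^sub>M borel) (\<lambda>\<omega>. (?Y \<omega>, ?Z \<omega>))"
    using ind(2) by simp
  \<comment> \<open>As B 0 = 0, the coordinate d k is B (q k), and d k + z is B w.\<close>
  let ?f = "\<lambda>(d, z). indicator E d * reflected_sign \<mu> (d k + z + \<mu> * w) :: real"
  have [measurable]: "?f \<in> borel_measurable (?P \<Otimes>\<^sub>M borel)"
    by measurable
  have Y0: "?Y \<omega> = (\<lambda>i\<in>{..k}. B (q i) \<omega>)" if "\<omega> \<in> space M" for \<omega>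
    using B_0[OF that] by auto
  have fYZ: "?f (?Y \<omega>, ?Z \<omega>) = indicator E (\<lambda>i\<in>{..k}. B (q i) \<omega>) * reflected_sign \<mu> (B w \<omega> + \<mu> * w)"
    if "\<omega> \<in> space M" for \<omega>
    using B_0[OF that] Y0[OF that] by simp
  have "integrable M (\<lambda>\<omega>. ?f (?Y \<omega>, ?Z \<omega>))"
  proof (rule Bochner_Integration.integrable_bound[OF integrable_reflected_sign[OF pos(2)]])
    show "(\<lambda>\<omega>. ?f (?Y \<omega>, ?Z \<omega>)) \<in> borel_measurable M" by measurable
    show "AE \<omega> in M. norm (?f (?Y \<omega>, ?Z \<omega>)) \<le> norm (reflected_sign \<mu> (B w \<omega> + \<mu> * w))"
      by (rule AE_I2, subst fYZ) (auto split: split_indicator)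
  qed
  then have int: "integrable (distr M ?P ?Y \<Otimes>\<^sub>M distr M borel ?Z) ?f"
    unfolding eq by (subst integrable_distr_eq) auto
  have inner: "(\<integral>z. ?f (d, z) \<partial>distr M borel ?Z) = indicator E d * survival \<mu> (w - q k) (d k + \<mu> * q k)" for d
  proof -
    have "(\<integral>z. ?f (d, z) \<partial>distr M borel ?Z) = (\<integral>\<omega>. indicator E d * reflected_sign \<mu> (d k + ?Z \<omega> + \<mu> * w) \<partial>M)"
      by (subst integral_distr) auto
    also have "\<dots> = (\<integral>z. normal_density 0 (sqrt (w - q k)) z *
        (indicator E d * reflected_sign \<mu> (d k + z + \<mu> * w)) \<partial>lborel)"
      using pos q by (subst distributed_integral[OF B_increment, symmetric]) auto
    also have "\<dots> = (\<integral>z. indicator E d * (normal_density 0 (sqrt (w - q k)) z *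
        reflected_sign \<mu> (d k + \<mu> * q k + \<mu> * (w - q k) + z)) \<partial>lborel)"
      by (intro Bochner_Integration.integral_cong) (auto simp: algebra_simps)
    also have "\<dots> = indicator E d * survival \<mu> (w - q k) (d k + \<mu> * q k)"
      using has_bochner_integral_survival[of "w - q k" \<mu> "d k + \<mu> * q k"] q
      by (simp add: has_bochner_integral_iff)
    finally show ?thesis .
  qed
  have "std_normal_cdf \<in> borel_measurable borel"
    using DERIV_std_normal_cdf[of "\<lambda>x. x" 1]
    by (intro borel_measurable_continuous_onI) (auto intro!: continuous_at_imp_continuous_on DERIV_isCont)
  then have [measurable]: "survival \<mu> r \<in> borel_measurable borel" for r
    unfolding survival_def[abs_def] by measurable
  have meas: "(\<lambda>d. indicator E d * survival \<mu> (w - q k) (d k + \<mu> * q k)) \<in> borel_measurable ?P"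
    by measurable
  have "(\<integral>\<omega>. indicator E (\<lambda>i\<in>{..k}. B (q i) \<omega>) * reflected_sign \<mu> (B w \<omega> + \<mu> * w) \<partial>M) =
      (\<integral>\<omega>. ?f (?Y \<omega>, ?Z \<omega>) \<partial>M)"
    by (intro Bochner_Integration.integral_cong refl fYZ[symmetric])
  also have "\<dots> = (\<integral>p. ?f p \<partial>(distr M ?P ?Y \<Otimes>\<^sub>M distr M borel ?Z))"
    unfolding eq by (subst integral_distr) auto
  also have "\<dots> = (\<integral>d. \<integral>z. ?f (d, z) \<partial>distr M borel ?Z \<partial>distr M ?P ?Y)"
    using int by (rule YZ.integral_fst'[symmetric])
  also have "\<dots> = (\<integral>d. indicator E d * survival \<mu> (w - q k) (d k + \<mu> * q k) \<partial>distr M ?P ?Y)"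
    unfolding inner ..
  also have "\<dots> = (\<integral>\<omega>. indicator E (?Y \<omega>) * survival \<mu> (w - q k) (?Y \<omega> k + \<mu> * q k) \<partial>M)"
    using meas by (intro integral_distr) simp
  also have "\<dots> = (\<integral>\<omega>. indicator E (\<lambda>i\<in>{..k}. B (q i) \<omega>) * survival \<mu> (w - q k) (B (q k) \<omega> + \<mu> * q k) \<partial>M)"
    using Y0 B_0 by (intro Bochner_Integration.integral_cong) auto
  finally show "(\<integral>\<omega>. indicator E (\<lambda>i\<in>{..k}. B (q i) \<omega>) * reflected_sign \<mu> (B w \<omega> + \<mu> * w) \<partial>M) =
    (\<integral>\<omega>. indicator E (\<lambda>i\<in>{..k}. B (q i) \<omega>) * survival \<mu> (w - q k) (B (q k) \<omega> + \<mu> * q k) \<partial>M)" .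
  have "integrable (distr M ?P ?Y) (\<lambda>d. indicator E d * survival \<mu> (w - q k) (d k + \<mu> * q k))"
    using YZ.integrable_fst'[OF int] unfolding inner .
  then have "integrable M (\<lambda>\<omega>. indicator E (?Y \<omega>) * survival \<mu> (w - q k) (?Y \<omega> k + \<mu> * q k))"
    using meas by (subst (asm) integrable_distr_eq) auto
  moreover have "integrable M (\<lambda>\<omega>. indicator E (?Y \<omega>) * survival \<mu> (w - q k) (?Y \<omega> k + \<mu> * q k)) \<longleftrightarrow>
      integrable M (\<lambda>\<omega>. indicator E (\<lambda>i\<in>{..k}. B (q i) \<omega>) * survival \<mu> (w - q k) (B (q k) \<omega> + \<mu> * q k))"
    using Y0 B_0 by (intro Bochner_Integration.integrable_cong) auto
  ultimately show "integrable M (\<lambda>\<omega>. indicator E (\<lambda>i\<in>{..k}. B (q i) \<omega>) * survival \<mu> (w - q k) (B (q k) \<omega> + \<mu> * q k))"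
    by simp
qed

text \<open>Positivity at the stopping index is demanded because the bound on
  \<open>survival\<close> concerns starting points in [0, \<eta>]; paths that have leapt below 0 are
  left to \<open>grid_jump\<close>.\<close>

definition level_hit :: "real \<Rightarrow> real \<Rightarrow> (nat \<Rightarrow> real) \<Rightarrow> nat \<Rightarrow> 'a set" where
  "level_hit \<mu> \<eta> q k = {\<omega> \<in> space M. (\<forall>i<k. \<eta> < B (q i) \<omega> + \<mu> * q i) \<and>
     0 < B (q k) \<omega> + \<mu> * q k \<and> B (q k) \<omega> + \<mu> * q k \<le> \<eta>}"

text \<open>The event depends only on values up to q k, so \<open>reflected_sign\<close> may be
  replaced by \<open>survival\<close> started in the band, which c bounds pointwise. The factor
  \<open>prob\<close> is kept so that the bounds for different k add up to at most c.\<close>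

lemma expectation_level_hit:
  assumes q: "0 < q 0" "\<And>i. i < k \<Longrightarrow> q i < q (Suc i)" "q k < w"
    and c: "\<And>y. 0 \<le> y \<Longrightarrow> y \<le> \<eta> \<Longrightarrow> \<bar>survival \<mu> (w - q k) y\<bar> \<le> c"
  shows "level_hit \<mu> \<eta> q k \<in> sets M"
    and "\<bar>\<integral>\<omega>. indicator (level_hit \<mu> \<eta> q k) \<omega> * reflected_sign \<mu> (B w \<omega> + \<mu> * w) \<partial>M\<bar> \<le>
      c * prob (level_hit \<mu> \<eta> q k)"
proof -
  have q0: "0 < q i" if "i \<le> k" for i
    using that q(1,2) by (induction i) (force dest: Suc_le_lessD)+
  have [measurable]: "B (q i) \<in> borel_measurable M" if "i \<le> k" for i
    using q0[OF that] by (intro B_measurable) simp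
  let ?P = "PiM {..k} (\<lambda>_. borel :: real measure)"
  define E where "E = {d \<in> space ?P. (\<forall>i<k. \<eta> < d i + \<mu> * q i) \<and>
     0 < d k + \<mu> * q k \<and> d k + \<mu> * q k \<le> \<eta>}"
  have E: "E \<in> sets ?P"
    unfolding E_def by measurable
  have ind: "indicator E (\<lambda>i\<in>{..k}. B (q i) \<omega>) = (indicator (level_hit \<mu> \<eta> q k) \<omega> :: real)"
    if "\<omega> \<in> space M" for \<omega>
    using that by (auto simp: E_def level_hit_def space_PiM split: split_indicator)
  have [measurable]: "(\<lambda>\<omega>. \<lambda>i\<in>{..k}. B (q i) \<omega>) \<in> measurable M ?P"
    by (intro measurable_restrict) auto
  have "level_hit \<mu> \<eta> q k = (\<lambda>\<omega>. \<lambda>i\<in>{..k}. B (q i) \<omega>) -` E \<inter> space M"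
    by (auto simp: E_def level_hit_def space_PiM)
  also have "\<dots> \<in> sets M" using E by measurable
  finally show meas [measurable]: "level_hit \<mu> \<eta> q k \<in> sets M" .
  have eq: "(\<integral>\<omega>. indicator (level_hit \<mu> \<eta> q k) \<omega> * reflected_sign \<mu> (B w \<omega> + \<mu> * w) \<partial>M) =
      (\<integral>\<omega>. indicator (level_hit \<mu> \<eta> q k) \<omega> * survival \<mu> (w - q k) (B (q k) \<omega> + \<mu> * q k) \<partial>M)"
    using expectation_reflected_sign_past(1)[OF q E, of \<mu>] ind
    by (simp cong: Bochner_Integration.integral_cong)
  have "norm (\<integral>\<omega>. indicator (level_hit \<mu> \<eta> q k) \<omega> * survival \<mu> (w - q k) (B (q k) \<omega> + \<mu> * q k) \<partial>M)
      \<le> (\<integral>\<omega>. c * indicator (level_hit \<mu> \<eta> q k) \<omega> \<partial>M)"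
  proof (rule order_trans[OF integral_norm_bound integral_mono'])
    show "integrable M (\<lambda>\<omega>. c * indicator (level_hit \<mu> \<eta> q k) \<omega>)"
      by (intro integrable_mult_right integrable_real_indicator) (auto simp: emeasure_eq_measure)
    fix \<omega> assume \<omega>: "\<omega> \<in> space M"
    show 1: "norm (indicator (level_hit \<mu> \<eta> q k) \<omega> * survival \<mu> (w - q k) (B (q k) \<omega> + \<mu> * q k)) \<le>
        c * indicator (level_hit \<mu> \<eta> q k) \<omega>"
      using c by (auto simp: level_hit_def split: split_indicator)
    show "0 \<le> c * indicator (level_hit \<mu> \<eta> q k) \<omega>"
      by (rule order_trans[OF norm_ge_zero 1])
  qed
  then show "\<bar>\<integral>\<omega>. indicator (level_hit \<mu> \<eta> q k) \<omega> * reflected_sign \<mu> (B w \<omega> + \<mu> * w) \<partial>M\<bar> \<le>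
      c * prob (level_hit \<mu> \<eta> q k)"
    unfolding eq by simp
qed

end

context standard_brownian
begin

lemma integral_indicator_dominated:
  assumes "\<And>N. A N \<in> sets M" "A' \<in> sets M"
    and "\<And>\<omega>. \<omega> \<in> space M \<Longrightarrow> (\<lambda>N. indicator (A N) \<omega> :: real) \<longlonglongrightarrow> indicator A' \<omega>"
    and f: "integrable M f"
  shows "(\<lambda>N. \<integral>\<omega>. indicator (A N) \<omega> * f \<omega> \<partial>M) \<longlonglongrightarrow> (\<integral>\<omega>. indicator A' \<omega> * (f \<omega> :: real) \<partial>M)"
proof (rule integral_dominated_convergence[where w="\<lambda>\<omega>. \<bar>f \<omega>\<bar>"])
  have [measurable]: "f \<in> borel_measurable M" using f by auto
  note [measurable] = assms(1,2)
  show "(\<lambda>\<omega>. indicator A' \<omega> * f \<omega>) \<in> borel_measurable M"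
    "(\<lambda>\<omega>. indicator (A N) \<omega> * f \<omega>) \<in> borel_measurable M" for N by measurable
  show "AE \<omega> in M. (\<lambda>N. indicator (A N) \<omega> * f \<omega>) \<longlonglongrightarrow> indicator A' \<omega> * f \<omega>"
    by (intro AE_I2 tendsto_intros assms)
qed (use f in \<open>auto split: split_indicator\<close>)

section \<open>Positivity on a closed interval [x, w] that ends before v\<close>

context
  fixes \<mu> x w v :: real
  assumes x: "0 < x" and w: "x < w" and v: "w < v"
begin

abbreviation (input) X where "X \<equiv> \<lambda>s \<omega>. B s \<omega> + \<mu> * s"
abbreviation (input) G where "G \<equiv> \<lambda>\<omega>. reflected_sign \<mu> (X v \<omega>)"

definition start_pos where "start_pos = {\<omega> \<in> space M. 0 < X x \<omega>}"
definition grid_above where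
  "grid_above \<eta> N = {\<omega> \<in> space M. \<forall>i\<le>2^N. \<eta> < X (dyadic_grid x w N i) \<omega>}"
definition grid_jump where
  "grid_jump \<eta> N = {\<omega> \<in> space M. \<exists>i<2^N. \<eta> <
     \<bar>X (dyadic_grid x w N (Suc i)) \<omega> - X (dyadic_grid x w N i) \<omega>\<bar>}"

lemma X_measurable [measurable]: "0 \<le> s \<Longrightarrow> X s \<in> borel_measurable M"
  using B_measurable[of s] by measurable

lemma X_grid_measurable [measurable]: "X (dyadic_grid x w N i) \<in> borel_measurable M"
  using x w dyadic_grid_ge[of x w N i] by (intro X_measurable) linarith

lemma G_integrable: "integrable M G"
  using integrable_reflected_sign[of v \<mu>] x w v by simp

lemma G_measurable [measurable]: "G \<in> borel_measurable M"
  using G_integrable by auto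

lemma sets_events [measurable]:
  "start_pos \<in> sets M" "grid_above \<eta> N \<in> sets M" "grid_jump \<eta> N \<in> sets M"
proof -
  have [measurable]: "X x \<in> borel_measurable M" using x by (intro X_measurable) simp
  show "start_pos \<in> sets M" "grid_above \<eta> N \<in> sets M" "grid_jump \<eta> N \<in> sets M"
    unfolding start_pos_def grid_above_def grid_jump_def by measurable
qed

text \<open>
  Stopping at the first grid time with value at most \<open>\<eta>\<close>: unless some increment exceeds \<open>\<eta>\<close>, that value is still positive.
\<close>

lemma indicator_decomposition:
  assumes \<eta>: "0 < \<eta>" and \<omega>: "\<omega> \<in> space M"
  shows "\<bar>indicator start_pos \<omega> - indicator (grid_above \<eta> N) \<omega> -
      indicator (\<Union>k\<le>2^N. level_hit \<mu> \<eta> (dyadic_grid x w N) k) \<omega>\<bar> \<le> (indicator (grid_jump \<eta> N) \<omega> :: real)"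
proof -
  let ?q = "dyadic_grid x w N" and ?U = "\<Union>k\<le>2^N. level_hit \<mu> \<eta> (dyadic_grid x w N) k"
  have A: "\<omega> \<in> start_pos" if "\<omega> \<in> grid_above \<eta> N"
    using that \<eta> by (auto simp: grid_above_def start_pos_def dest!: spec[of _ 0])
  have AU: "\<omega> \<notin> ?U" if "\<omega> \<in> grid_above \<eta> N"
    using that by (auto simp: grid_above_def level_hit_def)
  have U: "\<omega> \<in> start_pos" if "\<omega> \<in> ?U"
  proof -
    from that obtain k where "\<omega> \<in> level_hit \<mu> \<eta> ?q k" by auto
    then show ?thesis
      using \<eta> by (cases k) (auto simp: level_hit_def start_pos_def dest!: spec[of _ 0])
  qed
  have "\<omega> \<in> grid_jump \<eta> N" if "\<omega> \<in> start_pos" "\<omega> \<notin> grid_above \<eta> N" "\<omega> \<notin> ?U"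
  proof -
    \<comment> \<open>The first grid index with value at most \<eta>. As \<open>level_hit\<close>
      fails there, the value is nonpositive, and the step from the preceding value, which is above
      \<eta>, exceeds \<eta>.\<close>
    define k where "k = (LEAST k. X (?q k) \<omega> \<le> \<eta>)"
    from that \<omega> obtain i where i: "i \<le> 2^N" "X (?q i) \<omega> \<le> \<eta>"
      by (auto simp: grid_above_def not_less)
    have k: "X (?q k) \<omega> \<le> \<eta>" "k \<le> i"
      unfolding k_def using i(2) by (auto intro: LeastI Least_le)
    have less: "\<eta> < X (?q j) \<omega>" if "j < k" for j
      using not_less_Least[of j "\<lambda>k. X (?q k) \<omega> \<le> \<eta>"] that by (simp add: k_def)
    have "k \<le> 2^N" using k i by simp
    have neg: "X (?q k) \<omega> \<le> 0"
    proof (rule ccontr)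
      assume "\<not> ?thesis"
      then have "\<omega> \<in> level_hit \<mu> \<eta> ?q k"
        using \<omega> k less by (auto simp: level_hit_def)
      then show False using that(3) \<open>k \<le> 2^N\<close> by blast
    qed
    have "k \<noteq> 0"
      using neg that(1) by (cases "k = 0") (auto simp: start_pos_def)
    then obtain j where j: "k = Suc j" by (cases k) auto
    have "\<eta> < X (?q j) \<omega>" using less[of j] j by simp
    then have "\<eta> < \<bar>X (?q (Suc j)) \<omega> - X (?q j) \<omega>\<bar>"
      using neg unfolding j by linarith
    moreover have "j < 2^N" using j \<open>k \<le> 2^N\<close> by simp
    ultimately show ?thesis
      using \<omega> unfolding grid_jump_def by blast
  qed
  then show ?thesis
    using A AU U by (auto simp: indicator_def)
qed

text \<open>Integrates \<open>indicator_decomposition\<close> against G. Stopping happens no later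
  than w, so the remaining time is at least v - w and c applies to every \<open>level_hit\<close>
  term. As G need not be bounded, it stays inside the error integral.\<close>

lemma expectation_grid_above:
  assumes \<eta>: "0 < \<eta>" and c: "\<And>r y. v - w \<le> r \<Longrightarrow> 0 \<le> y \<Longrightarrow> y \<le> \<eta> \<Longrightarrow> \<bar>survival \<mu> r y\<bar> \<le> c"
  shows "\<bar>(\<integral>\<omega>. indicator start_pos \<omega> * G \<omega> \<partial>M) - (\<integral>\<omega>. indicator (grid_above \<eta> N) \<omega> * G \<omega> \<partial>M)\<bar> \<le>
    c + (\<integral>\<omega>. indicator (grid_jump \<eta> N) \<omega> * \<bar>G \<omega>\<bar> \<partial>M)"
proof -
  let ?q = "dyadic_grid x w N" and ?K = "{..(2::nat)^N}"
  let ?E = "\<lambda>k. level_hit \<mu> \<eta> (dyadic_grid x w N) k"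
  let ?U = "\<Union>k\<in>?K. ?E k"
  have "0 \<le> c" using c[of "v - w" 0] \<eta> by force
  have qw: "?q k \<le> w" if "k \<in> ?K" for k
    using that w by (intro dyadic_grid_le) auto
  have E: "?E k \<in> sets M"
    "\<bar>\<integral>\<omega>. indicator (?E k) \<omega> * G \<omega> \<partial>M\<bar> \<le> c * prob (?E k)" if "k \<in> ?K" for k
    using expectation_level_hit[of ?q k v \<eta> \<mu> c] x w v c qw[OF that]
    by (auto intro!: dyadic_grid_less)
  have U [measurable]: "?U \<in> sets M" using E by auto
  have int: "integrable M (\<lambda>\<omega>. indicator A \<omega> * G \<omega>)" if "A \<in> sets M" for A
    using integrable_real_mult_indicator[OF that G_integrable] by (simp add: mult.commute)
  have intn: "integrable M (\<lambda>\<omega>. indicator A \<omega> * \<bar>G \<omega>\<bar>)" if "A \<in> sets M" for A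
    using integrable_real_mult_indicator[OF that integrable_abs[OF G_integrable]] by (simp add: mult.commute)
  have disj: "disjoint_family_on ?E ?K"
    unfolding disjoint_family_on_def
  proof (intro ballI impI)
    \<comment> \<open>On \<open>?E n\<close> the value at the earlier index m exceeds \<eta>, on
      \<open>?E m\<close> it does not.\<close>
    have less: "?E m \<inter> ?E n = {}" if "m < n" for m n
      using that by (fastforce simp: level_hit_def)
    fix m n :: nat assume "m \<noteq> n"
    then show "?E m \<inter> ?E n = {}"
      using less[of m n] less[of n m] by (auto simp: nat_neq_iff)
  qed
  have "(\<integral>\<omega>. indicator ?U \<omega> * G \<omega> \<partial>M) = (\<integral>\<omega>. (\<Sum>k\<in>?K. indicator (?E k) \<omega> * G \<omega>) \<partial>M)"
    by (subst indicator_UN_disjoint[OF _ disj]) (auto simp: sum_distrib_right)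
  also have "\<dots> = (\<Sum>k\<in>?K. \<integral>\<omega>. indicator (?E k) \<omega> * G \<omega> \<partial>M)"
    by (rule Bochner_Integration.integral_sum) (auto intro: int E)
  finally have "\<bar>\<integral>\<omega>. indicator ?U \<omega> * G \<omega> \<partial>M\<bar> \<le> (\<Sum>k\<in>?K. \<bar>\<integral>\<omega>. indicator (?E k) \<omega> * G \<omega> \<partial>M\<bar>)"
    by (simp add: sum_abs)
  also have "\<dots> \<le> (\<Sum>k\<in>?K. c * prob (?E k))"
    by (intro sum_mono E)
  also have "\<dots> = c * prob ?U"
    using E(1) disj by (subst finite_measure_finite_Union) (auto simp: sum_distrib_left)
  also have "\<dots> \<le> c * 1"
    using \<open>0 \<le> c\<close> by (intro mult_left_mono) auto
  finally have 1: "\<bar>\<integral>\<omega>. indicator ?U \<omega> * G \<omega> \<partial>M\<bar> \<le> c" by simp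
  let ?R = "\<lambda>\<omega>. (indicator start_pos \<omega> - indicator (grid_above \<eta> N) \<omega> - indicator ?U \<omega>) * G \<omega>"
  have "(\<integral>\<omega>. ?R \<omega> \<partial>M) = (\<integral>\<omega>. indicator start_pos \<omega> * G \<omega> \<partial>M) - (\<integral>\<omega>. indicator (grid_above \<eta> N) \<omega> * G \<omega> \<partial>M)
      - (\<integral>\<omega>. indicator ?U \<omega> * G \<omega> \<partial>M)"
    unfolding left_diff_distrib by (simp add: int)
  moreover have "norm (\<integral>\<omega>. ?R \<omega> \<partial>M) \<le> (\<integral>\<omega>. indicator (grid_jump \<eta> N) \<omega> * \<bar>G \<omega>\<bar> \<partial>M)"
  proof (rule order_trans[OF integral_norm_bound integral_mono'])
    fix \<omega> assume \<omega>: "\<omega> \<in> space M"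
    show "norm (?R \<omega>) \<le> indicator (grid_jump \<eta> N) \<omega> * \<bar>G \<omega>\<bar>"
      using indicator_decomposition[OF \<eta> \<omega>, of N] by (auto simp: abs_mult intro!: mult_right_mono)
  qed (auto intro: intn)
  ultimately show ?thesis using 1 by (simp only: real_norm_def)
qed

lemma X_continuous: "\<omega> \<in> space M \<Longrightarrow> continuous_on {x..w} (\<lambda>s. X s \<omega>)"
  using x by (intro continuous_intros continuous_on_subset[OF B_continuous]) auto

definition positive_on where "positive_on = {\<omega> \<in> space M. \<forall>s\<in>{x..w}. 0 < X s \<omega>}"

definition dyadic_above where "dyadic_above \<eta> = (\<Inter>N. grid_above \<eta> N)"

lemma dyadic_above_measurable [measurable]: "dyadic_above \<eta> \<in> sets M"
  unfolding dyadic_above_def by measurable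

text \<open>A path positive on the compact [x, w] has a positive minimum, hence exceeds some 1/(m+1)
  on all grids; conversely, a lower bound at all dyadic points extends to all times by continuity.
  The union yields measurability and the limit in the level.\<close>

lemma positive_on_eq: "positive_on = (\<Union>m. dyadic_above (1 / real (Suc m)))"
proof (intro equalityI subsetI)
  fix \<omega> assume "\<omega> \<in> positive_on"
  then have \<omega>: "\<omega> \<in> space M" and pos: "\<And>s. s \<in> {x..w} \<Longrightarrow> 0 < X s \<omega>"
    by (auto simp: positive_on_def)
  obtain u where u: "u \<in> {x..w}" "\<And>s. s \<in> {x..w} \<Longrightarrow> X u \<omega> \<le> X s \<omega>"
    using continuous_attains_inf[OF _ _ X_continuous[OF \<omega>]] w by auto
  obtain m where "1 / real (Suc m) < X u \<omega>"
    using reals_Archimedean[OF pos[OF u(1)]] by (auto simp: inverse_eq_divide)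
  then have "\<omega> \<in> dyadic_above (1 / real (Suc m))"
    using u(2) \<omega> w by (force simp: dyadic_above_def grid_above_def dyadic_grid_ge dyadic_grid_le
        intro: less_le_trans)
  then show "\<omega> \<in> (\<Union>m. dyadic_above (1 / real (Suc m)))" by blast
next
  fix \<omega> assume "\<omega> \<in> (\<Union>m. dyadic_above (1 / real (Suc m)))"
  then obtain m where m: "\<omega> \<in> dyadic_above (1 / real (Suc m))" by blast
  then have \<omega>: "\<omega> \<in> space M" by (auto simp: dyadic_above_def grid_above_def)
  have "0 < X s \<omega>" if s: "s \<in> {x..w}" for s
  proof (rule ccontr)
    assume "\<not> 0 < X s \<omega>"
    moreover obtain N i where "i \<le> 2^N" "X (dyadic_grid x w N i) \<omega> < X s \<omega> + 1 / real (Suc m)"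
      using dyadic_grid_witness[OF w X_continuous[OF \<omega>] _ s, of "1 / real (Suc m)"] by auto
    moreover have "1 / real (Suc m) < X (dyadic_grid x w N i) \<omega>"
      using m \<open>i \<le> 2^N\<close> by (auto simp: dyadic_above_def grid_above_def)
    ultimately show False by linarith
  qed
  then show "\<omega> \<in> positive_on" using \<omega> by (simp add: positive_on_def)
qed

lemma positive_on_measurable [measurable]: "positive_on \<in> sets M"
  unfolding positive_on_eq by measurable

lemma grid_above_antimono: "decseq (grid_above \<eta>)"
proof (rule decseq_SucI)
  fix N
  have "2 * i \<le> 2 ^ Suc N" if "i \<le> 2 ^ N" for i :: nat using that by simp
  then show "grid_above \<eta> (Suc N) \<subseteq> grid_above \<eta> N"
    unfolding grid_above_def dyadic_grid_refine[of x w N] by blast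
qed

lemma grid_jump_tendsto:
  assumes "0 < \<eta>" "\<omega> \<in> space M"
  shows "(\<lambda>N. indicator (grid_jump \<eta> N) \<omega> :: real) \<longlonglongrightarrow> indicator {} \<omega>"
proof (rule tendsto_eventually)
  show "\<forall>\<^sub>F N in sequentially. indicator (grid_jump \<eta> N) \<omega> = (indicator {} \<omega> :: real)"
    using dyadic_grid_oscillation[OF w X_continuous[OF assms(2)] assms(1)]
    by eventually_elim (force simp: grid_jump_def indicator_def)
qed

text \<open>N tends to infinity at fixed \<eta>: each path eventually makes no grid step larger than
  \<eta>, so the error integral vanishes and only c is left.\<close>

lemma expectation_dyadic_above:
  assumes \<eta>: "0 < \<eta>" and c: "\<And>r y. v - w \<le> r \<Longrightarrow> 0 \<le> y \<Longrightarrow> y \<le> \<eta> \<Longrightarrow> \<bar>survival \<mu> r y\<bar> \<le> c"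
  shows "\<bar>(\<integral>\<omega>. indicator start_pos \<omega> * G \<omega> \<partial>M) - (\<integral>\<omega>. indicator (dyadic_above \<eta>) \<omega> * G \<omega> \<partial>M)\<bar> \<le> c"
proof (rule LIMSEQ_le)
  show "(\<lambda>N. \<bar>(\<integral>\<omega>. indicator start_pos \<omega> * G \<omega> \<partial>M) - (\<integral>\<omega>. indicator (grid_above \<eta> N) \<omega> * G \<omega> \<partial>M)\<bar>)
      \<longlonglongrightarrow> \<bar>(\<integral>\<omega>. indicator start_pos \<omega> * G \<omega> \<partial>M) - (\<integral>\<omega>. indicator (dyadic_above \<eta>) \<omega> * G \<omega> \<partial>M)\<bar>"
    by (intro tendsto_intros integral_indicator_dominated G_integrable)
       (auto simp: dyadic_above_def intro!: LIMSEQ_indicator_decseq grid_above_antimono)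
  have "(\<lambda>N. c + (\<integral>\<omega>. indicator (grid_jump \<eta> N) \<omega> * \<bar>G \<omega>\<bar> \<partial>M)) \<longlonglongrightarrow>
      c + (\<integral>\<omega>. indicator {} \<omega> * \<bar>G \<omega>\<bar> \<partial>M)"
    by (intro tendsto_intros integral_indicator_dominated integrable_abs G_integrable grid_jump_tendsto \<eta>) auto
  then show "(\<lambda>N. c + (\<integral>\<omega>. indicator (grid_jump \<eta> N) \<omega> * \<bar>G \<omega>\<bar> \<partial>M)) \<longlonglongrightarrow> c" by simp
qed (use expectation_grid_above[OF \<eta> c] in auto)

lemma expectation_positive_on:
  "(\<integral>\<omega>. indicator positive_on \<omega> * G \<omega> \<partial>M) = (\<integral>\<omega>. indicator start_pos \<omega> * G \<omega> \<partial>M)"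
proof (rule ccontr)
  let ?I = "\<integral>\<omega>. indicator start_pos \<omega> * G \<omega> \<partial>M" and ?J = "\<lambda>A. \<integral>\<omega>. indicator A \<omega> * G \<omega> \<partial>M"
  assume ne: "?J positive_on \<noteq> ?I"
  \<comment> \<open>Half the supposed gap; letting the level 1/(m+1) tend to 0 will bound the whole
    gap by c.\<close>
  define c where "c = \<bar>?I - ?J positive_on\<bar> / 2"
  have "0 < c" using ne by (simp add: c_def)
  obtain \<epsilon> where \<epsilon>: "\<epsilon> > 0" "\<And>r y. v - w \<le> r \<Longrightarrow> 0 \<le> y \<Longrightarrow> y \<le> \<epsilon> \<Longrightarrow> \<bar>survival \<mu> r y\<bar> \<le> c"
    using survival_small[of "v - w" c \<mu>] v \<open>0 < c\<close> by auto
  have "incseq (\<lambda>m. dyadic_above (1 / real (Suc m)))"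
  proof (rule incseq_SucI)
    fix m
    have "1 / real (Suc (Suc m)) \<le> 1 / real (Suc m)" by (simp add: field_simps)
    then show "dyadic_above (1 / real (Suc m)) \<subseteq> dyadic_above (1 / real (Suc (Suc m)))"
      unfolding dyadic_above_def grid_above_def by (force intro: le_less_trans)
  qed
  then have "(\<lambda>m. \<bar>?I - ?J (dyadic_above (1 / real (Suc m)))\<bar>) \<longlonglongrightarrow> \<bar>?I - ?J positive_on\<bar>"
    unfolding positive_on_eq
    by (intro tendsto_intros integral_indicator_dominated G_integrable)
       (auto intro!: LIMSEQ_indicator_incseq)
  moreover have "\<forall>\<^sub>F m in sequentially. \<bar>?I - ?J (dyadic_above (1 / real (Suc m)))\<bar> \<le> c"
  proof -
    have "(\<lambda>m. 1 / real (Suc m)) \<longlonglongrightarrow> 0"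
      using LIMSEQ_inverse_real_of_nat by (simp add: inverse_eq_divide)
    then have "\<forall>\<^sub>F m in sequentially. 1 / real (Suc m) < \<epsilon>"
      using \<epsilon>(1) by (rule order_tendstoD)
    then show ?thesis
    proof eventually_elim
      case (elim m)
      show ?case using elim \<epsilon>(2) by (intro expectation_dyadic_above) auto
    qed
  qed
  ultimately have "\<bar>?I - ?J positive_on\<bar> \<le> c"
    by (rule tendsto_upperbound) simp
  then show False using \<open>0 < c\<close> by (simp add: c_def)
qed

end

section \<open>The half-open interval [x, v) and the mirrored path\<close>

lemma AE_drifted_nonzero:
  assumes "0 < s"
  shows "AE \<omega> in M. B s \<omega> + \<mu> * s \<noteq> 0"
proof -
  have "AE \<omega> in M. B s \<omega> - B 0 \<omega> \<noteq> - \<mu> * s"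
    by (subst distributed_AE2[OF B_increment[of 0 s]])
       (use assms AE_lborel_singleton[of "- \<mu> * s"] in auto)
  then show ?thesis
    using AE_space by eventually_elim (auto simp: B_0)
qed

text \<open>The end point w is moved up to v by dominated convergence. On the limit event the value
  at v is nonnegative by continuity and almost surely nonzero, so \<open>reflected_sign\<close> is 1
  there and the expectation becomes a probability.\<close>

lemma prob_positive_until:
  fixes \<mu> :: real
  assumes x: "0 < x" and v: "x < v"
  defines "S \<equiv> {\<omega> \<in> space M. \<forall>s\<in>{x..<v}. 0 < B s \<omega> + \<mu> * s}"
  shows "S \<in> sets M"
    and "prob S = (\<integral>\<omega>. indicator (start_pos \<mu> x) \<omega> * reflected_sign \<mu> (B v \<omega> + \<mu> * v) \<partial>M)"
proof -
  let ?G = "\<lambda>\<omega>. reflected_sign \<mu> (B v \<omega> + \<mu> * v)"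
  \<comment> \<open>The offset 2 keeps even w 0 strictly above x.\<close>
  define w where "w m = v - (v - x) / real (m + 2)" for m
  have w: "x < w m" "w m < v" for m
  proof -
    have "(v - x) / real (m + 2) < (v - x) / 1"
      using v by (intro divide_strict_left_mono) auto
    then show "x < w m" by (simp add: w_def)
    show "w m < v" using v by (simp add: w_def)
  qed
  have w_mono: "w m \<le> w n" if "m \<le> n" for m n
    using that v unfolding w_def by (intro diff_left_mono divide_left_mono) auto
  have w_lim: "w \<longlonglongrightarrow> v"
  proof -
    have "(\<lambda>m. (v - x) / real (m + 2)) \<longlonglongrightarrow> 0" by real_asymp
    then have "(\<lambda>m. v - (v - x) / real (m + 2)) \<longlonglongrightarrow> v - 0" by (intro tendsto_intros)
    then show ?thesis by (simp add: w_def[abs_def])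
  qed
  have meas [measurable]: "positive_on \<mu> x (w m) \<in> sets M" for m
    by (rule positive_on_measurable[OF x w])
  have S: "S = (\<Inter>m. positive_on \<mu> x (w m))"
  proof (intro equalityI subsetI)
    fix \<omega> assume "\<omega> \<in> S"
    moreover have "s < v" if "s \<le> w m" for s m
      using that w(2)[of m] by simp
    ultimately show "\<omega> \<in> (\<Inter>m. positive_on \<mu> x (w m))"
      unfolding S_def positive_on_def[OF x w] by fastforce
  next
    fix \<omega> assume \<omega>: "\<omega> \<in> (\<Inter>m. positive_on \<mu> x (w m))"
    have "0 < B s \<omega> + \<mu> * s" if s: "s \<in> {x..<v}" for s
    proof -
      from s have "\<forall>\<^sub>F m in sequentially. s < w m"
        by (intro order_tendstoD[OF w_lim]) auto
      then obtain m where "s < w m" by (auto simp: eventually_sequentially)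
      moreover have "\<omega> \<in> positive_on \<mu> x (w m)" using \<omega> by blast
      ultimately show ?thesis
        using s by (simp add: positive_on_def[OF x w])
    qed
    then show "\<omega> \<in> S" using \<omega> by (auto simp: S_def positive_on_def[OF x w])
  qed
  then show meas_S [measurable]: "S \<in> sets M" by simp
  have int: "integrable M ?G"
    using x v by (intro integrable_reflected_sign) simp
  have "decseq (\<lambda>m. positive_on \<mu> x (w m))"
    unfolding decseq_def using w_mono by (force simp: positive_on_def[OF x w])
  then have "(\<lambda>m. \<integral>\<omega>. indicator (positive_on \<mu> x (w m)) \<omega> * ?G \<omega> \<partial>M) \<longlonglongrightarrow>
      (\<integral>\<omega>. indicator S \<omega> * ?G \<omega> \<partial>M)"
    unfolding S using int
    by (intro integral_indicator_dominated) (auto intro!: LIMSEQ_indicator_decseq)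
  then have "(\<integral>\<omega>. indicator S \<omega> * ?G \<omega> \<partial>M) = (\<integral>\<omega>. indicator (start_pos \<mu> x) \<omega> * ?G \<omega> \<partial>M)"
    using w unfolding expectation_positive_on[OF x w] by (simp add: LIMSEQ_const_iff)
  moreover have "(\<integral>\<omega>. indicator S \<omega> * ?G \<omega> \<partial>M) = (\<integral>\<omega>. indicator S \<omega> \<partial>M)"
  proof (rule integral_cong_AE)
    have "AE \<omega> in M. B v \<omega> + \<mu> * v \<noteq> 0"
      using x v by (intro AE_drifted_nonzero) simp
    then show "AE \<omega> in M. indicator S \<omega> * ?G \<omega> = indicator S \<omega>"
      using AE_space
    proof eventually_elim
      case (elim \<omega>)
      have "0 \<le> B v \<omega> + \<mu> * v" if "\<omega> \<in> S"
      proof (rule tendsto_lowerbound)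
        have "continuous_on {0..} (\<lambda>s. B s \<omega> + \<mu> * s)"
          using B_continuous[OF elim(2)] by (intro continuous_intros)
        then show "(\<lambda>m. B (w m) \<omega> + \<mu> * w m) \<longlonglongrightarrow> B v \<omega> + \<mu> * v"
          by (rule continuous_on_tendsto_compose[OF _ w_lim])
             (use x v w in \<open>auto intro!: eventuallyI less_imp_le intro: less_trans\<close>)
        show "\<forall>\<^sub>F m in sequentially. 0 \<le> B (w m) \<omega> + \<mu> * w m"
          using that w(2) less_imp_le[OF w(1)] by (auto simp: S_def intro!: eventuallyI less_imp_le)
      qed simp
      with elim(1) show ?case
        by (auto simp: reflected_sign_def split: split_indicator)
    qed
    have [measurable]: "?G \<in> borel_measurable M" using int by auto
    show "(\<lambda>\<omega>. indicator S \<omega> * ?G \<omega>) \<in> borel_measurable M" by measurable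
  qed auto
  ultimately show "prob S = (\<integral>\<omega>. indicator (start_pos \<mu> x) \<omega> * ?G \<omega> \<partial>M)"
    by simp
qed

text \<open>Paths negative on [x, v) become positive paths of the mirrored motion with drift -
  \<mu>; the crossing density is the same for both because it involves only \<mu>^2.\<close>

lemma standard_brownian_uminus: "standard_brownian M (\<lambda>s \<omega>. - B s \<omega>)"
proof
  show "standard_brownian_motion M (\<lambda>s \<omega>. - B s \<omega>)"
    unfolding standard_brownian_motion_def
  proof (intro conjI allI impI ballI)
    fix r s :: real assume "0 \<le> r \<and> r < s"
    then have "distributed M lborel (\<lambda>\<omega>. 0 + (-1) * (B s \<omega> - B r \<omega>))
        (\<lambda>x. ennreal (normal_density (0 + (-1) * 0) (\<bar>-1\<bar> * sqrt (s - r)) x))"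
      by (intro normal_density_affine B_increment) auto
    then show "distributed M lborel (\<lambda>\<omega>. - B s \<omega> - - B r \<omega>)
        (\<lambda>x. ennreal (normal_density 0 (sqrt (s - r)) x))"
      by simp
  next
    fix \<tau> :: "nat \<Rightarrow> real" and k assume "0 \<le> \<tau> 0 \<and> (\<forall>i<k. \<tau> i < \<tau> (Suc i))"
    then have "indep_vars (\<lambda>_. borel) (\<lambda>i \<omega>. - (B (\<tau> (Suc i)) \<omega> - B (\<tau> i) \<omega>)) {..<k}"
      by (intro indep_vars_compose2[where Y="\<lambda>_. uminus", OF B_indep]) auto
    then show "indep_vars (\<lambda>_. borel) (\<lambda>i \<omega>. - B (\<tau> (Suc i)) \<omega> - - B (\<tau> i) \<omega>) {..<k}"
      by simp
  qed (auto intro!: prob_space_axioms borel_measurable_uminus B_measurable continuous_intros B_continuous simp: B_0)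
qed

end

section \<open>The arcsine law with drift\<close>

lemma indicator_greaterThanLessThan: "indicator {a<..<b} x = (if a < x \<and> x < b then 1 else 0)"
  by (simp add: indicator_def)

text \<open>For 0 <= x < v this equals (2/pi) arcsin (sqrt (x/v)), the driftless distribution
  function of the last zero before v.\<close>

definition arcsine_cdf :: "real \<Rightarrow> real \<Rightarrow> real" where
  "arcsine_cdf x v = 2 / pi * arctan (sqrt (x / (v - x)))"

lemma arcsine_cdf_nonneg: "0 < x \<Longrightarrow> x < v \<Longrightarrow> 0 \<le> arcsine_cdf x v"
  by (simp add: arcsine_cdf_def)

lemma arcsine_cdf_le_1: "arcsine_cdf x v \<le> 1"
proof -
  have "2 / pi * arctan (sqrt (x / (v - x))) \<le> 2 / pi * (pi / 2)"
    using arctan_ubound[of "sqrt (x / (v - x))"] by (intro mult_left_mono) auto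
  then show ?thesis by (simp add: arcsine_cdf_def)
qed

lemma DERIV_arcsine_cdf_left:
  assumes "0 < a" "a < v"
  shows "((\<lambda>a. arcsine_cdf a v) has_real_derivative 1 / (pi * sqrt (a * (v - a)))) (at a)"
proof -
  define p q where "p = sqrt a" and "q = sqrt (v - a)"
  have pq: "0 < p" "0 < q" "a = p\<^sup>2" "v - a = q\<^sup>2" using assms by (auto simp: p_def q_def)
  have v: "v = p\<^sup>2 + q\<^sup>2" using pq by simp
  have s: "sqrt (a / (v - a)) = p / q" by (simp add: real_sqrt_divide p_def q_def)
  have s2: "sqrt (a * (v - a)) = p * q" by (simp add: real_sqrt_mult p_def q_def)
  have d1: "((\<lambda>a. a / (v - a)) has_real_derivative v / (q\<^sup>2)\<^sup>2) (at a)"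
  proof -
    have "((\<lambda>a. a / (v - a)) has_real_derivative (1 * (v - a) - a * (0 - 1)) / ((v - a) * (v - a))) (at a)"
      using assms by (intro DERIV_divide DERIV_diff DERIV_ident DERIV_const) auto
    then show ?thesis
      by (rule DERIV_cong) (unfold pq(4)[symmetric], simp add: power2_eq_square)
  qed
  have pos: "0 < a / (v - a)" using assms by simp
  have "((\<lambda>a. arcsine_cdf a v) has_real_derivative
      2 / pi * (inverse (1 + (sqrt (a / (v - a)))\<^sup>2) * (inverse (sqrt (a / (v - a))) / 2 * (v / (q\<^sup>2)\<^sup>2)))) (at a)"
    unfolding arcsine_cdf_def
    by (intro DERIV_cmult DERIV_chain2[OF DERIV_arctan] DERIV_chain2[OF DERIV_real_sqrt] d1 pos)
  also have "2 / pi * (inverse (1 + (sqrt (a / (v - a)))\<^sup>2) * (inverse (sqrt (a / (v - a))) / 2 * (v / (q\<^sup>2)\<^sup>2))) =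
      1 / (pi * sqrt (a * (v - a)))"
  proof -
    have "1 + (p / q)\<^sup>2 = v / q\<^sup>2" using pq(2) by (simp add: v power_divide add_divide_distrib)
    moreover have "0 < v" using assms by simp
    ultimately show ?thesis
      unfolding s s2 using pq(1,2) by (simp add: field_simps power2_eq_square)
  qed
  finally show ?thesis .
qed

text \<open>The density at \<open>u\<close> of the first zero after time \<open>x\<close>.\<close>

definition crossing_density :: "real \<Rightarrow> real \<Rightarrow> real \<Rightarrow> real" where
  "crossing_density \<mu> x u = exp (- (\<mu>\<^sup>2 * u / 2)) * sqrt x / (pi * u * sqrt (u - x))"

text \<open>The derivative in the horizon is minus the driftless \<open>crossing_density\<close>: a
  longer horizon loses exactly the paths whose first zero after x falls into the added
  piece.\<close>

lemma DERIV_arcsine_cdf_right: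
  assumes "0 < x" "x < u"
  shows "((\<lambda>u. arcsine_cdf x u) has_real_derivative - sqrt x / (pi * u * sqrt (u - x))) (at u)"
proof -
  define p q where "p = sqrt x" and "q = sqrt (u - x)"
  have pq: "0 < p" "0 < q" "x = p\<^sup>2" "u - x = q\<^sup>2" using assms by (auto simp: p_def q_def)
  have u: "u = p\<^sup>2 + q\<^sup>2" using pq by simp
  have s: "sqrt (x / (u - x)) = p / q" by (simp add: real_sqrt_divide p_def q_def)
  have d1: "((\<lambda>u. x / (u - x)) has_real_derivative - x / (q\<^sup>2)\<^sup>2) (at u)"
  proof -
    have "((\<lambda>u. x / (u - x)) has_real_derivative (0 * (u - x) - x * (1 - 0)) / ((u - x) * (u - x))) (at u)"
      using assms by (intro DERIV_divide DERIV_diff DERIV_ident DERIV_const) auto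
    then show ?thesis
      by (rule DERIV_cong) (unfold pq(4)[symmetric], simp add: power2_eq_square)
  qed
  have pos: "0 < x / (u - x)" using assms by simp
  have "((\<lambda>u. arcsine_cdf x u) has_real_derivative
      2 / pi * (inverse (1 + (sqrt (x / (u - x)))\<^sup>2) * (inverse (sqrt (x / (u - x))) / 2 * (- x / (q\<^sup>2)\<^sup>2)))) (at u)"
    unfolding arcsine_cdf_def
    by (intro DERIV_cmult DERIV_chain2[OF DERIV_arctan] DERIV_chain2[OF DERIV_real_sqrt] d1 pos)
  also have "2 / pi * (inverse (1 + (sqrt (x / (u - x)))\<^sup>2) * (inverse (sqrt (x / (u - x))) / 2 * (- x / (q\<^sup>2)\<^sup>2))) =
      - sqrt x / (pi * u * sqrt (u - x))"
  proof -
    have "1 + (p / q)\<^sup>2 = u / q\<^sup>2" using pq(2) by (simp add: u power_divide add_divide_distrib)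
    moreover have "0 < u" using assms by simp
    ultimately show ?thesis
      unfolding s p_def[symmetric] q_def[symmetric] using pq(1,2)
      by (simp add: pq(3) field_simps power2_eq_square)
  qed
  finally show ?thesis .
qed

lemma arcsine_cdf_at_right_0:
  assumes "0 < v"
  shows "((\<lambda>a. arcsine_cdf a v) \<longlongrightarrow> 0) (at_right 0)"
proof -
  have "isCont (\<lambda>a. arcsine_cdf a v) 0"
    unfolding arcsine_cdf_def using assms by (intro continuous_intros) auto
  then have "((\<lambda>a. arcsine_cdf a v) \<longlongrightarrow> arcsine_cdf 0 v) (at_right 0)"
    unfolding isCont_def by (rule filterlim_mono) (auto simp: at_le)
  then show ?thesis by (simp add: arcsine_cdf_def)
qed

lemma arcsine_cdf_diagonal:
  assumes "0 < v"
  shows "((\<lambda>a. arcsine_cdf a v) \<longlongrightarrow> 1) (at_left v)"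
    and "((\<lambda>u. arcsine_cdf v u) \<longlongrightarrow> 1) (at_right v)"
proof -
  have *: "((\<lambda>a. arcsine_cdf (f a) (g a)) \<longlongrightarrow> 1) F"
    if "filterlim (\<lambda>a. f a / (g a - f a)) at_top F" for f g :: "real \<Rightarrow> real" and F
  proof -
    have "((\<lambda>a. 2 / pi * arctan (sqrt (f a / (g a - f a)))) \<longlongrightarrow> 2 / pi * (pi / 2)) F"
      by (intro tendsto_intros filterlim_compose[OF tendsto_arctan_at_top]
          filterlim_compose[OF sqrt_at_top] that)
    then show ?thesis by (simp add: arcsine_cdf_def)
  qed
  show "((\<lambda>a. arcsine_cdf a v) \<longlongrightarrow> 1) (at_left v)"
    by (rule *) (use assms in real_asymp)
  show "((\<lambda>u. arcsine_cdf v u) \<longlongrightarrow> 1) (at_right v)"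
    by (rule *) (use assms in real_asymp)
qed

text \<open>The driftless law with horizon v, evaluated on (0, x). The second indicator admits
  horizons v below x, which occur once the horizon becomes a variable of integration.\<close>

definition arcsine_mass :: "real \<Rightarrow> real \<Rightarrow> ennreal" where
  "arcsine_mass x v = (\<integral>\<^sup>+a. ennreal (1 / (pi * sqrt (a * (v - a)))) *
     indicator {0<..<x} a * indicator {0<..<v} a \<partial>lborel)"

lemma arcsine_mass_eq:
  assumes "0 < x" "0 < v"
  shows "arcsine_mass x v = ennreal (if x < v then arcsine_cdf x v else 1)"
proof -
  let ?f = "\<lambda>a. 1 / (pi * sqrt (a * (v - a)))" and ?m = "min x v"
  have "arcsine_mass x v = (\<integral>\<^sup>+a. ennreal (?f a) * indicator {0<..<?m} a \<partial>lborel)"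
    unfolding arcsine_mass_def by (intro nn_integral_cong) (auto split: split_indicator)
  also have "\<dots> = ennreal ((if x < v then arcsine_cdf x v else 1) - 0)"
  proof (rule nn_integral_FTC_open)
    show "0 < ?m" using assms by simp
    fix a assume a: "0 < a" "a < ?m"
    then show "((\<lambda>a. arcsine_cdf a v) has_real_derivative ?f a) (at a)"
      by (intro DERIV_arcsine_cdf_left) auto
    show "isCont ?f a" using a by (intro continuous_intros) auto
    show "0 \<le> ?f a" using a by simp
  next
    show "((\<lambda>a. arcsine_cdf a v) \<longlongrightarrow> 0) (at_right 0)"
      using assms by (intro arcsine_cdf_at_right_0)
    show "((\<lambda>a. arcsine_cdf a v) \<longlongrightarrow> (if x < v then arcsine_cdf x v else 1)) (at_left ?m)"
    proof (cases "x < v")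
      case True
      then have "isCont (\<lambda>a. arcsine_cdf a v) x"
        using assms by (intro DERIV_isCont[OF DERIV_arcsine_cdf_left]) auto
      then show ?thesis
        using True unfolding isCont_def by (auto intro: filterlim_mono at_le)
    qed (use assms arcsine_cdf_diagonal in auto)
  qed
  finally show ?thesis by simp
qed

text \<open>By the product rule, the added term with \<open>arcsine_cdf\<close> makes the integrand
  an exact derivative. The same term arises from the mixture over horizons u > x.\<close>

lemma nn_integral_crossing_density:
  assumes x: "0 < x" and v: "x < v"
  shows "(\<integral>\<^sup>+u. ennreal (\<mu>\<^sup>2 / 2 * exp (- (\<mu>\<^sup>2 * u / 2)) * arcsine_cdf x u + crossing_density \<mu> x u) *
      indicator {x<..<v} u \<partial>lborel) =
    ennreal (exp (- (\<mu>\<^sup>2 * x / 2)) - exp (- (\<mu>\<^sup>2 * v / 2)) * arcsine_cdf x v)"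
proof -
  let ?f = "\<lambda>u. \<mu>\<^sup>2 / 2 * exp (- (\<mu>\<^sup>2 * u / 2)) * arcsine_cdf x u + crossing_density \<mu> x u"
  let ?F = "\<lambda>u. - (exp (- (\<mu>\<^sup>2 * u / 2)) * arcsine_cdf x u)"
  have D: "(?F has_real_derivative ?f u) (at u)" if "x < u" for u
  proof -
    have "(?F has_real_derivative - (exp (- (\<mu>\<^sup>2 * u / 2)) * (- (\<mu>\<^sup>2 * 1 / 2)) * arcsine_cdf x u +
        (- sqrt x / (pi * u * sqrt (u - x))) * exp (- (\<mu>\<^sup>2 * u / 2)))) (at u)"
      by (intro DERIV_minus DERIV_mult DERIV_chain2[OF DERIV_exp] DERIV_cdivide DERIV_cmult DERIV_ident
          DERIV_arcsine_cdf_right x that)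
    then show ?thesis
      by (rule DERIV_cong) (simp add: crossing_density_def algebra_simps)
  qed
  have "(\<integral>\<^sup>+u. ennreal (?f u) * indicator {x<..<v} u \<partial>lborel) = ennreal (?F v - - exp (- (\<mu>\<^sup>2 * x / 2)))"
  proof (rule nn_integral_FTC_open[OF v D])
    fix u assume u: "x < u" "u < v"
    show "isCont ?f u"
      unfolding crossing_density_def using u x
      by (intro continuous_intros DERIV_isCont[OF DERIV_arcsine_cdf_right]) auto
    show "0 \<le> ?f u"
      using u x arcsine_cdf_nonneg[of x u] by (simp add: crossing_density_def)
  next
    have "isCont ?F v" by (rule DERIV_isCont[OF D[OF v]])
    then show "(?F \<longlongrightarrow> ?F v) (at_left v)"
      unfolding isCont_def by (rule filterlim_mono) (auto simp: at_le)
    have "((\<lambda>u. exp (- (\<mu>\<^sup>2 * u / 2))) \<longlongrightarrow> exp (- (\<mu>\<^sup>2 * x / 2))) (at_right x)"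
      by (intro tendsto_intros) simp
    from tendsto_minus[OF tendsto_mult[OF this arcsine_cdf_diagonal(2)[OF x]]]
    show "(?F \<longlongrightarrow> - exp (- (\<mu>\<^sup>2 * x / 2))) (at_right x)" by simp
  qed
  then show ?thesis by simp
qed

section \<open>The drifted density as a mixture over horizons\<close>

lemma borel_measurable_last_zero_density [measurable]:
  "(\<lambda>p. last_zero_density \<mu> (fst p) (snd p)) \<in> borel_measurable (borel \<Otimes>\<^sub>M borel)"
proof -
  have "(\<lambda>p. \<integral>y. (if fst p \<le> y \<and> y \<le> snd p then 1 else 0) *\<^sub>R
        (exp (- (\<mu>\<^sup>2 * y / 2)) / sqrt (fst p * (y - fst p))) \<partial>lborel)
      \<in> borel_measurable (borel \<Otimes>\<^sub>M borel)"
    by measurable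
  moreover have "indicator {a..b} y = (if a \<le> y \<and> y \<le> b then 1 else 0 :: real)" for a b y :: real
    by (auto simp: indicator_def)
  ultimately show ?thesis
    unfolding last_zero_density_def set_lebesgue_integral_def by simp
qed

lemma borel_measurable_last_zero_density':
  assumes "f \<in> borel_measurable N" "g \<in> borel_measurable N"
  shows "(\<lambda>x. last_zero_density \<mu> (f x) (g x)) \<in> borel_measurable N"
  using measurable_compose[OF measurable_Pair[OF assms] borel_measurable_last_zero_density] by simp

text \<open>The horizon is v with weight exp (- \<mu>^2 v / 2) and otherwise y < v with the
  exponential density of rate \<mu>^2/2; each horizon contributes its driftless arcsine density at
  a, which is 0 for y below a.\<close>

lemma last_zero_density_eq:
  assumes "0 < a" "a < v"
  shows "0 \<le> last_zero_density \<mu> a v"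
    and "ennreal (last_zero_density \<mu> a v) =
      ennreal (exp (- (\<mu>\<^sup>2 * v / 2))) * ennreal (1 / (pi * sqrt (a * (v - a)))) +
      (\<integral>\<^sup>+y. ennreal (\<mu>\<^sup>2 / 2 * exp (- (\<mu>\<^sup>2 * y / 2))) * ennreal (1 / (pi * sqrt (a * (y - a)))) *
         indicator {a<..<v} y \<partial>lborel)"
proof -
  let ?h = "\<lambda>y. exp (- (\<mu>\<^sup>2 * y / 2)) / sqrt (a * (y - a))"
  have "(\<integral>\<^sup>+y. ennreal (1 / sqrt (a * (y - a))) * indicator {a<..<v} y \<partial>lborel) =
      ennreal (2 / sqrt a * sqrt (v - a) - 0)"
  proof (rule nn_integral_FTC_open[OF assms(2)])
    let ?F = "\<lambda>y. 2 / sqrt a * sqrt (y - a)"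
    show "(?F has_real_derivative 1 / sqrt (a * (y - a))) (at y)" if "a < y" for y
    proof -
      have d: "((\<lambda>y. y - a) has_real_derivative 1) (at y)"
        by (auto intro!: derivative_eq_intros)
      have "(?F has_real_derivative 2 / sqrt a * (inverse (sqrt (y - a)) / 2 * 1)) (at y)"
        by (rule DERIV_cmult[OF DERIV_chain2[OF DERIV_real_sqrt d]]) (use that in simp)
      then show ?thesis
        by (rule DERIV_cong) (simp add: real_sqrt_mult inverse_eq_divide)
    qed
    have F: "(?F \<longlongrightarrow> ?F y) (at y within S)" for y S
      using assms by (intro tendsto_intros) auto
    show "(?F \<longlongrightarrow> 0) (at_right a)" using F[of a "{a<..}"] by simp
    show "(?F \<longlongrightarrow> ?F v) (at_left v)" by (rule F)
    fix y assume "a < y"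
    then show "isCont (\<lambda>y. 1 / sqrt (a * (y - a))) y" "0 \<le> 1 / sqrt (a * (y - a))"
      using assms by (auto intro!: continuous_intros)
  qed
  moreover have "(\<integral>\<^sup>+y. ennreal (indicator {a..v} y * ?h y) \<partial>lborel) \<le>
      (\<integral>\<^sup>+y. ennreal (1 / sqrt (a * (y - a))) * indicator {a<..<v} y \<partial>lborel)"
  proof (rule nn_integral_mono_AE)
    show "AE y in lborel. ennreal (indicator {a..v} y * ?h y) \<le>
        ennreal (1 / sqrt (a * (y - a))) * indicator {a<..<v} y"
      \<comment> \<open>At y = a the quotient has denominator 0 and is 0 by convention, so of the
        closed interval only the end point v has to be discarded.\<close>
      using AE_lborel_singleton[of v]
    proof eventually_elim
      case (elim y)
      have "exp (- (\<mu>\<^sup>2 * y / 2)) \<le> 1" if "0 < y" using that by simp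
      then show ?case
        using elim assms by (auto split: split_indicator intro!: ennreal_leI divide_right_mono)
    qed
  qed
  \<comment> \<open>Without integrability the Lebesgue integral in \<open>last_zero_density\<close>
    would be 0 by convention. The majorant, with the exponential replaced by 1, has the primitive 2
    / sqrt a * sqrt (y - a).\<close>
  ultimately have fin: "(\<integral>\<^sup>+y. ennreal (indicator {a..v} y * ?h y) \<partial>lborel) < \<infinity>"
    by (auto simp: less_top[symmetric] top_unique)
  have int: "integrable lborel (\<lambda>y. indicator {a..v} y * ?h y)"
    using fin assms by (intro integrableI_nonneg AE_I2) (auto split: split_indicator)
  let ?I = "\<integral>y. indicator {a..v} y * ?h y \<partial>lborel"
  have I: "0 \<le> ?I" using assms by (intro integral_nonneg_AE AE_I2) (auto split: split_indicator)
  have eq: "last_zero_density \<mu> a v = exp (- (\<mu>\<^sup>2 * v / 2)) * (1 / (pi * sqrt (a * (v - a)))) + \<mu>\<^sup>2 / (2 * pi) * ?I"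
    by (simp add: last_zero_density_def set_lebesgue_integral_def)
  show "0 \<le> last_zero_density \<mu> a v" unfolding eq using assms I by simp
  have "ennreal (\<mu>\<^sup>2 / (2 * pi) * ?I) = ennreal (\<mu>\<^sup>2 / (2 * pi)) * (\<integral>\<^sup>+y. ennreal (indicator {a..v} y * ?h y) \<partial>lborel)"
  proof -
    have N: "(\<integral>\<^sup>+y. ennreal (indicator {a..v} y * ?h y) \<partial>lborel) = ennreal ?I"
      using assms by (intro nn_integral_eq_integral int AE_I2) (auto split: split_indicator)
    show ?thesis unfolding N by (rule ennreal_mult') simp
  qed
  also have "\<dots> = (\<integral>\<^sup>+y. ennreal (\<mu>\<^sup>2 / (2 * pi)) * ennreal (indicator {a..v} y * ?h y) \<partial>lborel)"
    by (rule nn_integral_cmult[symmetric]) simp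
  also have "\<dots> = (\<integral>\<^sup>+y. ennreal (\<mu>\<^sup>2 / 2 * exp (- (\<mu>\<^sup>2 * y / 2))) * ennreal (1 / (pi * sqrt (a * (y - a)))) *
         indicator {a<..<v} y \<partial>lborel)"
  proof (rule nn_integral_cong_AE)
    show "AE y in lborel. ennreal (\<mu>\<^sup>2 / (2 * pi)) * ennreal (indicator {a..v} y * ?h y) =
        ennreal (\<mu>\<^sup>2 / 2 * exp (- (\<mu>\<^sup>2 * y / 2))) * ennreal (1 / (pi * sqrt (a * (y - a)))) *
         indicator {a<..<v} y"
      using AE_lborel_singleton[of v]
    proof eventually_elim
      case (elim y)
      then show ?case
        using assms by (auto simp: ennreal_mult[symmetric] mult.commute split: split_indicator)
    qed
  qed
  finally show "ennreal (last_zero_density \<mu> a v) =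
      ennreal (exp (- (\<mu>\<^sup>2 * v / 2))) * ennreal (1 / (pi * sqrt (a * (v - a)))) +
      (\<integral>\<^sup>+y. ennreal (\<mu>\<^sup>2 / 2 * exp (- (\<mu>\<^sup>2 * y / 2))) * ennreal (1 / (pi * sqrt (a * (y - a)))) *
         indicator {a<..<v} y \<partial>lborel)"
    unfolding eq using assms I by (subst ennreal_plus) (auto simp: ennreal_mult'[symmetric])
qed

text \<open>Exchanging the integrals over a and over the horizon y turns the mixture of densities
  into a mixture of \<open>arcsine_mass\<close>.\<close>

lemma nn_integral_last_zero_density_Fubini:
  assumes "0 < x" "x \<le> v"
  shows "(\<integral>\<^sup>+a. ennreal (last_zero_density \<mu> a v) * indicator {0<..<x} a \<partial>lborel) =
    ennreal (exp (- (\<mu>\<^sup>2 * v / 2))) * arcsine_mass x v +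
    (\<integral>\<^sup>+y. ennreal (\<mu>\<^sup>2 / 2 * exp (- (\<mu>\<^sup>2 * y / 2))) * arcsine_mass x y * indicator {0<..<v} y \<partial>lborel)"
proof -
  let ?k = "\<lambda>a y. ennreal (1 / (pi * sqrt (a * (y - a))))"
  let ?e = "\<lambda>y. ennreal (\<mu>\<^sup>2 / 2 * exp (- (\<mu>\<^sup>2 * y / 2)))"
  let ?g = "\<lambda>a y. ?e y * ?k a y * (if 0 < a \<and> a < x \<and> a < y \<and> y < v then 1 else 0)"
  have "(\<integral>\<^sup>+a. ennreal (last_zero_density \<mu> a v) * indicator {0<..<x} a \<partial>lborel) =
      (\<integral>\<^sup>+a. ennreal (exp (- (\<mu>\<^sup>2 * v / 2))) * (?k a v * indicator {0<..<x} a * indicator {0<..<v} a) +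
        (\<integral>\<^sup>+y. ?g a y \<partial>lborel) \<partial>lborel)"
  proof (rule nn_integral_cong)
    fix a :: real
    show "ennreal (last_zero_density \<mu> a v) * indicator {0<..<x} a =
       ennreal (exp (- (\<mu>\<^sup>2 * v / 2))) * (?k a v * indicator {0<..<x} a * indicator {0<..<v} a) +
        (\<integral>\<^sup>+y. ?g a y \<partial>lborel)"
    proof (cases "0 < a \<and> a < x")
      case True
      then have "(\<integral>\<^sup>+y. ?e y * ?k a y * indicator {a<..<v} y \<partial>lborel) = (\<integral>\<^sup>+y. ?g a y \<partial>lborel)"
        by (intro nn_integral_cong) (auto split: split_indicator)
      then show ?thesis
        using True assms last_zero_density_eq(2)[of a v \<mu>] by simp
    qed (use assms in \<open>auto split: split_indicator\<close>)
  qed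
  also have "\<dots> = ennreal (exp (- (\<mu>\<^sup>2 * v / 2))) * arcsine_mass x v + (\<integral>\<^sup>+a. \<integral>\<^sup>+y. ?g a y \<partial>lborel \<partial>lborel)"
    unfolding arcsine_mass_def by (subst nn_integral_add) (auto simp: nn_integral_cmult)
  also have "(\<integral>\<^sup>+a. \<integral>\<^sup>+y. ?g a y \<partial>lborel \<partial>lborel) = (\<integral>\<^sup>+y. \<integral>\<^sup>+a. ?g a y \<partial>lborel \<partial>lborel)"
    by (rule lborel_pair.Fubini'[symmetric]) measurable
  also have "\<dots> = (\<integral>\<^sup>+y. ?e y * arcsine_mass x y * indicator {0<..<v} y \<partial>lborel)"
  proof (rule nn_integral_cong)
    fix y :: real
    have "(\<integral>\<^sup>+a. ?g a y \<partial>lborel) = (\<integral>\<^sup>+a. (?e y * indicator {0<..<v} y) *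
        (?k a y * indicator {0<..<x} a * indicator {0<..<y} a) \<partial>lborel)"
      by (intro nn_integral_cong) (auto split: split_indicator)
    also have "\<dots> = (?e y * indicator {0<..<v} y) * arcsine_mass x y"
      unfolding arcsine_mass_def by (rule nn_integral_cmult) simp
    finally show "(\<integral>\<^sup>+a. ?g a y \<partial>lborel) = ?e y * arcsine_mass x y * indicator {0<..<v} y"
      by (simp add: mult_ac)
  qed
  finally show ?thesis .
qed

lemma nn_integral_exp_square:
  assumes "0 < x"
  shows "(\<integral>\<^sup>+y. ennreal (\<mu>\<^sup>2 / 2 * exp (- (\<mu>\<^sup>2 * y / 2))) * indicator {0<..<x} y \<partial>lborel) =
    ennreal (1 - exp (- (\<mu>\<^sup>2 * x / 2)))"
proof -
  let ?F = "\<lambda>y. - exp (- (\<mu>\<^sup>2 * y / 2))"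
  have F: "(?F \<longlongrightarrow> ?F y) (at y within S)" for y S by (intro tendsto_intros) simp
  have "(\<integral>\<^sup>+y. ennreal (\<mu>\<^sup>2 / 2 * exp (- (\<mu>\<^sup>2 * y / 2))) * indicator {0<..<x} y \<partial>lborel) =
      ennreal (?F x - ?F 0)"
    by (rule nn_integral_FTC_open[OF assms _ _ _ F F])
       (auto intro!: derivative_eq_intros continuous_intros)
  then show ?thesis by simp
qed

text \<open>Every horizon up to v puts its whole mass into (0, v), so only the weights of the
  mixture remain, and they add up to 1.\<close>

lemma nn_integral_last_zero_density_full:
  assumes v: "0 < v"
  shows "(\<integral>\<^sup>+a. ennreal (last_zero_density \<mu> a v) * indicator {0<..<v} a \<partial>lborel) = 1"
proof -
  have "(\<integral>\<^sup>+y. ennreal (\<mu>\<^sup>2 / 2 * exp (- (\<mu>\<^sup>2 * y / 2))) * arcsine_mass v y * indicator {0<..<v} y \<partial>lborel) =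
      (\<integral>\<^sup>+y. ennreal (\<mu>\<^sup>2 / 2 * exp (- (\<mu>\<^sup>2 * y / 2))) * indicator {0<..<v} y \<partial>lborel)"
    using v by (intro nn_integral_cong) (auto simp: arcsine_mass_eq split: split_indicator)
  also have "\<dots> = ennreal (1 - exp (- (\<mu>\<^sup>2 * v / 2)))"
    by (rule nn_integral_exp_square[OF v])
  finally show ?thesis
    using v unfolding nn_integral_last_zero_density_Fubini[OF v order_refl]
    by (simp add: arcsine_mass_eq ennreal_plus[symmetric] del: ennreal_plus)
qed

text \<open>Horizons y below x have all their mass in (0, x) and contribute 1 - exp (- \<mu>^2 x /
  2); those above x combine with the crossing density into an exact derivative, whose boundary terms
  complete the sum to 1. Writing a sum avoids truncated subtraction.\<close>

lemma nn_integral_last_zero_density: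
  assumes x: "0 < x" and v: "x < v"
  shows "(\<integral>\<^sup>+a. ennreal (last_zero_density \<mu> a v) * indicator {0<..<x} a \<partial>lborel) +
    (\<integral>\<^sup>+u. ennreal (crossing_density \<mu> x u) * indicator {x<..<v} u \<partial>lborel) = 1"
proof -
  let ?e = "\<lambda>y. \<mu>\<^sup>2 / 2 * exp (- (\<mu>\<^sup>2 * y / 2))" and ?E = "\<lambda>u. exp (- (\<mu>\<^sup>2 * u / 2))"
  let ?J = "\<integral>\<^sup>+u. ennreal (crossing_density \<mu> x u) * indicator {x<..<v} u \<partial>lborel"
  have [measurable]: "(\<lambda>u. arcsine_cdf x u) \<in> borel_measurable borel"
    unfolding arcsine_cdf_def by measurable
  have [measurable]: "(\<lambda>u. crossing_density \<mu> x u) \<in> borel_measurable borel"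
    unfolding crossing_density_def by measurable
  have "(\<integral>\<^sup>+y. ennreal (?e y) * arcsine_mass x y * indicator {0<..<v} y \<partial>lborel) =
      (\<integral>\<^sup>+y. ennreal (?e y) * indicator {0<..<x} y + ennreal (?e y * arcsine_cdf x y) * indicator {x<..<v} y \<partial>lborel)"
  proof (rule nn_integral_cong_AE)
    show "AE y in lborel. ennreal (?e y) * arcsine_mass x y * indicator {0<..<v} y =
        ennreal (?e y) * indicator {0<..<x} y + ennreal (?e y * arcsine_cdf x y) * indicator {x<..<v} y"
      using AE_lborel_singleton[of x]
    proof eventually_elim
      case (elim y)
      have "ennreal (?e y * arcsine_cdf x y) = ennreal (?e y) * ennreal (arcsine_cdf x y)"
        by (rule ennreal_mult') simp
      with elim show ?case
        using x v by (auto simp only: arcsine_mass_eq split: split_indicator)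
          (auto simp: arcsine_mass_eq)
    qed
  qed
  also have "\<dots> = (\<integral>\<^sup>+y. ennreal (?e y) * indicator {0<..<x} y \<partial>lborel) +
      (\<integral>\<^sup>+y. ennreal (?e y * arcsine_cdf x y) * indicator {x<..<v} y \<partial>lborel)"
    by (rule nn_integral_add) simp_all
  also have "(\<integral>\<^sup>+y. ennreal (?e y) * indicator {0<..<x} y \<partial>lborel) = ennreal (1 - ?E x)"
    by (rule nn_integral_exp_square[OF x])
  finally have "(\<integral>\<^sup>+a. ennreal (last_zero_density \<mu> a v) * indicator {0<..<x} a \<partial>lborel) + ?J =
      ennreal (?E v) * arcsine_mass x v + ennreal (1 - ?E x) +
      ((\<integral>\<^sup>+y. ennreal (?e y * arcsine_cdf x y) * indicator {x<..<v} y \<partial>lborel) + ?J)"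
    using x v by (simp add: nn_integral_last_zero_density_Fubini add_ac)
  also have "(\<integral>\<^sup>+y. ennreal (?e y * arcsine_cdf x y) * indicator {x<..<v} y \<partial>lborel) + ?J =
      (\<integral>\<^sup>+u. ennreal (?e u * arcsine_cdf x u + crossing_density \<mu> x u) * indicator {x<..<v} u \<partial>lborel)"
    using x by (subst nn_integral_add[symmetric])
       (auto intro!: nn_integral_cong simp: arcsine_cdf_nonneg crossing_density_def split: split_indicator)
  also have "\<dots> = ennreal (?E x - ?E v * arcsine_cdf x v)"
    by (rule nn_integral_crossing_density[OF x v])
  also have "ennreal (?E v) * arcsine_mass x v + ennreal (1 - ?E x) + ennreal (?E x - ?E v * arcsine_cdf x v) =
      ennreal (?E v * arcsine_cdf x v + (1 - ?E x) + (?E x - ?E v * arcsine_cdf x v))"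
  proof -
    have "?E v \<le> ?E x" using v by (simp add: mult_left_mono)
    then have "?E v * arcsine_cdf x v \<le> ?E x * 1"
      using arcsine_cdf_nonneg[OF x v] by (intro mult_mono) (auto simp: arcsine_cdf_le_1)
    then show ?thesis
      using x v arcsine_cdf_nonneg[OF x v]
      by (simp add: arcsine_mass_eq ennreal_mult'[symmetric] ennreal_plus[symmetric] del: ennreal_plus)
  qed
  finally show ?thesis by simp
qed

section \<open>The first zero after a fixed time\<close>

lemma borel_measurable_hitting_density [measurable (raw)]:
  assumes [measurable]: "f \<in> borel_measurable N" "g \<in> borel_measurable N"
  shows "(\<lambda>x. hitting_density \<mu> (f x) (g x)) \<in> borel_measurable N"
  unfolding hitting_density_def by measurable

lemma borel_measurable_crossing_density [measurable (raw)]: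
  assumes [measurable]: "f \<in> borel_measurable N" "g \<in> borel_measurable N"
  shows "(\<lambda>x. crossing_density \<mu> (f x) (g x)) \<in> borel_measurable N"
  unfolding crossing_density_def by measurable

text \<open>The linear terms \<mu> y and - \<mu> y of the two exponents cancel; the drift survives
  only in exp (- \<mu>^2 (x + s) / 2), and the rest is a multiple of y exp (- \<beta> y^2), which
  has an elementary primitive. The 1/2 comes from the restriction to positive y.\<close>

lemma nn_integral_hitting_from_normal:
  assumes x: "0 < x" and s: "0 < s"
  shows "(\<integral>\<^sup>+y. ennreal (normal_density (\<mu> * x) (sqrt x) y) *
      (ennreal (hitting_density \<mu> y s) * indicator {0<..} y) \<partial>lborel) =
    ennreal (crossing_density \<mu> x (x + s) / 2)"
proof -
  define p q where "p = sqrt x" and "q = sqrt s"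
  have pq: "0 < p" "0 < q" "x = p\<^sup>2" "s = q\<^sup>2" using x s by (auto simp: p_def q_def)
  \<comment> \<open>\<beta> is 1/(2x) + 1/(2s), the sum of the two quadratic coefficients; C
    collects all that does not depend on y.\<close>
  define \<beta> where "\<beta> = (x + s) / (2 * x * s)"
  define C where "C = exp (- (\<mu>\<^sup>2 * (x + s) / 2)) / (2 * pi * p * q ^ 3)"
  have \<beta>: "0 < \<beta>" using x s by (simp add: \<beta>_def)
  have C: "0 < C" using pq(1,2) by (simp add: C_def)
  let ?f = "\<lambda>y. C * y * exp (- \<beta> * y\<^sup>2)" and ?F = "\<lambda>y. - (C / (2 * \<beta>) * exp (- \<beta> * y\<^sup>2))"
  have f: "normal_density (\<mu> * x) (sqrt x) y * hitting_density \<mu> y s = ?f y" for y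
  proof -
    have "- (y - \<mu> * x)\<^sup>2 / (2 * x) + - (y + \<mu> * s)\<^sup>2 / (2 * s) = - (\<mu>\<^sup>2 * (x + s) / 2) + - \<beta> * y\<^sup>2"
      using x s by (simp add: \<beta>_def field_simps power2_eq_square)
    then have "exp (- (y - \<mu> * x)\<^sup>2 / (2 * x)) * exp (- (y + \<mu> * s)\<^sup>2 / (2 * s)) =
        exp (- (\<mu>\<^sup>2 * (x + s) / 2)) * exp (- \<beta> * y\<^sup>2)"
      unfolding exp_add[symmetric] by (rule arg_cong)
    moreover have "sqrt (2 * pi * x) * sqrt (2 * pi * s ^ 3) = 2 * pi * p * q ^ 3"
    proof -
      have "sqrt (2 * pi * x) * sqrt (2 * pi * s ^ 3) = (sqrt (2 * pi))\<^sup>2 * p * q ^ 3"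
        unfolding real_sqrt_mult[of "2 * pi"] real_sqrt_power p_def q_def
        by (simp only: power2_eq_square mult_ac)
      then show ?thesis by simp
    qed
    ultimately show ?thesis
      using x by (simp add: normal_density_def hitting_density_def C_def)
  qed
  have "(\<integral>\<^sup>+y. ennreal (normal_density (\<mu> * x) (sqrt x) y) *
      (ennreal (hitting_density \<mu> y s) * indicator {0<..} y) \<partial>lborel) =
      (\<integral>\<^sup>+y. ennreal (?f y) * indicator {0..} y \<partial>lborel)"
    \<comment> \<open>The half-line may be closed because \<open>?f\<close> vanishes at 0.\<close>
    by (intro nn_integral_cong) (auto simp: ennreal_mult'[symmetric] f split: split_indicator)
  also have "\<dots> = ennreal (0 - ?F 0)"
  proof (rule nn_integral_FTC_atLeast)
    fix y :: real assume "0 \<le> y"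
    then show "0 \<le> ?f y" using C by simp
    show "(?F has_real_derivative ?f y) (at y)"
      using \<beta> by (auto intro!: derivative_eq_intros)
  next
    show "(?F \<longlongrightarrow> 0) at_top" using \<beta> by real_asymp
  qed simp
  also have "0 - ?F 0 = crossing_density \<mu> x (x + s) / 2"
  proof -
    have "C / (2 * \<beta>) = C * x * s / (x + s)"
      using x s by (simp add: \<beta>_def field_simps)
    moreover have "0 < x + s" using x s by simp
    moreover have "C * x * s = exp (- (\<mu>\<^sup>2 * (x + s) / 2)) * p / (2 * pi * q)"
      using pq(1,2) by (simp add: C_def pq(3,4) power2_eq_square power3_eq_cube)
    ultimately show ?thesis
      by (simp add: crossing_density_def p_def q_def mult_ac)
  qed
  finally show ?thesis .
qed

lemma last_zero_le_iff:
  assumes "x 0 = 0" "0 < w" "0 \<le> a"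
  shows "last_zero x w \<le> a \<longleftrightarrow> (\<forall>s. a < s \<and> s < w \<longrightarrow> x s \<noteq> 0)"
proof -
  let ?S = "{s. 0 \<le> s \<and> s < w \<and> x s = 0}"
  have "0 \<in> ?S" using assms by simp
  then have ne: "?S \<noteq> {}" by blast
  have bdd: "bdd_above ?S" by (auto intro!: bdd_aboveI[of _ w])
  show ?thesis
    unfolding last_zero_def cSup_le_iff[OF ne bdd]
    using assms(3) by (auto simp: not_less[symmetric]) (metis le_less_trans less_imp_le)+
qed

lemma no_zero_constant_sign:
  fixes p :: "real \<Rightarrow> real"
  assumes cont: "continuous_on {a..<b} p" and nz: "\<And>s. s \<in> {a..<b} \<Longrightarrow> p s \<noteq> 0"
  shows "(\<forall>s\<in>{a..<b}. 0 < p s) \<or> (\<forall>s\<in>{a..<b}. p s < 0)"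
proof (rule ccontr)
  assume "\<not> ?thesis"
  then obtain s s' where s: "s \<in> {a..<b}" "p s < 0" "s' \<in> {a..<b}" "0 < p s'"
    using nz by (metis linorder_neqE_linordered_idom)
  have "connected (p ` {a..<b})"
    using cont by (intro connected_continuous_image) auto
  then have "0 \<in> p ` {a..<b}"
    using s by (meson connectedD_interval image_eqI less_imp_le)
  then show False using nz by auto
qed

section \<open>The distribution function of the last zero\<close>

context standard_brownian
begin

text \<open>The left side averages 1 - \<open>survival\<close> over the positive values y of the
  path at x. The hitting density writes this as an integral over s, Fubini averages over y first,
  and the translation u = x + s finishes.\<close>

lemma crossing_probability:
  assumes x: "0 < x" and v: "x < v"
  shows "ennreal (prob (start_pos \<mu> x) -
      (\<integral>\<omega>. indicator (start_pos \<mu> x) \<omega> * reflected_sign \<mu> (B v \<omega> + \<mu> * v) \<partial>M)) =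
    (\<integral>\<^sup>+u. ennreal (crossing_density \<mu> x u / 2) * indicator {x<..<v} u \<partial>lborel)"
proof -
  have [measurable]: "B x \<in> borel_measurable M" "B 0 \<in> borel_measurable M"
    using x by (auto intro!: B_measurable)
  let ?X = "\<lambda>\<omega>. B x \<omega> - B 0 \<omega> + \<mu> * x" and ?r = "v - x"
  have X: "?X \<omega> = B x \<omega> + \<mu> * x" if "\<omega> \<in> space M" for \<omega>
    using B_0[OF that] by simp
  have "distributed M lborel (\<lambda>\<omega>. \<mu> * x + 1 * (B x \<omega> - B 0 \<omega>))
      (\<lambda>y. ennreal (normal_density (\<mu> * x + 1 * 0) (\<bar>1\<bar> * sqrt (x - 0)) y))"
    using x by (intro normal_density_affine B_increment) auto
  then have dist: "distributed M lborel ?X (\<lambda>y. ennreal (normal_density (\<mu> * x) (sqrt x) y))"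
    by (simp add: add.commute)
  define E where "E = {d \<in> space (PiM {..0::nat} (\<lambda>_. borel :: real measure)). 0 < d 0 + \<mu> * x}"
  have E: "E \<in> sets (PiM {..0} (\<lambda>_. borel))" unfolding E_def by measurable
  have ind: "indicator E (\<lambda>i\<in>{..0}. B x \<omega>) = (indicator (start_pos \<mu> x) \<omega> :: real)" if "\<omega> \<in> space M" for \<omega>
    \<comment> \<open>\<open>start_pos\<close> was introduced under 0 < x < w < v; these hypotheses
      are met with v and v + 1 in place of w and v.\<close>
    using that by (auto simp: E_def start_pos_def[OF x v less_add_one] space_PiM split: split_indicator)
  let ?S = "\<lambda>\<omega>. indicator (start_pos \<mu> x) \<omega> * survival \<mu> ?r (B x \<omega> + \<mu> * x)"
  have eq: "(\<integral>\<omega>. indicator (start_pos \<mu> x) \<omega> * reflected_sign \<mu> (B v \<omega> + \<mu> * v) \<partial>M) = (\<integral>\<omega>. ?S \<omega> \<partial>M)"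
    using expectation_reflected_sign_past(1)[of "\<lambda>_. x" 0 v E \<mu>] x v E ind
    by (simp cong: Bochner_Integration.integral_cong)
  have int: "integrable M ?S"
    using expectation_reflected_sign_past(2)[of "\<lambda>_. x" 0 v E \<mu>] x v E ind
    by (simp cong: Bochner_Integration.integrable_cong)
  have start [measurable]: "start_pos \<mu> x \<in> sets M"
    by (rule sets_events(1)[OF x v less_add_one])
  have int1: "integrable M (indicator (start_pos \<mu> x) :: 'a \<Rightarrow> real)"
    by (intro integrable_real_indicator) (auto simp: emeasure_eq_measure)
  have nonneg: "0 \<le> 1 - survival \<mu> r y" for r y
  proof -
    have "survival \<mu> r y \<le> 1 - 0"
      unfolding survival_def
      by (intro diff_mono std_normal_cdf_le_1) (auto simp: std_normal_cdf_nonneg)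
    then show ?thesis by simp
  qed
  let ?H = "\<lambda>y s. ennreal (hitting_density \<mu> y s) * indicator {0<..<?r} s"
  let ?n = "\<lambda>y. ennreal (normal_density (\<mu> * x) (sqrt x) y)"
  have "ennreal (prob (start_pos \<mu> x) - (\<integral>\<omega>. ?S \<omega> \<partial>M)) = ennreal (\<integral>\<omega>. indicator (start_pos \<mu> x) \<omega> - ?S \<omega> \<partial>M)"
    using int int1 by simp
  also have "\<dots> = (\<integral>\<^sup>+\<omega>. ennreal (indicator (start_pos \<mu> x) \<omega> - ?S \<omega>) \<partial>M)"
    using int int1 nonneg
    by (intro nn_integral_eq_integral[symmetric]) (auto split: split_indicator)
  also have "\<dots> = (\<integral>\<^sup>+\<omega>. indicator {0<..} (?X \<omega>) * (\<integral>\<^sup>+s. ?H (?X \<omega>) s \<partial>lborel) \<partial>M)"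
  proof (rule nn_integral_cong)
    fix \<omega> assume "\<omega> \<in> space M"
    then show "ennreal (indicator (start_pos \<mu> x) \<omega> - ?S \<omega>) =
        indicator {0<..} (?X \<omega>) * (\<integral>\<^sup>+s. ?H (?X \<omega>) s \<partial>lborel)"
      using nn_integral_hitting_density[of "?X \<omega>" ?r \<mu>] v
      by (auto simp: X start_pos_def[OF x v less_add_one] split: split_indicator)
  qed
  also have "\<dots> = (\<integral>\<^sup>+y. ?n y * (indicator {0<..} y * (\<integral>\<^sup>+s. ?H y s \<partial>lborel)) \<partial>lborel)"
    by (rule distributed_nn_integral[OF dist, symmetric]) simp
  also have "\<dots> = (\<integral>\<^sup>+y. \<integral>\<^sup>+s. ?n y * (indicator {0<..} y * ?H y s) \<partial>lborel \<partial>lborel)"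
    by (simp add: nn_integral_cmult)
  also have "\<dots> = (\<integral>\<^sup>+s. \<integral>\<^sup>+y. ?n y * (indicator {0<..} y * ?H y s) \<partial>lborel \<partial>lborel)"
    by (rule lborel_pair.Fubini'[symmetric]) measurable
  also have "\<dots> = (\<integral>\<^sup>+s. ennreal (crossing_density \<mu> x (x + s) / 2) * indicator {0<..<?r} s \<partial>lborel)"
  proof (rule nn_integral_cong)
    fix s :: real
    have "(\<integral>\<^sup>+y. ?n y * (indicator {0<..} y * ?H y s) \<partial>lborel) =
        (\<integral>\<^sup>+y. ?n y * (ennreal (hitting_density \<mu> y s) * indicator {0<..} y) * indicator {0<..<?r} s \<partial>lborel)"
      by (intro nn_integral_cong) (simp add: mult_ac)
    also have "\<dots> = (\<integral>\<^sup>+y. ?n y * (ennreal (hitting_density \<mu> y s) * indicator {0<..} y) \<partial>lborel) * indicator {0<..<?r} s"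
      by (rule nn_integral_multc) measurable
    also have "\<dots> = ennreal (crossing_density \<mu> x (x + s) / 2) * indicator {0<..<?r} s"
      using nn_integral_hitting_from_normal[OF x, of s \<mu>] by (simp split: split_indicator)
    finally show "(\<integral>\<^sup>+y. ?n y * (indicator {0<..} y * ?H y s) \<partial>lborel) =
        ennreal (crossing_density \<mu> x (x + s) / 2) * indicator {0<..<?r} s" .
  qed
  also have "\<dots> = (\<integral>\<^sup>+s. ennreal (crossing_density \<mu> x (x + 1 * s) / 2) * indicator {x<..<v} (x + 1 * s) \<partial>lborel)"
    by (intro nn_integral_cong) (auto split: split_indicator)
  also have "\<dots> = (\<integral>\<^sup>+u. ennreal (crossing_density \<mu> x u / 2) * indicator {x<..<v} u \<partial>lborel)"
    using nn_integral_real_affine[of "\<lambda>u. ennreal (crossing_density \<mu> x u / 2) * indicator {x<..<v} u" 1 x]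
    by simp
  finally show ?thesis unfolding eq .
qed

text \<open>The last zero is at most x iff (x, v) is free of zeros; almost surely x is not a zero
  either, so the path keeps one sign on [x, v). Each sign loses \<open>?J\<close> from its start
  event, and the two start events almost surely fill the space.\<close>

lemma prob_last_zero_le:
  fixes \<mu> :: real
  assumes x: "0 < x" and v: "x < v"
  defines "L \<equiv> {\<omega> \<in> space M. last_zero (\<lambda>s. B s \<omega> + \<mu> * s) v \<le> x}"
  assumes L [measurable]: "L \<in> sets M"
  shows "emeasure M L = (\<integral>\<^sup>+a. ennreal (last_zero_density \<mu> a v) * indicator {0<..<x} a \<partial>lborel)"
proof -
  interpret neg: standard_brownian M "\<lambda>s \<omega>. - B s \<omega>" by (rule standard_brownian_uminus)
  let ?P = "{\<omega> \<in> space M. \<forall>s\<in>{x..<v}. 0 < B s \<omega> + \<mu> * s}"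
  let ?N = "{\<omega> \<in> space M. \<forall>s\<in>{x..<v}. 0 < - B s \<omega> + (- \<mu>) * s}"
  let ?J = "\<integral>\<^sup>+u. ennreal (crossing_density \<mu> x u / 2) * indicator {x<..<v} u \<partial>lborel"
  note start = start_pos_def[OF x v less_add_one] neg.start_pos_def[OF x v less_add_one]
  have PN [measurable]: "?P \<in> sets M" "?N \<in> sets M"
    by (rule prob_positive_until(1)[OF x v] neg.prob_positive_until(1)[OF x v])+
  have nz: "AE \<omega> in M. B x \<omega> + \<mu> * x \<noteq> 0"
    using x by (rule AE_drifted_nonzero)
  have st [measurable]: "start_pos \<mu> x \<in> sets M" "neg.start_pos (- \<mu>) x \<in> sets M"
    by (rule sets_events(1)[OF x v less_add_one] neg.sets_events(1)[OF x v less_add_one])+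
  have disj: "emeasure M (start_pos \<mu> x \<union> neg.start_pos (- \<mu>) x) = 1"
    proof (subst emeasure_eq_1_AE)
    show "AE \<omega> in M. \<omega> \<in> start_pos \<mu> x \<union> neg.start_pos (- \<mu>) x"
      using nz AE_space by eventually_elim (auto simp: start)
  qed simp_all
  have *: "emeasure M (start_pos \<mu> x) = emeasure M ?P + ?J"
    "emeasure M (neg.start_pos (- \<mu>) x) = emeasure M ?N + ?J"
  proof -
    \<comment> \<open>\<open>ennreal\<close> sends negative numbers to 0, so the differences below
      can be turned into sums only with these inclusions.\<close>
    have "?P \<subseteq> start_pos \<mu> x" "?N \<subseteq> neg.start_pos (- \<mu>) x"
      using v by (auto simp: start)
    then have le: "prob ?P \<le> prob (start_pos \<mu> x)" "prob ?N \<le> prob (neg.start_pos (- \<mu>) x)"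
      by (auto intro!: finite_measure_mono)
    have 1: "ennreal (prob (start_pos \<mu> x) - prob ?P) = ?J"
      using crossing_probability[OF x v, of \<mu>] prob_positive_until(2)[OF x v, of \<mu>] by simp
    have 2: "ennreal (prob (neg.start_pos (- \<mu>) x) - prob ?N) = ?J"
      using neg.crossing_probability[OF x v, of "- \<mu>"] neg.prob_positive_until(2)[OF x v, of "- \<mu>"]
      by (simp add: crossing_density_def)
    have split: "ennreal a = ennreal b + J" if "b \<le> a" "0 \<le> b" "ennreal (a - b) = J" for a b J
      using that(1,2) unfolding that(3)[symmetric] by (simp add: ennreal_plus[symmetric] del: ennreal_plus)
    show "emeasure M (start_pos \<mu> x) = emeasure M ?P + ?J"
      unfolding emeasure_eq_measure by (rule split[OF le(1) measure_nonneg 1])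
    show "emeasure M (neg.start_pos (- \<mu>) x) = emeasure M ?N + ?J"
      unfolding emeasure_eq_measure by (rule split[OF le(2) measure_nonneg 2])
  qed
  have "emeasure M L = emeasure M (?P \<union> ?N)"
  proof (rule emeasure_eq_AE)
    show "AE \<omega> in M. \<omega> \<in> L \<longleftrightarrow> \<omega> \<in> ?P \<union> ?N"
      using nz AE_space
    proof eventually_elim
      case (elim \<omega>)
      have X0: "B 0 \<omega> + \<mu> * 0 = 0" using B_0[OF elim(2)] by simp
      have "\<omega> \<in> L \<longleftrightarrow> (\<forall>s. x < s \<and> s < v \<longrightarrow> B s \<omega> + \<mu> * s \<noteq> 0)"
        unfolding L_def using last_zero_le_iff[where x="\<lambda>s. B s \<omega> + \<mu> * s", OF X0] x v elim by simp
      also have "\<dots> \<longleftrightarrow> (\<forall>s\<in>{x..<v}. B s \<omega> + \<mu> * s \<noteq> 0)"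
        using elim(1) by (metis atLeastLessThan_iff le_less less_imp_le)
      also have "\<dots> \<longleftrightarrow> \<omega> \<in> ?P \<union> ?N"
      proof
        assume nz: "\<forall>s\<in>{x..<v}. B s \<omega> + \<mu> * s \<noteq> 0"
        have "continuous_on {x..<v} (\<lambda>s. B s \<omega> + \<mu> * s)"
          using x by (intro continuous_intros continuous_on_subset[OF B_continuous[OF elim(2)]]) auto
        from no_zero_constant_sign[OF this] nz elim(2) show "\<omega> \<in> ?P \<union> ?N"
          by auto
      next
        assume "\<omega> \<in> ?P \<union> ?N"
        then show "\<forall>s\<in>{x..<v}. B s \<omega> + \<mu> * s \<noteq> 0" by force
      qed
      finally show ?case .
    qed
  qed (use L PN in auto)
  also have "\<dots> = emeasure M ?P + emeasure M ?N"
    using v PN by (intro plus_emeasure[symmetric]) force+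
  finally have Leq: "emeasure M L = emeasure M ?P + emeasure M ?N" .
  have "1 = emeasure M (start_pos \<mu> x) + emeasure M (neg.start_pos (- \<mu>) x)"
    unfolding disj[symmetric] by (intro plus_emeasure[symmetric] st) (auto simp: start)
  also have "\<dots> = emeasure M L + (?J + ?J)"
    unfolding * Leq by (simp add: add_ac)
  also have "?J + ?J = (\<integral>\<^sup>+u. ennreal (crossing_density \<mu> x u) * indicator {x<..<v} u \<partial>lborel)"
  proof -
    have "0 \<le> crossing_density \<mu> x u" if "x < u" for u
      using that x by (simp add: crossing_density_def)
    then show ?thesis
      by (subst nn_integral_add[symmetric])
         (auto intro!: nn_integral_cong simp: ennreal_plus[symmetric] simp del: ennreal_plus split: split_indicator)
  qed
  finally have 1: "emeasure M L + (\<integral>\<^sup>+u. ennreal (crossing_density \<mu> x u) * indicator {x<..<v} u \<partial>lborel) = 1"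
    by simp
  \<comment> \<open>Cancelling a summand in the extended reals requires that it be finite.\<close>
  then have "(\<integral>\<^sup>+u. ennreal (crossing_density \<mu> x u) * indicator {x<..<v} u \<partial>lborel) \<noteq> \<infinity>"
    by (metis ennreal_add_eq_top ennreal_one_neq_top infinity_ennreal_def)
  then show ?thesis
    using 1 nn_integral_last_zero_density[OF x v, of \<mu>]
    by (metis ennreal_add_left_cancel add.commute infinity_ennreal_def)
qed

end

section \<open>Measurability and law of the last zero\<close>

text \<open>A zero need not occur at a rational time, but arbitrarily small values at rational times
  of a compact interval force one if the path is continuous. Only countably many coordinates are
  read.\<close>

definition path_zero_between :: "(real \<Rightarrow> real) \<Rightarrow> real \<Rightarrow> real \<Rightarrow> bool" where
  "path_zero_between p a b \<longleftrightarrow> (\<forall>m. \<exists>s\<in>\<rat> \<inter> {a..b}. \<bar>p s\<bar> < 1 / real (Suc m))"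

lemma path_zero_between_iff:
  assumes cont: "continuous_on {a..b} p" and ab: "a < b"
  shows "path_zero_between p a b \<longleftrightarrow> (\<exists>s\<in>{a..b}. p s = 0)"
proof
  assume *: "path_zero_between p a b"
  have "continuous_on {a..b} (\<lambda>s. \<bar>p s\<bar>)" using cont by (intro continuous_intros)
  then obtain u where u: "u \<in> {a..b}" "\<And>s. s \<in> {a..b} \<Longrightarrow> \<bar>p u\<bar> \<le> \<bar>p s\<bar>"
    using continuous_attains_inf[of "{a..b}" "\<lambda>s. \<bar>p s\<bar>"] ab by auto
  have "p u = 0"
  proof (rule ccontr)
    assume "p u \<noteq> 0"
    then obtain m where "1 / real (Suc m) < \<bar>p u\<bar>"
      using reals_Archimedean[of "\<bar>p u\<bar>"] by (auto simp: inverse_eq_divide)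
    moreover obtain s where "s \<in> \<rat> \<inter> {a..b}" "\<bar>p s\<bar> < 1 / real (Suc m)"
      using * unfolding path_zero_between_def by blast
    ultimately show False using u(2)[of s] by auto
  qed
  then show "\<exists>s\<in>{a..b}. p s = 0" using u(1) by blast
next
  assume "\<exists>s\<in>{a..b}. p s = 0"
  then obtain u where u: "u \<in> {a..b}" "p u = 0" by blast
  show "path_zero_between p a b"
    unfolding path_zero_between_def
  proof
    fix m
    have "0 < 1 / real (Suc m)" by simp
    then obtain d where d: "d > 0" "\<And>s. s \<in> {a..b} \<Longrightarrow> dist s u < d \<Longrightarrow> dist (p s) (p u) < 1 / real (Suc m)"
      using cont u(1) unfolding continuous_on_iff by metis
    \<comment> \<open>Since a < b, an open interval inside [a, b] close to u remains even if u is an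
      end point.\<close>
    have "max a (u - d) < min b (u + d)" using u ab d by auto
    then obtain s where s: "s \<in> \<rat>" "max a (u - d) < s" "s < min b (u + d)"
      using Rats_dense_in_real by blast
    then have "dist (p s) (p u) < 1 / real (Suc m)"
      by (intro d(2)) (auto simp: dist_real_def)
    then show "\<exists>s\<in>\<rat> \<inter> {a..b}. \<bar>p s\<bar> < 1 / real (Suc m)"
      using s u(2) by (intro bexI[of _ s]) (auto simp: dist_real_def)
  qed
qed

text \<open>
  This reads a path only at rational times, hence is measurable for the product sigma-algebra; it agrees with
  the last zero on continuous paths, including the junk value for \<open>w \<le> 0\<close>.
\<close>

definition rational_last_zero :: "(real \<Rightarrow> real) \<Rightarrow> real \<Rightarrow> real" where
  "rational_last_zero p w = (if 0 < w
     then SUP (a, b) \<in> {(a, b). a \<in> \<rat> \<and> b \<in> \<rat> \<and> 0 \<le> a \<and> a < b}.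
       if b < w \<and> path_zero_between p a b then a else 0
     else Sup {})"

text \<open>A pair (a, b) that sees a zero before w bounds the last zero below by a, and any
  positive zero before w is approached from below by such rational a. The value 0 of the other pairs
  stands for the zero at time 0.\<close>

lemma last_zero_eq_rational:
  assumes cont: "continuous_on {0..} p" and p0: "p 0 = 0"
  shows "last_zero p w = rational_last_zero p w"
proof (cases "0 < w")
  case False
  then have "{s. 0 \<le> s \<and> s < w \<and> p s = 0} = {}" by auto
  then show ?thesis using False by (simp only: last_zero_def rational_last_zero_def if_False)
next
  case True
  let ?I = "{(a, b). a \<in> \<rat> \<and> b \<in> \<rat> \<and> 0 \<le> a \<and> a < (b::real)}"
  let ?f = "\<lambda>(a, b). if b < w \<and> path_zero_between p a b then a else 0"
  let ?S = "{s. 0 \<le> s \<and> s < w \<and> p s = 0}"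
  have z: "path_zero_between p a b \<longleftrightarrow> (\<exists>s\<in>{a..b}. p s = 0)" if "0 \<le> a" "a < b" for a b
    using that by (intro path_zero_between_iff continuous_on_subset[OF cont]) auto
  have bddS: "bdd_above ?S" by (auto intro!: bdd_aboveI[of _ w])
  have bddf: "bdd_above (?f ` ?I)" using True by (auto intro!: bdd_aboveI[of _ w])
  have S0: "0 \<in> ?S" using p0 True by simp
  have I0: "(0, 1) \<in> ?I" by simp
  have "Sup ?S = Sup (?f ` ?I)"
  proof (rule antisym)
    show "Sup ?S \<le> Sup (?f ` ?I)"
    proof (rule cSup_least)
      show "?S \<noteq> {}" using S0 by blast
      fix s assume s: "s \<in> ?S"
      show "s \<le> Sup (?f ` ?I)"
      proof (cases "s = 0")
        case True
        have "0 \<le> ?f (0, 1)" by simp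
        also have "\<dots> \<le> Sup (?f ` ?I)" by (rule cSup_upper[OF imageI[OF I0] bddf])
        finally show ?thesis using True by simp
      next
        case False
        show ?thesis
        proof (rule dense_le)
          fix r assume "r < s"
          then have "max 0 r < s" using s False by auto
          then obtain a where a: "a \<in> \<rat>" "max 0 r < a" "a < s"
            using Rats_dense_in_real by blast
          obtain b where b: "b \<in> \<rat>" "s < b" "b < w"
            using Rats_dense_in_real[of s w] s by auto
          have "path_zero_between p a b"
            using a b s by (subst z) auto
          then have "a = ?f (a, b)" using b by simp
          also have "\<dots> \<le> Sup (?f ` ?I)"
            using a b by (intro cSup_upper[OF imageI bddf]) auto
          finally show "r \<le> Sup (?f ` ?I)" using a by simp
        qed
      qed
    qed
  next
    show "Sup (?f ` ?I) \<le> Sup ?S"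
    proof (rule cSup_least)
      show "?f ` ?I \<noteq> {}" using I0 by blast
      fix y assume "y \<in> ?f ` ?I"
      then obtain a b where ab: "0 \<le> a" "a < b" and y: "y = ?f (a, b)" by auto
      show "y \<le> Sup ?S"
      proof (cases "b < w \<and> path_zero_between p a b")
        case True
        then obtain s where "s \<in> {a..b}" "p s = 0" using z[OF ab] by blast
        moreover from this have "s \<le> Sup ?S"
          using True ab by (intro cSup_upper[OF _ bddS]) auto
        ultimately show ?thesis using True by (simp add: y)
      next
        case False
        then have "y = 0" unfolding y by auto
        then show ?thesis using cSup_upper[OF S0 bddS] by simp
      qed
    qed
  qed
  then show ?thesis using True by (simp add: last_zero_def rational_last_zero_def)
qed

text \<open>Joint measurability in path and time allows an independent random time to be substituted
  for the second argument. The supremum runs over countably many rational pairs.\<close>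

lemma borel_measurable_rational_last_zero:
  "(\<lambda>z. rational_last_zero (fst z) (snd z)) \<in> borel_measurable (PiM {0..} (\<lambda>_. borel) \<Otimes>\<^sub>M borel)"
proof -
  let ?N = "PiM {0::real..} (\<lambda>_. borel :: real measure) \<Otimes>\<^sub>M (borel :: real measure)"
  let ?I = "{(a, b). a \<in> \<rat> \<and> b \<in> \<rat> \<and> 0 \<le> a \<and> a < (b::real)}"
  let ?f = "\<lambda>i z. (\<lambda>(a, b). if b < snd z \<and> path_zero_between (fst z) a b then a else 0) i :: real"
  have rat: "countable (\<rat> \<inter> A)" for A :: "real set"
    using countable_rat by (rule countable_subset[rotated]) auto
  have I: "countable ?I"
    by (rule countable_subset[of _ "\<rat> \<times> \<rat>"]) (auto intro: countable_rat)
  have "(\<lambda>z. SUP i\<in>?I. ?f i z) \<in> borel_measurable ?N"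
  proof (rule borel_measurable_cSUP[OF I])
    fix i assume "i \<in> ?I"
    then obtain a b where i: "i = (a, b)" "0 \<le> a" by auto
    have [measurable]: "(\<lambda>z. fst z s) \<in> borel_measurable ?N" if "s \<in> \<rat> \<inter> {a..b}" for s
      using that i by (intro measurable_compose[OF measurable_fst measurable_component_singleton]) auto
    note [measurable] = rat
    have [measurable]: "Measurable.pred ?N (\<lambda>z. path_zero_between (fst z) a b)"
      unfolding path_zero_between_def
      by (intro pred_intros_countable pred_intros_countable_bounded rat) measurable
    show "?f i \<in> borel_measurable ?N"
      unfolding i by simp
  next
    fix z assume "z \<in> space ?N"
    show "bdd_above ((\<lambda>i. ?f i z) ` ?I)"
      \<comment> \<open>The bound has to cover every z, including nonpositive times, where all terms
        are 0.\<close>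
      by (auto intro!: bdd_aboveI[of _ "max 0 (snd z)"])
  qed
  then have [measurable]: "(\<lambda>z. SUP (a, b)\<in>?I. if b < snd z \<and> path_zero_between (fst z) a b then a else 0) \<in> borel_measurable ?N"
    by (simp add: case_prod_beta)
  show ?thesis
    unfolding rational_last_zero_def by measurable
qed

section \<open>The last zero of a drifted path as a random variable\<close>

context standard_brownian
begin

lemma last_zero_eq_rational_path:
  assumes "\<omega> \<in> space M"
  shows "last_zero (\<lambda>s. B s \<omega> + \<mu> * s) w = rational_last_zero (\<lambda>s\<in>{0..}. B s \<omega> + \<mu> * s) w"
proof -
  let ?X = "\<lambda>s\<in>{0..}. B s \<omega> + \<mu> * s"
  have "continuous_on {0..} (\<lambda>s. B s \<omega> + \<mu> * s)"
    using assms by (intro continuous_intros B_continuous)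
  then have "continuous_on {0..} ?X"
    by (subst continuous_on_cong[OF refl]) auto
  moreover have "last_zero (\<lambda>s. B s \<omega> + \<mu> * s) w = last_zero ?X w"
    unfolding last_zero_def by (intro arg_cong[where f=Sup]) auto
  ultimately show ?thesis
    using last_zero_eq_rational[of ?X] assms by (simp add: B_0)
qed

lemma last_zero_measurable:
  assumes "0 < w"
  shows "(\<lambda>\<omega>. last_zero (\<lambda>s. B s \<omega> + \<mu> * s) w) \<in> borel_measurable M"
proof -
  let ?X = "\<lambda>\<omega>. \<lambda>s\<in>{0..}. B s \<omega> + \<mu> * s"
  have "?X \<in> measurable M (PiM {0..} (\<lambda>_. borel))"
    by (intro measurable_restrict borel_measurable_add B_measurable) auto
  then have "(\<lambda>\<omega>. rational_last_zero (?X \<omega>) w) \<in> borel_measurable M"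
    using measurable_compose[OF measurable_Pair[OF _ measurable_const[of w borel]] borel_measurable_rational_last_zero]
    by simp
  then show ?thesis
    by (subst measurable_cong) (auto simp: last_zero_eq_rational_path)
qed

text \<open>Distribution functions are compared: between 0 and w by
  \<open>prob_last_zero_le\<close>, elsewhere both are trivially 0 or 1. The point 0, excluded
  there, follows by right continuity, so that there is no atom at 0.\<close>

lemma distributed_last_zero:
  assumes w: "0 < w"
  shows "distributed M lborel (\<lambda>\<omega>. last_zero (\<lambda>s. B s \<omega> + \<mu> * s) w)
    (\<lambda>x. ennreal (last_zero_density \<mu> x w) * indicator {0<..<w} x)"
proof -
  let ?L = "\<lambda>\<omega>. last_zero (\<lambda>s. B s \<omega> + \<mu> * s) w"
  let ?f = "\<lambda>x. ennreal (last_zero_density \<mu> x w) * indicator {0<..<w} x"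
  note L [measurable] = last_zero_measurable[OF w, of \<mu>]
  have f [measurable]: "?f \<in> borel_measurable borel"
    using borel_measurable_last_zero_density'[of "\<lambda>x. x" borel "\<lambda>_. w" \<mu>] by measurable
  interpret D: real_distribution "distr M borel ?L" by simp
  have "prob_space (density lborel ?f)"
    by (rule prob_spaceI) (simp add: emeasure_density nn_integral_last_zero_density_full[OF w])
  then interpret E: real_distribution "density lborel ?f"
    by (simp add: real_distribution_def real_distribution_axioms_def)
  have space: "{\<omega> \<in> space M. ?L \<omega> \<in> A} = ?L -` A \<inter> space M" for A by auto
  have bounds: "0 \<le> ?L \<omega>" "?L \<omega> \<le> w" if "\<omega> \<in> space M" for \<omega>
  proof -
    let ?S = "{s. 0 \<le> s \<and> s < w \<and> B s \<omega> + \<mu> * s = 0}"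
    have 0: "0 \<in> ?S" using B_0[OF that] w by simp
    have "bdd_above ?S" by (auto intro!: bdd_aboveI[of _ w])
    from cSup_upper[OF 0 this] show "0 \<le> ?L \<omega>" by (simp add: last_zero_def)
    show "?L \<omega> \<le> w" unfolding last_zero_def using 0 by (intro cSup_least) auto
  qed
  have eq: "cdf (distr M borel ?L) x = cdf (density lborel ?f) x" if "x \<noteq> 0" for x
  proof -
    have dist: "emeasure (distr M borel ?L) {..x} = emeasure M {\<omega> \<in> space M. ?L \<omega> \<le> x}"
      by (subst emeasure_distr) (auto intro!: arg_cong[where f="emeasure M"])
    have dens: "emeasure (density lborel ?f) {..x} = (\<integral>\<^sup>+a. ?f a * indicator {..x} a \<partial>lborel)"
      by (subst emeasure_density) auto
    consider "x < 0" | "0 < x" "x < w" | "w \<le> x" using \<open>x \<noteq> 0\<close> by linarith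
    then have "emeasure (distr M borel ?L) {..x} = emeasure (density lborel ?f) {..x}"
    proof cases
      case 1
      then have e1: "{\<omega> \<in> space M. ?L \<omega> \<le> x} = {}" using bounds(1) by force
      have e2: "(\<integral>\<^sup>+a. ?f a * indicator {..x} a \<partial>lborel) = (\<integral>\<^sup>+a. 0 \<partial>(lborel :: real measure))"
        using 1 by (intro nn_integral_cong) (auto split: split_indicator)
      show ?thesis unfolding dist dens e1 e2 by simp
    next
      case 2
      have "emeasure M {\<omega> \<in> space M. ?L \<omega> \<le> x} =
          (\<integral>\<^sup>+a. ennreal (last_zero_density \<mu> a w) * indicator {0<..<x} a \<partial>lborel)"
        by (rule prob_last_zero_le[OF 2]) measurable
      also have "\<dots> = (\<integral>\<^sup>+a. ?f a * indicator {..x} a \<partial>lborel)"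
      proof (rule nn_integral_cong_AE)
        show "AE a in lborel. ennreal (last_zero_density \<mu> a w) * indicator {0<..<x} a = ?f a * indicator {..x} a"
          using AE_lborel_singleton[of x] by eventually_elim (use 2 in \<open>auto split: split_indicator\<close>)
      qed
      finally show ?thesis by (simp add: dist dens)
    next
      case 3
      then have e1: "{\<omega> \<in> space M. ?L \<omega> \<le> x} = space M" using bounds(2) by force
      have e2: "(\<integral>\<^sup>+a. ?f a * indicator {..x} a \<partial>lborel) = (\<integral>\<^sup>+a. ?f a \<partial>lborel)"
        using 3 by (intro nn_integral_cong) (auto split: split_indicator)
      show ?thesis
        unfolding dist dens e1 e2 by (simp add: emeasure_space_1 nn_integral_last_zero_density_full[OF w])
    qed
    then show ?thesis by (simp add: cdf_def measure_def)
  qed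
  have "cdf (distr M borel ?L) 0 = cdf (density lborel ?f) 0"
  proof (rule tendsto_unique)
    show "(cdf (distr M borel ?L) \<longlongrightarrow> cdf (distr M borel ?L) 0) (at_right 0)"
      using D.cdf_is_right_cont[of 0] by (simp add: continuous_within)
    have "(cdf (density lborel ?f) \<longlongrightarrow> cdf (density lborel ?f) 0) (at_right 0)"
      using E.cdf_is_right_cont[of 0] by (simp add: continuous_within)
    then show "(cdf (distr M borel ?L) \<longlongrightarrow> cdf (density lborel ?f) 0) (at_right 0)"
      by (rule Lim_transform_eventually) (auto simp: eq eventually_at_filter)
  qed simp
  with eq have "cdf (distr M borel ?L) x = cdf (density lborel ?f) x" for x
    by (cases "x = 0") simp_all
  then have "cdf (distr M borel ?L) = cdf (density lborel ?f)" ..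
  then have "distr M borel ?L = density lborel ?f"
    by (intro cdf_unique D.real_distribution_axioms E.real_distribution_axioms)
  moreover have "distr M lborel ?L = distr M borel ?L"
    by (rule distr_cong) simp_all
  ultimately show ?thesis
    using L f by (simp add: distributed_def)
qed

end

section \<open>Nested last zeros\<close>

lemma distributed_cong_space:
  assumes "distributed M N X f" "\<And>\<omega>. \<omega> \<in> space M \<Longrightarrow> Y \<omega> = X \<omega>"
  shows "distributed M N Y f"
proof -
  have "distr M N Y = distr M N X" by (intro distr_cong assms) auto
  moreover have "Y \<in> measurable M N \<longleftrightarrow> X \<in> measurable M N" by (intro measurable_cong assms)
  ultimately show ?thesis using assms(1) by (simp add: distributed_def)
qed

lemma brownian_motion_drift_path:
  assumes "brownian_motion_drift M \<mu> X" "\<omega> \<in> space M"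
  shows "last_zero (\<lambda>s. X s \<omega>) w = rational_last_zero (\<lambda>s\<in>{0..}. X s \<omega>) w"
proof -
  obtain B where B: "standard_brownian_motion M B" "\<And>s \<omega>. 0 \<le> s \<Longrightarrow> \<omega> \<in> space M \<Longrightarrow> X s \<omega> = B s \<omega> + \<mu> * s"
    using assms(1) by (auto simp: brownian_motion_drift_def)
  interpret standard_brownian M B by standard (rule B)
  have "last_zero (\<lambda>s. X s \<omega>) w = last_zero (\<lambda>s. B s \<omega> + \<mu> * s) w"
    unfolding last_zero_def using B(2) assms(2) by (intro arg_cong[where f=Sup]) auto
  also have "\<dots> = rational_last_zero (\<lambda>s\<in>{0..}. B s \<omega> + \<mu> * s) w"
    by (rule last_zero_eq_rational_path[OF assms(2)])
  also have "(\<lambda>s\<in>{0..}. B s \<omega> + \<mu> * s) = (\<lambda>s\<in>{0..}. X s \<omega>)"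
    using B(2) assms(2) by auto
  finally show ?thesis .
qed

lemma brownian_motion_drift_distributed:
  assumes "brownian_motion_drift M \<mu> X" "0 < w"
  shows "distributed M lborel (\<lambda>\<omega>. last_zero (\<lambda>s. X s \<omega>) w)
    (\<lambda>x. ennreal (last_zero_density \<mu> x w) * indicator {0<..<w} x)"
proof -
  obtain B where B: "standard_brownian_motion M B" "\<And>s \<omega>. 0 \<le> s \<Longrightarrow> \<omega> \<in> space M \<Longrightarrow> X s \<omega> = B s \<omega> + \<mu> * s"
    using assms(1) by (auto simp: brownian_motion_drift_def)
  interpret standard_brownian M B by standard (rule B)
  show ?thesis
    using distributed_last_zero[OF assms(2)]
  proof (rule distributed_cong_space)
    fix \<omega> assume "\<omega> \<in> space M"
    then show "last_zero (\<lambda>s. X s \<omega>) w = last_zero (\<lambda>s. B s \<omega> + \<mu> * s) w"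
      unfolding last_zero_def using B(2) by (intro arg_cong[where f=Sup]) auto
  qed
qed

text \<open>The integral of \<open>chain_integral\<close> with each factor drawn out of the inner
  integrals: one more outermost process is one more integration on the left, matching the recursion
  of \<open>nested_last_zero\<close>.\<close>

primrec chain_kernel :: "nat \<Rightarrow> (nat \<Rightarrow> real \<Rightarrow> real \<Rightarrow> real) \<Rightarrow> real \<Rightarrow> real \<Rightarrow> ennreal" where
  "chain_kernel 0 g t a = ennreal (g 1 a t)"
| "chain_kernel (Suc n) g t a =
     (\<integral>\<^sup>+w\<in>{a<..<t}. ennreal (g 1 a w) * chain_kernel n (\<lambda>j. g (Suc j)) t w \<partial>lborel)"

lemma borel_measurable_chain_kernel:
  assumes "\<And>j. (\<lambda>p. g j (fst p) (snd p)) \<in> borel_measurable (borel \<Otimes>\<^sub>M borel)"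
  shows "chain_kernel n g t \<in> borel_measurable borel"
  using assms
proof (induction n arbitrary: g)
  case 0
  then have "(\<lambda>a. g 1 (fst (a, t)) (snd (a, t))) \<in> borel_measurable borel"
    by (intro measurable_compose[OF _ 0]) auto
  then show ?case by simp
next
  case (Suc n)
  note [measurable] = Suc.IH[of "\<lambda>j. g (Suc j)", OF Suc.prems] Suc.prems
  have "(\<lambda>a. \<integral>\<^sup>+w. ennreal (g 1 (fst (a, w)) (snd (a, w))) * chain_kernel n (\<lambda>j. g (Suc j)) t w *
      (if a < w \<and> w < t then 1 else 0) \<partial>lborel) \<in> borel_measurable borel"
    by measurable
  then show ?case
    by (simp add: indicator_greaterThanLessThan)
qed

text \<open>The free constant c carries the induction: the factor g 1 a w, constant for the inner
  integrations, is absorbed into it. Nonnegativity lets \<open>ennreal\<close> split the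
  product.\<close>

lemma iterated_integral_eq_chain_kernel:
  assumes "\<And>j. (\<lambda>p. g j (fst p) (snd p)) \<in> borel_measurable (borel \<Otimes>\<^sub>M borel)"
    and "\<And>j x w. 0 < x \<Longrightarrow> x < w \<Longrightarrow> 0 \<le> g j x w" and "0 < a"
  shows "iterated_integral n a t
      (\<lambda>ws. c * ennreal (\<Prod>j=1..n+1. g j ((a # ws @ [t]) ! (j - 1)) ((a # ws @ [t]) ! j))) =
    c * chain_kernel n g t a"
  using assms
proof (induction n arbitrary: g a c)
  case 0
  then show ?case by simp
next
  case (Suc n)
  note meas [measurable] = Suc.prems(1)
  have [measurable]: "chain_kernel n (\<lambda>j. g (Suc j)) t \<in> borel_measurable borel"
    by (rule borel_measurable_chain_kernel) (rule meas)
  have "(\<lambda>w. g 1 (fst (a, w)) (snd (a, w))) \<in> borel_measurable borel"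
    by (intro measurable_compose[OF _ meas]) auto
  then have [measurable]: "g (Suc 0) a \<in> borel_measurable borel" by simp
  have "iterated_integral n w t
      (\<lambda>ws. c * ennreal (\<Prod>j=1..Suc n+1. g j ((a # (w # ws) @ [t]) ! (j - 1)) ((a # (w # ws) @ [t]) ! j))) =
      c * (ennreal (g 1 a w) * chain_kernel n (\<lambda>j. g (Suc j)) t w)" if "a < w" for w
  proof -
    have "c * ennreal (\<Prod>j=1..Suc n+1. g j ((a # (w # ws) @ [t]) ! (j - 1)) ((a # (w # ws) @ [t]) ! j)) =
        c * ennreal (g 1 a w) * ennreal (\<Prod>j=1..n+1. g (Suc j) ((w # ws @ [t]) ! (j - 1)) ((w # ws @ [t]) ! j))" for ws
    proof -
      let ?h = "\<lambda>j. g j ((a # (w # ws) @ [t]) ! (j - 1)) ((a # (w # ws) @ [t]) ! j)"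
      \<comment> \<open>Factor 1 is split off; for the others the index drops by one, and so does
        the position in the list once a is removed.\<close>
      have "(\<Prod>j=1..Suc n+1. ?h j) = ?h 1 * (\<Prod>j=Suc 1..Suc (n+1). ?h j)"
        by (subst prod.atLeast_Suc_atMost) auto
      also have "(\<Prod>j=Suc 1..Suc (n+1). ?h j) = (\<Prod>j=1..n+1. ?h (Suc j))"
        by (rule prod.shift_bounds_cl_Suc_ivl)
      also have "\<dots> = (\<Prod>j=1..n+1. g (Suc j) ((w # ws @ [t]) ! (j - 1)) ((w # ws @ [t]) ! j))"
        by (intro prod.cong) (auto simp: nth_Cons')
      also have "?h 1 = g 1 a w" by simp
      finally have eq: "(\<Prod>j=1..Suc n+1. ?h j) =
          g 1 a w * (\<Prod>j=1..n+1. g (Suc j) ((w # ws @ [t]) ! (j - 1)) ((w # ws @ [t]) ! j))" .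
      have "0 \<le> g 1 a w" using Suc.prems(2)[of a w 1] Suc.prems(3) that by simp
      then show ?thesis unfolding eq by (simp only: ennreal_mult' mult.assoc)
    qed
    then show ?thesis
      using Suc.IH[of "\<lambda>j. g (Suc j)" w "c * ennreal (g 1 a w)"] Suc.prems that
      by (simp add: mult.assoc)
  qed
  then have "iterated_integral (Suc n) a t
      (\<lambda>ws. c * ennreal (\<Prod>j=1..Suc n+1. g j ((a # ws @ [t]) ! (j - 1)) ((a # ws @ [t]) ! j))) =
      (\<integral>\<^sup>+w. c * (ennreal (g 1 a w) * chain_kernel n (\<lambda>j. g (Suc j)) t w * indicator {a<..<t} w) \<partial>lborel)"
    unfolding iterated_integral.simps
    by (intro nn_integral_cong) (auto simp: mult.assoc split: split_indicator)
  also have "\<dots> = c * chain_kernel (Suc n) g t a"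
    by (subst nn_integral_cmult) auto
  finally show ?case .
qed

lemma chain_integral_eq_chain_kernel:
  assumes "0 < a"
  shows "chain_integral n (\<lambda>j. last_zero_density (\<mu> j)) a t = chain_kernel n (\<lambda>j. last_zero_density (\<mu> j)) t a"
  using iterated_integral_eq_chain_kernel[of "\<lambda>j. last_zero_density (\<mu> j)" a n t 1] assms
    last_zero_density_eq(1) borel_measurable_last_zero_density
  by (simp add: chain_integral_def)

text \<open>Given U = u, the last zero has density f a u on (0, u); independence makes the law of
  the pair a product, and averaging over U followed by Fubini gives the mixture. As U lies in (0, t)
  almost surely, the unspecified value at nonpositive times has no effect.\<close>

lemma (in prob_space) distributed_last_zero_random_time:
  fixes P :: "'a \<Rightarrow> real \<Rightarrow> real" and U :: "'a \<Rightarrow> real"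
  defines "S \<equiv> PiM {0::real..} (\<lambda>_. borel :: real measure)"
  assumes P [measurable]: "P \<in> measurable M S"
    and U: "distributed M lborel U (\<lambda>u. h u * indicator {0<..<t} u)"
    and h [measurable]: "h \<in> borel_measurable borel"
    and indep: "distr M (S \<Otimes>\<^sub>M borel) (\<lambda>\<omega>. (P \<omega>, U \<omega>)) = distr M S P \<Otimes>\<^sub>M distr M borel U"
    and f: "(\<lambda>p. f (fst p) (snd p)) \<in> borel_measurable (borel \<Otimes>\<^sub>M borel)"
    and dist: "\<And>w. 0 < w \<Longrightarrow> distributed M lborel (\<lambda>\<omega>. rational_last_zero (P \<omega>) w)
      (\<lambda>a. ennreal (f a w) * indicator {0<..<w} a)"
  shows "distributed M lborel (\<lambda>\<omega>. rational_last_zero (P \<omega>) (U \<omega>))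
    (\<lambda>a. (\<integral>\<^sup>+w\<in>{a<..<t}. ennreal (f a w) * h w \<partial>lborel) * indicator {0<..<t} a)"
proof -
  have Um [measurable]: "U \<in> borel_measurable M"
    using distributed_measurable[OF U] by simp
  interpret P: prob_space "distr M S P" by (rule prob_space_distr) fact
  interpret U: prob_space "distr M borel U" by (rule prob_space_distr) fact
  interpret PU: pair_prob_space "distr M S P" "distr M borel U" ..
  have rlz [measurable]: "(\<lambda>z. rational_last_zero (fst z) (snd z)) \<in> borel_measurable (S \<Otimes>\<^sub>M borel)"
    unfolding S_def by (rule borel_measurable_rational_last_zero)
  have V [measurable]: "(\<lambda>\<omega>. rational_last_zero (P \<omega>) (U \<omega>)) \<in> borel_measurable M"
    using measurable_compose[OF measurable_Pair[OF P Um] rlz] by simp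
  note [measurable] = f
  have "(\<lambda>a. \<integral>\<^sup>+w. ennreal (f (fst (a, w)) (snd (a, w))) * h w * (if a < w \<and> w < t then 1 else 0) \<partial>lborel)
      \<in> borel_measurable borel"
    by measurable
  then have D [measurable]: "(\<lambda>a. \<integral>\<^sup>+w\<in>{a<..<t}. ennreal (f a w) * h w \<partial>lborel) \<in> borel_measurable borel"
    by (simp add: indicator_greaterThanLessThan)
  have "distr M lborel (\<lambda>\<omega>. rational_last_zero (P \<omega>) (U \<omega>)) =
      density lborel (\<lambda>a. (\<integral>\<^sup>+w\<in>{a<..<t}. ennreal (f a w) * h w \<partial>lborel) * indicator {0<..<t} a)" (is "?L = ?R")
  proof (rule measure_eqI)
    fix A assume "A \<in> sets ?L"
    then have A [measurable]: "A \<in> sets borel" by simp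
    let ?g = "\<lambda>z. indicator A (rational_last_zero (fst z) (snd z)) :: ennreal"
    have g [measurable]: "?g \<in> borel_measurable (S \<Otimes>\<^sub>M borel)" by measurable
    have g' : "?g \<in> borel_measurable (distr M S P \<Otimes>\<^sub>M distr M borel U)"
      using g by (simp cong: measurable_cong_sets sets_pair_measure_cong)
    have inner: "(\<integral>\<^sup>+p. ?g (p, u) \<partial>distr M S P) = (\<integral>\<^sup>+a. ennreal (f a u) * indicator {0<..<u} a * indicator A a \<partial>lborel)"
      if "0 < u" for u
    proof -
      have "(\<lambda>p. ?g (p, u)) \<in> borel_measurable S"
        using measurable_compose[OF measurable_Pair2' g, of u] by simp
      then have "(\<integral>\<^sup>+p. ?g (p, u) \<partial>distr M S P) = (\<integral>\<^sup>+\<omega>. indicator A (rational_last_zero (P \<omega>) u) \<partial>M)"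
        by (subst nn_integral_distr) auto
      also have "\<dots> = (\<integral>\<^sup>+a. ennreal (f a u) * indicator {0<..<u} a * indicator A a \<partial>lborel)"
        by (rule distributed_nn_integral[OF dist[OF that], symmetric]) simp
      finally show ?thesis .
    qed
    have "(\<lambda>(u, p). ?g (p, u)) \<in> borel_measurable (borel \<Otimes>\<^sub>M distr M S P)"
      using measurable_compose[OF measurable_pair_swap' g]
      by (simp add: split_beta cong: measurable_cong_sets sets_pair_measure_cong)
    then have [measurable]: "(\<lambda>u. \<integral>\<^sup>+p. ?g (p, u) \<partial>distr M S P) \<in> borel_measurable borel"
      by (rule P.borel_measurable_nn_integral)
    \<comment> \<open>One condition 0 < a < u < t serves both orders of integration: for fixed u it
      is the support (0, u) in a, for fixed a it is the range (a, t) of u.\<close>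
    let ?k = "\<lambda>u a. ennreal (f a u) * h u * indicator A a * (if 0 < a \<and> a < u \<and> u < t then 1 else 0)"
    have "emeasure ?L A = (\<integral>\<^sup>+\<omega>. ?g (P \<omega>, U \<omega>) \<partial>M)"
      by (subst emeasure_distr) (auto simp: nn_integral_indicator[symmetric] simp del: nn_integral_indicator
          intro!: nn_integral_cong split: split_indicator)
    also have "\<dots> = (\<integral>\<^sup>+z. ?g z \<partial>(distr M S P \<Otimes>\<^sub>M distr M borel U))"
      unfolding indep[symmetric] by (subst nn_integral_distr) auto
    also have "\<dots> = (\<integral>\<^sup>+u. \<integral>\<^sup>+p. ?g (p, u) \<partial>distr M S P \<partial>distr M borel U)"
      by (rule PU.nn_integral_snd[OF g', symmetric])
    also have "\<dots> = (\<integral>\<^sup>+\<omega>. (\<integral>\<^sup>+p. ?g (p, U \<omega>) \<partial>distr M S P) \<partial>M)"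
      by (rule nn_integral_distr) measurable
    also have "\<dots> = (\<integral>\<^sup>+u. h u * indicator {0<..<t} u * (\<integral>\<^sup>+p. ?g (p, u) \<partial>distr M S P) \<partial>lborel)"
      by (rule distributed_nn_integral[OF U, symmetric]) measurable
    also have "\<dots> = (\<integral>\<^sup>+u. \<integral>\<^sup>+a. ?k u a \<partial>lborel \<partial>lborel)"
    proof (rule nn_integral_cong)
      fix u :: real
      have [measurable]: "(\<lambda>a. f a u) \<in> borel_measurable borel"
        using measurable_compose[OF measurable_Pair2' f, of u] by simp
      show "h u * indicator {0<..<t} u * (\<integral>\<^sup>+p. ?g (p, u) \<partial>distr M S P) = (\<integral>\<^sup>+a. ?k u a \<partial>lborel)"
      proof (cases "0 < u \<and> u < t")
        case True
        then have "h u * indicator {0<..<t} u * (\<integral>\<^sup>+p. ?g (p, u) \<partial>distr M S P) =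
            (\<integral>\<^sup>+a. h u * (ennreal (f a u) * indicator {0<..<u} a * indicator A a) \<partial>lborel)"
          using inner[of u] by (simp add: nn_integral_cmult)
        also have "\<dots> = (\<integral>\<^sup>+a. ?k u a \<partial>lborel)"
          using True by (intro nn_integral_cong) (auto simp: mult_ac split: split_indicator)
        finally show ?thesis .
      next
        case False
        then have "(\<integral>\<^sup>+a. ?k u a \<partial>lborel) = (\<integral>\<^sup>+a. 0 \<partial>(lborel :: real measure))"
          by (intro nn_integral_cong) auto
        moreover have "indicator {0<..<t} u = (0::ennreal)" using False by simp
        ultimately show ?thesis by simp
      qed
    qed
    also have "\<dots> = (\<integral>\<^sup>+a. \<integral>\<^sup>+u. ?k u a \<partial>lborel \<partial>lborel)"
    proof (rule lborel_pair.Fubini')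
      have "(\<lambda>p. ennreal (f (snd p) (fst p)) * h (fst p) * indicator A (snd p) *
          (if 0 < snd p \<and> snd p < fst p \<and> fst p < t then 1 else 0)) \<in> borel_measurable (lborel \<Otimes>\<^sub>M lborel)"
        using measurable_compose[OF measurable_pair_swap' f] by (simp add: split_beta)
      then show "(\<lambda>(a, u). ?k u a) \<in> borel_measurable (lborel \<Otimes>\<^sub>M lborel)"
        by (simp add: split_beta)
    qed
    also have "\<dots> = (\<integral>\<^sup>+a. ((\<integral>\<^sup>+w\<in>{a<..<t}. ennreal (f a w) * h w \<partial>lborel) * indicator {0<..<t} a) * indicator A a \<partial>lborel)"
    proof (rule nn_integral_cong)
      fix a :: real
      have [measurable]: "(\<lambda>w. f a w) \<in> borel_measurable borel"
        using measurable_compose[OF measurable_Pair1' f, of a] by simp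
      have "(\<integral>\<^sup>+u. ?k u a \<partial>lborel) =
          (\<integral>\<^sup>+u. ennreal (f a u) * h u * indicator {a<..<t} u * (indicator {0<..<t} a * indicator A a) \<partial>lborel)"
        by (intro nn_integral_cong) (auto split: split_indicator)
      also have "\<dots> = (\<integral>\<^sup>+u. ennreal (f a u) * h u * indicator {a<..<t} u \<partial>lborel) *
          (indicator {0<..<t} a * indicator A a)"
        by (rule nn_integral_multc) measurable
      finally show "(\<integral>\<^sup>+u. ?k u a \<partial>lborel) =
          ((\<integral>\<^sup>+w\<in>{a<..<t}. ennreal (f a w) * h w \<partial>lborel) * indicator {0<..<t} a) * indicator A a"
        by (simp only: mult.assoc)
    qed
    also have "\<dots> = emeasure ?R A"
      by (subst emeasure_density) auto
    finally show "emeasure ?L A = emeasure ?R A" .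
  qed simp
  then show ?thesis by (simp add: distributed_def)
qed

text \<open>F is carried through the induction because the law alone does not give independence: as
  a measurable function of the later paths, the inner last zero is independent of path m. Kernels
  are numbered from 1 and processes from m, whence the index m + j - 1.\<close>

lemma nested_last_zero_distributed:
  fixes X :: "nat \<Rightarrow> real \<Rightarrow> 'a \<Rightarrow> real"
  defines "S \<equiv> PiM {0::real..} (\<lambda>_. borel :: real measure)"
  assumes M: "prob_space M" and t: "0 < t"
    and bm: "\<And>j. j \<in> J \<Longrightarrow> brownian_motion_drift M (\<mu> j) (X j)"
    and indep: "indep_processes M X J"
    and J: "{m..m + k} \<subseteq> J"
  shows "(\<exists>F \<in> borel_measurable (PiM {m..m + k} (\<lambda>_. S)). \<forall>\<omega>\<in>space M.
      nested_last_zero (map (\<lambda>j s. X j s \<omega>) [m..<m + k + 1]) t = F (\<lambda>j\<in>{m..m + k}. \<lambda>s\<in>{0..}. X j s \<omega>)) \<and>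
    distributed M lborel (\<lambda>\<omega>. nested_last_zero (map (\<lambda>j s. X j s \<omega>) [m..<m + k + 1]) t)
      (\<lambda>a. chain_kernel k (\<lambda>j. last_zero_density (\<mu> (m + j - 1))) t a * indicator {0<..<t} a)"
  using J
proof (induction k arbitrary: m)
  interpret prob_space M by fact
  have rlz [measurable]: "(\<lambda>z. rational_last_zero (fst z) (snd z)) \<in> borel_measurable (S \<Otimes>\<^sub>M borel)"
    unfolding S_def by (rule borel_measurable_rational_last_zero)
  {
    case 0
    then have m: "m \<in> J" by simp
    have m1: "(\<lambda>ps. rational_last_zero (ps m) t) \<in> borel_measurable (PiM {m..m + 0} (\<lambda>_. S))"
      using measurable_compose[OF measurable_Pair[OF measurable_component_singleton[of m] measurable_const] rlz, of "{m..m+0}" t]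
      by simp
    have m2: "nested_last_zero (map (\<lambda>j s. X j s \<omega>) [m..<m + 0 + 1]) t =
        rational_last_zero ((\<lambda>j\<in>{m..m + 0}. \<lambda>s\<in>{0..}. X j s \<omega>) m) t" if "\<omega> \<in> space M" for \<omega>
    proof -
      have "(\<lambda>j\<in>{m..m + 0}. \<lambda>s\<in>{0..}. X j s \<omega>) m = (\<lambda>s\<in>{0..}. X m s \<omega>)"
        by (subst restrict_apply') simp_all
      then show ?thesis
        using brownian_motion_drift_path[OF bm[OF m] that, of t] by simp
    qed
    have m3: "distributed M lborel (\<lambda>\<omega>. nested_last_zero (map (\<lambda>j s. X j s \<omega>) [m..<m + 0 + 1]) t)
        (\<lambda>a. chain_kernel 0 (\<lambda>j. last_zero_density (\<mu> (m + j - 1))) t a * indicator {0<..<t} a)"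
      using brownian_motion_drift_distributed[OF bm[OF m] t] by simp
    show ?case by (intro conjI bexI[OF _ m1] ballI m2 m3)
  next
    case (Suc k)
    let ?A = "{m..m + Suc k}" and ?A' = "{Suc m..Suc m + k}"
    let ?paths = "\<lambda>\<omega> j. \<lambda>s\<in>{0..}. X j s \<omega>"
    let ?U = "\<lambda>\<omega>. nested_last_zero (map (\<lambda>j s. X j s \<omega>) [Suc m..<Suc m + k + 1]) t"
    let ?h = "chain_kernel k (\<lambda>j. last_zero_density (\<mu> (Suc m + j - 1))) t"
    have m: "m \<in> J" and A': "?A' \<subseteq> J" using Suc.prems by auto
    from Suc.IH[OF A'] obtain F where F [measurable]: "F \<in> borel_measurable (PiM ?A' (\<lambda>_. S))"
      and FU: "\<And>\<omega>. \<omega> \<in> space M \<Longrightarrow> ?U \<omega> = F (\<lambda>j\<in>?A'. ?paths \<omega> j)"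
      and U: "distributed M lborel ?U (\<lambda>a. ?h a * indicator {0<..<t} a)"
      by blast
    have "indep_vars (\<lambda>_. S) (\<lambda>j \<omega>. ?paths \<omega> j) J"
      using indep by (simp add: indep_processes_def S_def)
    then have ind: "indep_var (PiM {m} (\<lambda>_. S)) (\<lambda>\<omega>. restrict (\<lambda>j. ?paths \<omega> j) {m})
        (PiM ?A' (\<lambda>_. S)) (\<lambda>\<omega>. restrict (\<lambda>j. ?paths \<omega> j) ?A')"
      using m A' by (intro indep_var_restrict) auto
    have path_m: "restrict (\<lambda>j. ?paths \<omega> j) {m} m = ?paths \<omega> m" for \<omega>
      by (rule restrict_apply') simp
    have P [measurable]: "(\<lambda>\<omega>. ?paths \<omega> m) \<in> measurable M S"
      using measurable_compose[OF indep_var_rv1[OF ind] measurable_component_singleton[of m]] by simp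
    have "distr M (S \<Otimes>\<^sub>M borel) (\<lambda>\<omega>. (?paths \<omega> m, F (\<lambda>j\<in>?A'. ?paths \<omega> j))) =
        distr M S (\<lambda>\<omega>. ?paths \<omega> m) \<Otimes>\<^sub>M distr M borel (\<lambda>\<omega>. F (\<lambda>j\<in>?A'. ?paths \<omega> j))"
      using distr_pair_indep_compose[OF ind measurable_component_singleton[of m "{m}" "\<lambda>_. S", OF singletonI] F]
      unfolding path_m .
    also have "distr M (S \<Otimes>\<^sub>M borel) (\<lambda>\<omega>. (?paths \<omega> m, F (\<lambda>j\<in>?A'. ?paths \<omega> j))) =
        distr M (S \<Otimes>\<^sub>M borel) (\<lambda>\<omega>. (?paths \<omega> m, ?U \<omega>))"
      by (intro distr_cong refl) (simp_all only: FU)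
    also have "distr M borel (\<lambda>\<omega>. F (\<lambda>j\<in>?A'. ?paths \<omega> j)) = distr M borel ?U"
      by (intro distr_cong refl) (simp_all only: FU)
    finally have PU: "distr M (S \<Otimes>\<^sub>M borel) (\<lambda>\<omega>. (?paths \<omega> m, ?U \<omega>)) =
        distr M S (\<lambda>\<omega>. ?paths \<omega> m) \<Otimes>\<^sub>M distr M borel ?U" .
    have "distributed M lborel (\<lambda>\<omega>. rational_last_zero (?paths \<omega> m) (?U \<omega>))
      (\<lambda>a. (\<integral>\<^sup>+w\<in>{a<..<t}. ennreal (last_zero_density (\<mu> m) a w) * ?h w \<partial>lborel) * indicator {0<..<t} a)"
    proof (rule distributed_last_zero_random_time[OF P[unfolded S_def] U _ PU[unfolded S_def]])
      show "?h \<in> borel_measurable borel"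
        by (rule borel_measurable_chain_kernel) (rule borel_measurable_last_zero_density)
      fix w :: real assume "0 < w"
      from brownian_motion_drift_distributed[OF bm[OF m] this]
      show "distributed M lborel (\<lambda>\<omega>. rational_last_zero (?paths \<omega> m) w)
          (\<lambda>a. ennreal (last_zero_density (\<mu> m) a w) * indicator {0<..<w} a)"
        by (rule distributed_cong_space) (simp add: brownian_motion_drift_path[OF bm[OF m]])
    qed (rule borel_measurable_last_zero_density)
    moreover have nested: "nested_last_zero (map (\<lambda>j s. X j s \<omega>) [m..<m + Suc k + 1]) t =
        rational_last_zero (?paths \<omega> m) (?U \<omega>)" if "\<omega> \<in> space M" for \<omega>
    proof -
      have "[m..<m + Suc k + 1] = m # [Suc m..<Suc m + k + 1]" by (simp add: upt_conv_Cons)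
      then show ?thesis
        using brownian_motion_drift_path[OF bm[OF m] that] by simp
    qed
    ultimately have D: "distributed M lborel (\<lambda>\<omega>. nested_last_zero (map (\<lambda>j s. X j s \<omega>) [m..<m + Suc k + 1]) t)
      (\<lambda>a. chain_kernel (Suc k) (\<lambda>j. last_zero_density (\<mu> (m + j - 1))) t a * indicator {0<..<t} a)"
      by (intro distributed_cong_space[OF _ nested]) simp_all
    let ?G = "\<lambda>ps. rational_last_zero (ps m) (F (\<lambda>j\<in>?A'. ps j))"
    have m1: "?G \<in> borel_measurable (PiM ?A (\<lambda>_. S))"
    proof -
      have a: "(\<lambda>ps. ps m) \<in> measurable (PiM ?A (\<lambda>_. S)) S"
        by (rule measurable_component_singleton) simp
      have b: "(\<lambda>ps. F (\<lambda>j\<in>?A'. ps j)) \<in> borel_measurable (PiM ?A (\<lambda>_. S))"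
        by (intro measurable_compose[OF _ F] measurable_restrict measurable_component_singleton) auto
      show ?thesis
        using measurable_compose[OF measurable_Pair[OF a b] rlz] by simp
    qed
    have m2: "nested_last_zero (map (\<lambda>j s. X j s \<omega>) [m..<m + Suc k + 1]) t = ?G (\<lambda>j\<in>?A. ?paths \<omega> j)"
      if "\<omega> \<in> space M" for \<omega>
    proof -
      have "(\<lambda>j\<in>?A'. (\<lambda>j\<in>?A. ?paths \<omega> j) j) = (\<lambda>j\<in>?A'. ?paths \<omega> j)" by (auto simp: restrict_def fun_eq_iff)
      then show ?thesis using nested[OF that] FU[OF that] by simp
    qed
    show ?case by (intro conjI bexI[OF _ m1] ballI m2 D)
  }
qed

theorem mainTheorem9:
  fixes M :: "'a measure"
    and X :: "nat \<Rightarrow> real \<Rightarrow> 'a \<Rightarrow> real"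
    and \<mu> :: "nat \<Rightarrow> real"
    and n :: nat and t :: real
    and T :: "'a \<Rightarrow> real"
  assumes "n \<ge> 1" and "t > 0"
    and "prob_space M"
    and "\<And>j. j \<in> {1..n+1} \<Longrightarrow> brownian_motion_drift M (\<mu> j) (X j)"
    and "indep_processes M X {1..n+1}"
    and "T = (\<lambda>\<omega>. nested_last_zero (map (\<lambda>j s. X j s \<omega>) [1..<n+2]) t)"
  shows "(\<forall>j\<in>{1..n+1}. \<forall>w>0.
           distributed M lborel (\<lambda>\<omega>. last_zero (\<lambda>s. X j s \<omega>) w)
             (\<lambda>x. ennreal (last_zero_density (\<mu> j) x w) * indicator {0<..<w} x)) \<and>
         distributed M lborel T
           (\<lambda>a. chain_integral n (\<lambda>j. last_zero_density (\<mu> j)) a t * indicator {0<..<t} a) \<and>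
         ((\<forall>j\<in>{1..n+1}. \<mu> j = 0) \<longrightarrow>
            distributed M lborel T
             (\<lambda>a. chain_integral n (\<lambda>j x w. 1 / (pi * sqrt (x * (w - x)))) a t * indicator {0<..<t} a))"
proof (intro conjI ballI allI impI)
  fix j w assume "j \<in> {1..n+1}" "0 < (w::real)"
  then show "distributed M lborel (\<lambda>\<omega>. last_zero (\<lambda>s. X j s \<omega>) w)
      (\<lambda>x. ennreal (last_zero_density (\<mu> j) x w) * indicator {0<..<w} x)"
    by (intro brownian_motion_drift_distributed assms)
next
  have "distributed M lborel T (\<lambda>a. chain_kernel n (\<lambda>j. last_zero_density (\<mu> j)) t a * indicator {0<..<t} a)"
    \<comment> \<open>With m = 1 and k = n the index m + j - 1 is j.\<close>
    using nested_last_zero_distributed[OF assms(3,2,4,5), of 1 n] by (simp add: assms(6))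
  moreover have "(\<lambda>a. chain_kernel n (\<lambda>j. last_zero_density (\<mu> j)) t a * indicator {0<..<t} a) =
      (\<lambda>a. chain_integral n (\<lambda>j. last_zero_density (\<mu> j)) a t * indicator {0<..<t} a)"
    \<comment> \<open>The kernel identity is available for 0 < a; elsewhere the indicator makes both
      sides 0.\<close>
    by (auto simp: fun_eq_iff chain_integral_eq_chain_kernel split: split_indicator)
  ultimately show T: "distributed M lborel T
      (\<lambda>a. chain_integral n (\<lambda>j. last_zero_density (\<mu> j)) a t * indicator {0<..<t} a)"
    by simp
  assume "\<forall>j\<in>{1..n+1}. \<mu> j = 0"
  \<comment> \<open>Without drift the exponential is 1 and the integral term has coefficient 0, so
    the integrands agree at all arguments.\<close>
  then have "chain_integral n (\<lambda>j. last_zero_density (\<mu> j)) a t =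
      chain_integral n (\<lambda>j x w. 1 / (pi * sqrt (x * (w - x)))) a t" for a
    unfolding chain_integral_def
    by (intro arg_cong[where f="iterated_integral n a t"] ext arg_cong[where f=ennreal] prod.cong)
       (auto simp: last_zero_density_def)
  with T show "distributed M lborel T
      (\<lambda>a. chain_integral n (\<lambda>j x w. 1 / (pi * sqrt (x * (w - x)))) a t * indicator {0<..<t} a)"
    by simp
qed

end
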